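(* Let $\mu\in\mathbb{M}$ and let $u$ be a solution of $-Au=\mu$. If $u\ge0$, then $\mu_c\ge0$.
   Context: Setting. $E$ is a locally compact separable metric space, $m$ is a positive Radon measure on $E$ with $\mathrm{supp}[m]=E$, and $(\mathcal{E},D[\mathcal{E}])$ is a symmetric regular Dirichlet form on $L^2(E;m)$, assumed transient: there is a strictly positive function $g$ on $E$ with $\int_E|u|g\,dm\le\sqrt{\mathcal{E}(u,u)}$ for $u\in D[\mathcal{E}]$. $A$ is the associated negative definite self-adjoint operator: $D(A)\subset D[\mathcal{E}]$, $\mathcal{E}(u,v)=(-Au,v)$ for $u\in D(A)$, $v\in D[\mathcal{E}]$. $\mathbb{X}=((X_t)_{t\ge0},(P_x)_{x\in E},(\mathcal{F}_t)_{t\ge0},\zeta)$ is the associated symmetric Hunt process with life time $\zeta$; $E_x$ is expectation under $P_x$. For $\alpha\ge0$, $R_\alpha h(x)=E_x\int_0^\zeta e^{-\alpha t}h(X_t)\,dt$, and $R=R_0$. It is assumed that $R_\alpha(x,\cdot)\ll m$ for all $x\in E$, $\alpha>0$. Hence for every $\alpha\ge0$ there is a symmetric Borel kernel $r_\alpha:E\times E\to[0,\infty]$, $\alpha$-excessive in each variable, with $R_\alpha h(x)=\int_E h(y)r_\alpha(x,y)\,m(dy)$; put $r=r_0$. For a Borel measure $\mu$, $R\mu(x)=\int_E r(x,y)\,\mu(dy)$ (with the convention that this is $0$ if the integrals with respect to $\mu^+$ and $\mu^-$ are both infinite). "Measurable" functions on $E$ are universally measurable. Capacity: $\mathrm{Cap}(U)=\inf\{\mathcal{E}(u,u):u\in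 D[\mathcal{E}],\,u\ge\mathbf{1}_U\ m\text{-a.e.}\}$ for open $U$, and $\mathrm{Cap}(B)=\inf\{\mathrm{Cap}(U):B\subset U,\ U\text{ open}\}$ for arbitrary $B\subset E$; "q.e." means outside a set of capacity zero. Measures: Borel measures are signed and possibly unbounded, $|\mu|=\mu^++\mu^-$. $\mathbb{M}$ is the class of Borel measures $\mu$ on $E$ with $R|\mu|(x)<\infty$ for q.e. $x\in E$. Each such $\mu$ has the unique decomposition $\mu=\mu_c+\mu_d$, where $\mu_d$ does not charge sets of zero capacity and $\mu_c$ is concentrated on a set of zero capacity. A measurable numerical ($[-\infty,\infty]$-valued) function $u$ on $E$ is a solution of $-Au=\mu$ if $u(x)=\int_E r(x,y)\,\mu(dy)$ for q.e. $x\in E$. *)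

theory Defs
  imports "HOL-Probability.Probability"
begin

section \<open>The state space and its reference measure\<close>

definition radon_measure :: "'a::metric_space measure \<Rightarrow> bool" where
  "radon_measure m \<longleftrightarrow> sets m = sets borel \<and> (\<forall>K. compact K \<longrightarrow> emeasure m K < \<infinity>)"

definition full_support :: "'a::metric_space measure \<Rightarrow> bool" where
  "full_support m \<longleftrightarrow> (\<forall>U. open U \<longrightarrow> U \<noteq> {} \<longrightarrow> emeasure m U > 0)"

definition universally_measurable :: "('a::topological_space \<Rightarrow> 'b::topological_space) \<Rightarrow> bool" where
  "universally_measurable f \<longleftrightarrow>
     (\<forall>\<nu>. prob_space \<nu> \<longrightarrow> sets \<nu> = sets borel \<longrightarrow> f \<in> borel_measurable (completion \<nu>))"


section \<open>Dirichlet forms\<close>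

text \<open>Elements of $L^2(E;m)$ are represented by Borel functions; a form domain is a set of
  representatives that is closed under modification on \<open>m\<close>-null sets.\<close>

definition L2 :: "'a measure \<Rightarrow> ('a \<Rightarrow> real) set" where
  "L2 m = {f \<in> borel_measurable m. integrable m (\<lambda>x. (f x)\<^sup>2)}"

definition L2_inner :: "'a measure \<Rightarrow> ('a \<Rightarrow> real) \<Rightarrow> ('a \<Rightarrow> real) \<Rightarrow> real" where
  "L2_inner m f g = (\<integral>x. f x * g x \<partial>m)"

text \<open>The squared norm of the Hilbert space \<open>D\<close>, namely $\mathcal{E}_1(u,u)$.\<close>

definition form1 ::
  "'a measure \<Rightarrow> (('a \<Rightarrow> real) \<Rightarrow> ('a \<Rightarrow> real) \<Rightarrow> real) \<Rightarrow> ('a \<Rightarrow> real) \<Rightarrow> real" where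
  "form1 m \<E> u = \<E> u u + L2_inner m u u"

locale dirichlet_form =
  fixes m :: "'a measure"
    and D :: "('a \<Rightarrow> real) set"
    and \<E> :: "('a \<Rightarrow> real) \<Rightarrow> ('a \<Rightarrow> real) \<Rightarrow> real"
  assumes domain_L2: "D \<subseteq> L2 m"
    and domain_zero: "(\<lambda>x. 0) \<in> D"
    and domain_add: "u \<in> D \<Longrightarrow> v \<in> D \<Longrightarrow> (\<lambda>x. u x + v x) \<in> D"
    and domain_scale: "u \<in> D \<Longrightarrow> (\<lambda>x. c * u x) \<in> D"
    and domain_AE: "u \<in> D \<Longrightarrow> v \<in> borel_measurable m \<Longrightarrow> AE x in m. u x = v x \<Longrightarrow> v \<in> D"
    and domain_dense: "f \<in> L2 m \<Longrightarrow> 0 < e \<Longrightarrow>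
           \<exists>u\<in>D. L2_inner m (\<lambda>x. f x - u x) (\<lambda>x. f x - u x) < e"
    and form_AE: "u \<in> D \<Longrightarrow> v \<in> D \<Longrightarrow> w \<in> D \<Longrightarrow> AE x in m. u x = v x \<Longrightarrow> \<E> u w = \<E> v w"
    and form_sym: "u \<in> D \<Longrightarrow> v \<in> D \<Longrightarrow> \<E> u v = \<E> v u"
    and form_add: "u \<in> D \<Longrightarrow> v \<in> D \<Longrightarrow> w \<in> D \<Longrightarrow> \<E> (\<lambda>x. u x + v x) w = \<E> u w + \<E> v w"
    and form_scale: "u \<in> D \<Longrightarrow> w \<in> D \<Longrightarrow> \<E> (\<lambda>x. c * u x) w = c * \<E> u w"
    and form_nonneg: "u \<in> D \<Longrightarrow> 0 \<le> \<E> u u"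
    and form_closed: "(\<And>n. U n \<in> D) \<Longrightarrow>
           (\<And>e. 0 < e \<Longrightarrow> \<exists>N. \<forall>i\<ge>N. \<forall>j\<ge>N. form1 m \<E> (\<lambda>x. U i x - U j x) < e) \<Longrightarrow>
           \<exists>u\<in>D. (\<lambda>n. form1 m \<E> (\<lambda>x. U n x - u x)) \<longlonglongrightarrow> 0"
    and form_markov: "u \<in> D \<Longrightarrow>
           (\<lambda>x. min (max (u x) 0) 1) \<in> D \<and>
           \<E> (\<lambda>x. min (max (u x) 0) 1) (\<lambda>x. min (max (u x) 0) 1) \<le> \<E> u u"

definition Cc :: "('a::metric_space \<Rightarrow> real) set" where
  "Cc = {f. continuous_on UNIV f \<and> compact (closure {x. f x \<noteq> 0})}"

definition regular_form ::
  "'a::metric_space measure \<Rightarrow> ('a \<Rightarrow> real) set \<Rightarrow> (('a \<Rightarrow> real) \<Rightarrow> ('a \<Rightarrow> real) \<Rightarrow> real) \<Rightarrow> bool" where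
  "regular_form m D \<E> \<longleftrightarrow>
     (\<forall>u\<in>D. \<forall>e>0. \<exists>f\<in>D \<inter> Cc. form1 m \<E> (\<lambda>x. u x - f x) < e) \<and>
     (\<forall>g\<in>Cc. \<forall>e>0. \<exists>f\<in>D \<inter> Cc. \<forall>x. \<bar>g x - f x\<bar> < e)"

definition transient_form ::
  "'a measure \<Rightarrow> ('a \<Rightarrow> real) set \<Rightarrow> (('a \<Rightarrow> real) \<Rightarrow> ('a \<Rightarrow> real) \<Rightarrow> real) \<Rightarrow> bool" where
  "transient_form m D \<E> \<longleftrightarrow>
     (\<exists>g\<in>borel_measurable m. (\<forall>x. 0 < g x) \<and>
        (\<forall>u\<in>D. (\<integral>\<^sup>+x. ennreal (\<bar>u x\<bar> * g x) \<partial>m) \<le> ennreal (sqrt (\<E> u u))))"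

text \<open>The graph of the self-adjoint operator \<open>A\<close> of the form: \<open>generator m D \<E> u f\<close> says that
  \<open>u\<close> belongs to the domain of \<open>A\<close> and \<open>A u = f\<close> holds \<open>m\<close>-a.e.\<close>

definition generator ::
  "'a measure \<Rightarrow> ('a \<Rightarrow> real) set \<Rightarrow> (('a \<Rightarrow> real) \<Rightarrow> ('a \<Rightarrow> real) \<Rightarrow> real)
     \<Rightarrow> ('a \<Rightarrow> real) \<Rightarrow> ('a \<Rightarrow> real) \<Rightarrow> bool" where
  "generator m D \<E> u f \<longleftrightarrow>
     u \<in> D \<and> f \<in> L2 m \<and> (\<forall>v\<in>D. \<E> u v = L2_inner m (\<lambda>x. - f x) v)"


section \<open>Capacity\<close>

definition open_capacity ::
  "'a::metric_space measure \<Rightarrow> ('a \<Rightarrow> real) set \<Rightarrow> (('a \<Rightarrow> real) \<Rightarrow> ('a \<Rightarrow> real) \<Rightarrow> real)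
     \<Rightarrow> 'a set \<Rightarrow> ennreal" where
  "open_capacity m D \<E> U = (INF u\<in>{u \<in> D. AE x in m. indicator U x \<le> u x}. ennreal (\<E> u u))"

definition capacity ::
  "'a::metric_space measure \<Rightarrow> ('a \<Rightarrow> real) set \<Rightarrow> (('a \<Rightarrow> real) \<Rightarrow> ('a \<Rightarrow> real) \<Rightarrow> real)
     \<Rightarrow> 'a set \<Rightarrow> ennreal" where
  "capacity m D \<E> B = (INF U\<in>{U. open U \<and> B \<subseteq> U}. open_capacity m D \<E> U)"

definition quasi_everywhere ::
  "'a::metric_space measure \<Rightarrow> ('a \<Rightarrow> real) set \<Rightarrow> (('a \<Rightarrow> real) \<Rightarrow> ('a \<Rightarrow> real) \<Rightarrow> real)
     \<Rightarrow> ('a \<Rightarrow> bool) \<Rightarrow> bool" where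
  "quasi_everywhere m D \<E> Q \<longleftrightarrow> (\<exists>N. capacity m D \<E> N = 0 \<and> (\<forall>x. x \<notin> N \<longrightarrow> Q x))"


section \<open>Hunt processes\<close>

text \<open>The state space with cemetery is \<^typ>\<open>'a option\<close>, where \<^term>\<open>None\<close> is the cemetery, with the
  topology of \<^const>\<open>Alexandroff_compactification\<close> (in which \<^term>\<open>None\<close> is isolated if \<open>E\<close> is
  compact) and the \<open>\<sigma>\<close>-algebra consisting of \<open>B\<close> and \<open>B \<union> {None}\<close> for Borel \<open>B\<close>.
  The time set $[0,\infty]$ is \<^typ>\<open>ennreal\<close>, and the process is in the cemetery at time \<open>\<infinity>\<close>.\<close>

definition cemetery_borel :: "'a::topological_space option measure" where
  "cemetery_borel = sigma UNIV {B. Some -` B \<in> sets borel}"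

abbreviation cemetery_topology :: "'a::topological_space option topology" where
  "cemetery_topology \<equiv> Alexandroff_compactification euclidean"

definition lifetime :: "(ennreal \<Rightarrow> 'w \<Rightarrow> 'a option) \<Rightarrow> 'w \<Rightarrow> ennreal" where
  "lifetime X \<omega> = Inf {t. X t \<omega> = None}"

text \<open>\<open>M\<close> carries the \<open>\<sigma>\<close>-algebra on the sample space on which all the laws \<open>P x\<close> live, and
  \<open>F\<close> is the filtration. The strong Markov property at constant times is the Markov property.
  Strong Markov property and quasi-left-continuity under all \<open>P x\<close> give the same under every
  initial law by integration.\<close>

locale hunt_process = filtration "space M" F
  for M :: "'w measure" and F :: "ennreal \<Rightarrow> 'w measure" +
  fixes P :: "'a::metric_space option \<Rightarrow> 'w measure"
    and X :: "ennreal \<Rightarrow> 'w \<Rightarrow> 'a option"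
  assumes prob: "prob_space (P x)"
    and sets_P: "sets (P x) = sets M"
    and filtration_sub: "sets (F t) \<subseteq> sets M"
    and filtration_right_cont: "t < \<infinity> \<Longrightarrow> sets (F t) = (\<Inter>s\<in>{t<..}. sets (F s))"
    and adapted: "X t \<in> F t \<rightarrow>\<^sub>M cemetery_borel"
    and kernel_measurable: "B \<in> sets cemetery_borel \<Longrightarrow>
           (\<lambda>x. emeasure (P (Some x)) {\<omega> \<in> space M. X t \<omega> \<in> B}) \<in> borel_measurable borel"
    and normal: "AE \<omega> in P x. X 0 \<omega> = x"
    and cemetery_trap: "AE \<omega> in P None. X t \<omega> = None"
    and at_infinity: "\<omega> \<in> space M \<Longrightarrow> X \<infinity> \<omega> = None"
    and dead_after_lifetime: "\<omega> \<in> space M \<Longrightarrow> lifetime X \<omega> \<le> t \<Longrightarrow> X t \<omega> = None"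
    and shifts: "t < \<infinity> \<Longrightarrow> \<exists>\<theta>. \<forall>\<omega>\<in>space M. \<theta> \<omega> \<in> space M \<and> (\<forall>s. X s (\<theta> \<omega>) = X (s + t) \<omega>)"
    and right_cont: "\<omega> \<in> space M \<Longrightarrow> t < \<infinity> \<Longrightarrow>
           limitin cemetery_topology (\<lambda>s. X s \<omega>) (X t \<omega>) (at_right t)"
    and left_lim: "\<omega> \<in> space M \<Longrightarrow> 0 < t \<Longrightarrow> t < \<infinity> \<Longrightarrow>
           \<exists>l. limitin cemetery_topology (\<lambda>s. X s \<omega>) l (at_left t)"
    and strong_markov: "stopping_time F T \<Longrightarrow> \<Lambda> \<in> sets (filtration.pre_sigma (space M) F T) \<Longrightarrow>
           B \<in> sets cemetery_borel \<Longrightarrow>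
           emeasure (P x) {\<omega> \<in> \<Lambda>. X (T \<omega> + s) \<omega> \<in> B} =
           (\<integral>\<^sup>+\<omega>. indicator \<Lambda> \<omega> * emeasure (P (X (T \<omega>) \<omega>)) {\<omega>' \<in> space M. X s \<omega>' \<in> B} \<partial>P x)"
    and quasi_left_cont: "(\<And>n. stopping_time F (S n)) \<Longrightarrow>
           (\<And>\<omega>. \<omega> \<in> space M \<Longrightarrow> incseq (\<lambda>n. S n \<omega>)) \<Longrightarrow>
           AE \<omega> in P x. (SUP n. S n \<omega>) < \<infinity> \<longrightarrow>
             limitin cemetery_topology (\<lambda>n. X (S n \<omega>) \<omega>) (X (SUP n. S n \<omega>) \<omega>) sequentially"

text \<open>Functions on \<open>E\<close> are extended by \<open>0\<close> to the cemetery.\<close>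

definition transition ::
  "('a option \<Rightarrow> 'w measure) \<Rightarrow> (ennreal \<Rightarrow> 'w \<Rightarrow> 'a option) \<Rightarrow> ennreal \<Rightarrow> ('a \<Rightarrow> ennreal) \<Rightarrow> 'a \<Rightarrow> ennreal"
where
  "transition P X t h x = (\<integral>\<^sup>+\<omega>. case_option 0 h (X t \<omega>) \<partial>P (Some x))"

definition resolvent ::
  "('a option \<Rightarrow> 'w measure) \<Rightarrow> (ennreal \<Rightarrow> 'w \<Rightarrow> 'a option) \<Rightarrow> real \<Rightarrow> ('a \<Rightarrow> ennreal) \<Rightarrow> 'a \<Rightarrow> ennreal"
where
  "resolvent P X \<alpha> h x =
     (\<integral>\<^sup>+\<omega>. (\<integral>\<^sup>+t. indicator {t. 0 \<le> t \<and> ennreal t < lifetime X \<omega>} t *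
                   (ennreal (exp (- \<alpha> * t)) * case_option 0 h (X (ennreal t) \<omega>)) \<partial>lborel) \<partial>P (Some x))"

definition resolvent_real ::
  "('a option \<Rightarrow> 'w measure) \<Rightarrow> (ennreal \<Rightarrow> 'w \<Rightarrow> 'a option) \<Rightarrow> real \<Rightarrow> ('a \<Rightarrow> real) \<Rightarrow> 'a \<Rightarrow> real"
where
  "resolvent_real P X \<alpha> f x =
     enn2real (resolvent P X \<alpha> (\<lambda>y. ennreal (max (f y) 0)) x)
     - enn2real (resolvent P X \<alpha> (\<lambda>y. ennreal (max (- f y) 0)) x)"

definition symmetric_process ::
  "'a::metric_space measure \<Rightarrow> ('a option \<Rightarrow> 'w measure) \<Rightarrow> (ennreal \<Rightarrow> 'w \<Rightarrow> 'a option) \<Rightarrow> bool" where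
  "symmetric_process m P X \<longleftrightarrow>
     (\<forall>t<\<infinity>. \<forall>f\<in>borel_measurable borel. \<forall>g\<in>borel_measurable borel.
        (\<integral>\<^sup>+x. transition P X t f x * g x \<partial>m) = (\<integral>\<^sup>+x. f x * transition P X t g x \<partial>m))"

text \<open>The process is associated with the form if its resolvent on $L^2(E;m)$ is that of \<open>A\<close>, i.e.\
  $R_\alpha f = (\alpha - A)^{-1} f$: $R_\alpha f$ is in the domain of \<open>A\<close> and
  $A R_\alpha f = \alpha R_\alpha f - f$.\<close>

definition associated_process ::
  "'a::metric_space measure \<Rightarrow> ('a \<Rightarrow> real) set \<Rightarrow> (('a \<Rightarrow> real) \<Rightarrow> ('a \<Rightarrow> real) \<Rightarrow> real)
     \<Rightarrow> ('a option \<Rightarrow> 'w measure) \<Rightarrow> (ennreal \<Rightarrow> 'w \<Rightarrow> 'a option) \<Rightarrow> bool" where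
  "associated_process m D \<E> P X \<longleftrightarrow>
     (\<forall>\<alpha>>0. \<forall>f\<in>L2 m. generator m D \<E> (resolvent_real P X \<alpha> f)
        (\<lambda>x. \<alpha> * resolvent_real P X \<alpha> f x - f x))"

definition absolutely_continuous_resolvent ::
  "'a::metric_space measure \<Rightarrow> ('a option \<Rightarrow> 'w measure) \<Rightarrow> (ennreal \<Rightarrow> 'w \<Rightarrow> 'a option) \<Rightarrow> bool" where
  "absolutely_continuous_resolvent m P X \<longleftrightarrow>
     (\<forall>\<alpha>>0. \<forall>x. \<forall>B\<in>sets borel. emeasure m B = 0 \<longrightarrow> resolvent P X \<alpha> (indicator B) x = 0)"

definition excessive ::
  "('a::metric_space option \<Rightarrow> 'w measure) \<Rightarrow> (ennreal \<Rightarrow> 'w \<Rightarrow> 'a option) \<Rightarrow> real \<Rightarrow> ('a \<Rightarrow> ennreal) \<Rightarrow> bool"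
where
  "excessive P X \<alpha> f \<longleftrightarrow> universally_measurable f \<and>
     (\<forall>x. (\<forall>t\<ge>0. ennreal (exp (- \<alpha> * t)) * transition P X (ennreal t) f x \<le> f x) \<and>
          ((\<lambda>t. ennreal (exp (- \<alpha> * t)) * transition P X (ennreal t) f x) \<longlongrightarrow> f x) (at_right 0))"

text \<open>These conditions determine the kernels \<open>r \<alpha>\<close> at every point.\<close>

definition resolvent_kernel ::
  "'a::metric_space measure \<Rightarrow> ('a option \<Rightarrow> 'w measure) \<Rightarrow> (ennreal \<Rightarrow> 'w \<Rightarrow> 'a option)
     \<Rightarrow> (real \<Rightarrow> 'a \<Rightarrow> 'a \<Rightarrow> ennreal) \<Rightarrow> bool" where
  "resolvent_kernel m P X r \<longleftrightarrow>
     (\<forall>\<alpha>\<ge>0. (\<lambda>(x, y). r \<alpha> x y) \<in> borel_measurable borel \<and>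
        (\<forall>x y. r \<alpha> x y = r \<alpha> y x) \<and>
        (\<forall>y. excessive P X \<alpha> (\<lambda>x. r \<alpha> x y)) \<and>
        (\<forall>x. excessive P X \<alpha> (\<lambda>y. r \<alpha> x y)) \<and>
        (\<forall>h\<in>borel_measurable borel. \<forall>x. resolvent P X \<alpha> h x = (\<integral>\<^sup>+y. h y * r \<alpha> x y \<partial>m)))"


section \<open>Signed Borel measures, potentials and solutions\<close>

text \<open>A signed Borel measure whose positive and negative part may both be infinite is not a set
  function on all Borel sets; it is represented by its Jordan parts, which are mutually singular.\<close>

datatype 'a smeasure = SMeasure (pos_part: "'a measure") (neg_part: "'a measure")

definition signed_borel :: "'a::metric_space smeasure \<Rightarrow> bool" where
  "signed_borel \<mu> \<longleftrightarrow> sets (pos_part \<mu>) = sets borel \<and> sets (neg_part \<mu>) = sets borel \<and>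
     (\<exists>S\<in>sets borel. emeasure (pos_part \<mu>) (- S) = 0 \<and> emeasure (neg_part \<mu>) S = 0)"

definition tvar :: "'a::metric_space smeasure \<Rightarrow> 'a measure" where
  "tvar \<mu> = measure_of UNIV (sets borel) (\<lambda>B. emeasure (pos_part \<mu>) B + emeasure (neg_part \<mu>) B)"

lemma sets_tvar [simp, measurable_cong]: "sets (tvar \<mu>) = sets borel"
  using sets.sigma_sets_eq[of "borel :: 'a measure"] by (simp add: tvar_def)

lemma emeasure_tvar:
  assumes "signed_borel \<mu>" and "B \<in> sets borel"
  shows "emeasure (tvar \<mu>) B = emeasure (pos_part \<mu>) B + emeasure (neg_part \<mu>) B"
proof (rule emeasure_measure_of[OF tvar_def])
  show "countably_additive (sets (tvar \<mu>)) (\<lambda>B. emeasure (pos_part \<mu>) B + emeasure (neg_part \<mu>) B)"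
  proof (rule countably_additiveI)
    fix A :: "nat \<Rightarrow> 'a set"
    assume A: "range A \<subseteq> sets (tvar \<mu>)" and disj: "disjoint_family A"
    then show "(\<Sum>i. emeasure (pos_part \<mu>) (A i) + emeasure (neg_part \<mu>) (A i)) =
      emeasure (pos_part \<mu>) (\<Union>i. A i) + emeasure (neg_part \<mu>) (\<Union>i. A i)"
      using assms(1) by (simp add: signed_borel_def suminf_add[symmetric] suminf_emeasure)
  qed
qed (use assms in \<open>auto simp: positive_def\<close>)

definition nonneg_smeasure :: "'a::metric_space smeasure \<Rightarrow> bool" where
  "nonneg_smeasure \<mu> \<longleftrightarrow> (\<forall>B\<in>sets borel. emeasure (neg_part \<mu>) B = 0)"

definition potential :: "('a \<Rightarrow> 'a \<Rightarrow> ennreal) \<Rightarrow> 'a smeasure \<Rightarrow> 'a \<Rightarrow> ereal" where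
  "potential k \<mu> x =
     (let p = (\<integral>\<^sup>+y. k x y \<partial>pos_part \<mu>); n = (\<integral>\<^sup>+y. k x y \<partial>neg_part \<mu>)
      in if p = \<infinity> \<and> n = \<infinity> then 0 else enn2ereal p - enn2ereal n)"

definition class_M ::
  "'a::metric_space measure \<Rightarrow> ('a \<Rightarrow> real) set \<Rightarrow> (('a \<Rightarrow> real) \<Rightarrow> ('a \<Rightarrow> real) \<Rightarrow> real)
     \<Rightarrow> ('a \<Rightarrow> 'a \<Rightarrow> ennreal) \<Rightarrow> 'a smeasure set" where
  "class_M m D \<E> k = {\<mu>. signed_borel \<mu> \<and>
     quasi_everywhere m D \<E> (\<lambda>x. (\<integral>\<^sup>+y. k x y \<partial>tvar \<mu>) < \<infinity>)}"

text \<open>\<open>\<mu> = \<mu>c + \<mu>d\<close> is expressed by additivity of the Jordan parts, which avoids \<open>\<infinity> - \<infinity>\<close> and is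
  equivalent because \<open>\<mu>c\<close> and \<open>\<mu>d\<close> are mutually singular.\<close>

definition capacity_decomposition ::
  "'a::metric_space measure \<Rightarrow> ('a \<Rightarrow> real) set \<Rightarrow> (('a \<Rightarrow> real) \<Rightarrow> ('a \<Rightarrow> real) \<Rightarrow> real)
     \<Rightarrow> 'a smeasure \<Rightarrow> 'a smeasure \<Rightarrow> 'a smeasure \<Rightarrow> bool" where
  "capacity_decomposition m D \<E> \<mu> \<mu>c \<mu>d \<longleftrightarrow>
     signed_borel \<mu>c \<and> signed_borel \<mu>d \<and>
     (\<forall>B\<in>sets borel.
        emeasure (pos_part \<mu>) B = emeasure (pos_part \<mu>c) B + emeasure (pos_part \<mu>d) B \<and>
        emeasure (neg_part \<mu>) B = emeasure (neg_part \<mu>c) B + emeasure (neg_part \<mu>d) B) \<and>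
     (\<exists>N\<in>sets borel. capacity m D \<E> N = 0 \<and> emeasure (tvar \<mu>c) (- N) = 0) \<and>
     (\<forall>B\<in>sets borel. capacity m D \<E> B = 0 \<longrightarrow> emeasure (tvar \<mu>d) B = 0)"

definition is_solution ::
  "'a::metric_space measure \<Rightarrow> ('a \<Rightarrow> real) set \<Rightarrow> (('a \<Rightarrow> real) \<Rightarrow> ('a \<Rightarrow> real) \<Rightarrow> real)
     \<Rightarrow> ('a \<Rightarrow> 'a \<Rightarrow> ennreal) \<Rightarrow> 'a smeasure \<Rightarrow> ('a \<Rightarrow> ereal) \<Rightarrow> bool" where
  "is_solution m D \<E> k \<mu> u \<longleftrightarrow>
     universally_measurable u \<and> quasi_everywhere m D \<E> (\<lambda>x. u x = potential k \<mu> x)"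

end

theory Submission
  imports Defs
begin

text \<open>
  Write \<open>\<nu>\<close> and \<open>\<sigma>\<close> for the negative and the positive part of \<open>\<mu>\<close>; a nonnegative solution means
  \<open>R\<nu> \<le> R\<sigma>\<close> almost everywhere. It suffices to show \<open>\<nu>(K) = 0\<close> for closed \<open>K\<close> of capacity zero with
  \<open>\<sigma>(K) = 0\<close>. If \<open>a \<ge> 0\<close> is a function, then symmetry of \<open>r\<close> gives
  \<open>\<integral> Ra d\<nu> = \<integral> a R\<nu> dm \<le> \<integral> a R\<sigma> dm = \<integral> Ra d\<sigma>\<close>, so one needs potentials of functions that are small
  off \<open>K\<close> and not small on \<open>K\<close>. With \<open>v\<close> the minimum of \<open>Rh\<close> and the probability of hitting a
  neighbourhood \<open>U\<close> of \<open>K\<close>, the function \<open>a = (v - P\<^sub>t v) / t\<close> has the potential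
  \<open>1/t \<integral>\<^bsub>0\<^esub>\<^bsup>t\<^esup> P\<^sub>s v ds\<close>; letting \<open>t \<rightarrow> 0\<close> and then \<open>U\<close> shrink to \<open>K\<close>, the right hand side tends to zero
  while the left hand side dominates the integral over \<open>K\<close> of a strictly positive function.

  The hitting probabilities tend to zero almost everywhere because they are dominated by
  the solution of a penalized equation whose energy is at most that of any competitor in the
  definition of the capacity. The convergence holds at every point off \<open>K\<close> by right continuity of the
  paths and absolute continuity of the resolvent.
\<close>

section \<open>Hunt processes: transition operators and the Markov property\<close>

text \<open>The obstacle is that \<open>K\<close> has capacity zero and hence is
  \<open>m\<close>-null: nothing known almost everywhere, or even quasi everywhere, can be evaluated
  on it. Energies and the comparison of the potentials are therefore used under \<open>m\<close>
  only, and the passage to \<open>\<nu>\<close> and \<open>\<sigma>\<close> goes through Fubini with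
  the symmetric kernel or through pointwise properties of the process. Fubini needs sigma-finite
  measures; as \<open>\<mu>\<close> may be unbounded, this is extracted from the finiteness of its
  potential. The minimum with \<open>Rh\<close> has two purposes. For a suitable \<open>h\<close> it
  gives an integrable majorant when \<open>U\<close> shrinks to \<open>K\<close>, and it makes
  \<open>P_t v\<close> vanish at infinity, so that the potential of \<open>a\<close> has no
  remaining boundary term. Hitting probabilities of open sets are limits over dyadic time grids, so
  that the Markov property and the comparison with supermedian functions become inductions on the
  number of grid points. Capacity is defined by \<open>\<E>\<close> without an L2 term: the
  penalized equation needs a discount \<open>\<alpha> > 0\<close>, which must tend to zero while the
  penalty grows, and transience turns the energy bound into an integral bound.\<close>

lemma sets_cemetery_borel_iff: "A \<in> sets cemetery_borel \<longleftrightarrow> Some -` A \<in> sets borel"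
proof -
  have "sigma_algebra UNIV {B. Some -` B \<in> sets (borel :: 'a measure)}"
    unfolding sigma_algebra_iff2
  proof (intro conjI ballI allI impI)
    fix B :: "'a option set" assume "B \<in> {B. Some -` B \<in> sets borel}"
    then have "- (Some -` B) \<in> sets borel"
      by auto
    then show "UNIV - B \<in> {B. Some -` B \<in> sets borel}"
      by (simp add: vimage_Diff Compl_eq_Diff_UNIV)
  qed (auto simp: vimage_UN)
  then show ?thesis
    unfolding cemetery_borel_def using sigma_algebra.sets_measure_of_eq by blast
qed

lemma space_cemetery_borel [simp]: "space cemetery_borel = UNIV"
  by (simp add: cemetery_borel_def)

lemma image_Some_in_cemetery_borel [measurable]:
  "B \<in> sets borel \<Longrightarrow> Some ` B \<in> sets cemetery_borel"
  by (simp add: sets_cemetery_borel_iff inj_vimage_image_eq)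

lemma borel_measurable_case_option [measurable]:
  fixes h :: "'a::topological_space \<Rightarrow> ennreal"
  assumes "h \<in> borel_measurable borel"
  shows "case_option 0 h \<in> borel_measurable cemetery_borel"
proof (rule measurableI)
  fix A :: "ennreal set" assume "A \<in> sets borel"
  then have "h -` A \<in> sets borel"
    using measurable_sets[OF assms, of A] by simp
  moreover have "Some -` (case_option 0 h -` A) = h -` A"
    by auto
  ultimately show "case_option 0 h -` A \<inter> space cemetery_borel \<in> sets cemetery_borel"
    by (simp add: sets_cemetery_borel_iff)
qed simp

lemma case_option_indicator: "case_option 0 (indicator B) z = indicator (Some ` B) z"
  by (cases z) (auto simp: indicator_def)

text \<open>Local compactness and second countability make every open set a countable union of open
  sets inside compact sets. On these the topology of the compactification can be tested by
  continuous functions that vanish off a compact set.\<close>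

locale hunt_process_lc = hunt_process M F P X
  for M :: "'w measure" and F :: "ennreal \<Rightarrow> 'w measure"
    and P :: "'a::{metric_space, second_countable_topology} option \<Rightarrow> 'w measure"
    and X :: "ennreal \<Rightarrow> 'w \<Rightarrow> 'a option" +
  assumes locally_compact: "locally_compact_space (euclidean :: 'a topology)"
begin

abbreviation \<P> :: "real \<Rightarrow> ('a \<Rightarrow> ennreal) \<Rightarrow> 'a \<Rightarrow> ennreal" where
  "\<P> t \<equiv> transition P X (ennreal t)"

abbreviation \<R> :: "real \<Rightarrow> ('a \<Rightarrow> ennreal) \<Rightarrow> 'a \<Rightarrow> ennreal" where
  "\<R> \<equiv> resolvent P X"

lemma prob_space_P [simp]: "prob_space (P z)"
  by (rule prob)

lemma sets_P_eq [simp, measurable_cong]: "sets (P z) = sets M"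
  by (rule sets_P)

lemma space_P [simp]: "space (P z) = space M"
  using sets_eq_imp_space_eq[OF sets_P] .

lemma emeasure_P_space [simp]: "emeasure (P z) (space M) = 1"
  using prob_space.emeasure_space_1[OF prob_space_P, of z] by simp

lemma emeasure_P_le_1: "emeasure (P z) A \<le> 1"
  by (metis prob_space_P prob_space.measure_le_1)

lemma measurable_X [measurable]: "X t \<in> M \<rightarrow>\<^sub>M cemetery_borel"
  using adapted[of t] filtration_sub[of t] space_F[of t]
  by (simp add: measurable_def) blast

lemma events_filtration [measurable_dest]: "\<Lambda> \<in> sets (F t) \<Longrightarrow> \<Lambda> \<in> sets M"
  using filtration_sub by blast

lemma sets_X_in [measurable]:
  "B \<in> sets borel \<Longrightarrow> {\<omega> \<in> space M. X t \<omega> \<in> Some ` B} \<in> sets M"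
  using measurable_sets[OF measurable_X image_Some_in_cemetery_borel, of B t]
  by (simp add: vimage_def Int_def conj_commute)

lemma filtration_X_in:
  "\<Lambda> \<in> sets (F t) \<Longrightarrow> B \<in> sets borel \<Longrightarrow> {\<omega> \<in> \<Lambda>. X t \<omega> \<in> Some ` B} \<in> sets (F t)"
  "\<Lambda> \<in> sets (F t) \<Longrightarrow> B \<in> sets borel \<Longrightarrow> {\<omega> \<in> \<Lambda>. X t \<omega> \<notin> Some ` B} \<in> sets (F t)"
proof -
  assume \<Lambda>: "\<Lambda> \<in> sets (F t)" and B: "B \<in> sets borel"
  have 1: "X t -` (Some ` B) \<inter> space (F t) \<in> sets (F t)"
    using adapted B by (auto intro: measurable_sets)
  have "{\<omega> \<in> \<Lambda>. X t \<omega> \<in> Some ` B} = \<Lambda> \<inter> (X t -` (Some ` B) \<inter> space (F t))"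
    using sets.sets_into_space[OF \<Lambda>] by auto
  then show "{\<omega> \<in> \<Lambda>. X t \<omega> \<in> Some ` B} \<in> sets (F t)"
    using 1 \<Lambda> by auto
  have "{\<omega> \<in> \<Lambda>. X t \<omega> \<notin> Some ` B} = \<Lambda> - (X t -` (Some ` B) \<inter> space (F t))"
    using sets.sets_into_space[OF \<Lambda>] by auto
  then show "{\<omega> \<in> \<Lambda>. X t \<omega> \<notin> Some ` B} \<in> sets (F t)"
    using 1 \<Lambda> by auto
qed

lemma transition_indicator:
  "B \<in> sets borel \<Longrightarrow>
    transition P X t (indicator B) x = emeasure (P (Some x)) {\<omega> \<in> space M. X t \<omega> \<in> Some ` B}"
  using nn_integral_indicator[of "{\<omega> \<in> space M. X t \<omega> \<in> Some ` B}" "P (Some x)"]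
  unfolding transition_def case_option_indicator
  by (simp add: sets_X_in indicator_def cong: nn_integral_cong_simp)

lemma transition_mono:
  "(\<And>x. h x \<le> k x) \<Longrightarrow> transition P X t h x \<le> transition P X t k x"
  unfolding transition_def by (rule nn_integral_mono) (auto split: option.split)

lemma transition_add:
  assumes [measurable]: "h \<in> borel_measurable borel" "k \<in> borel_measurable borel"
  shows "transition P X t (\<lambda>x. h x + k x) x = transition P X t h x + transition P X t k x"
  unfolding transition_def
  by (subst nn_integral_add[symmetric]) (auto intro!: nn_integral_cong split: option.split)

lemma transition_cmult:
  assumes [measurable]: "h \<in> borel_measurable borel"
  shows "transition P X t (\<lambda>x. c * h x) x = c * transition P X t h x"
  unfolding transition_def
  by (subst nn_integral_cmult[symmetric]) (auto intro!: nn_integral_cong split: option.split)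

lemma transition_diff:
  assumes [measurable]: "h \<in> borel_measurable borel" "k \<in> borel_measurable borel"
    and "\<And>x. k x \<le> h x" and "transition P X t k x \<noteq> \<infinity>"
  shows "transition P X t (\<lambda>x. h x - k x) x = transition P X t h x - transition P X t k x"
  using assms(3,4) unfolding transition_def
  by (subst nn_integral_diff[symmetric]) (auto intro!: nn_integral_cong AE_I2 split: option.split)

lemma transition_SUP:
  assumes [measurable]: "\<And>i::nat. h i \<in> borel_measurable borel" and "incseq h"
  shows "transition P X t (\<lambda>x. SUP i. h i x) x = (SUP i. transition P X t (h i) x)"
  unfolding transition_def using \<open>incseq h\<close>
  by (subst nn_integral_monotone_convergence_SUP[symmetric])
     (auto intro!: nn_integral_cong simp: incseq_def le_fun_def split: option.split)

lemma transition_const_le: "transition P X t (\<lambda>_. c) x \<le> c"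
proof -
  have "transition P X t (\<lambda>_. c) x \<le> (\<integral>\<^sup>+\<omega>. c \<partial>P (Some x))"
    unfolding transition_def by (intro nn_integral_mono) (auto split: option.split)
  also have "\<dots> = c"
    by (simp add: nn_integral_const)
  finally show ?thesis .
qed

lemma transition_le_const: "(\<And>x. h x \<le> c) \<Longrightarrow> transition P X t h x \<le> c"
  using transition_mono[of h "\<lambda>_. c"] transition_const_le order_trans by blast

lemma transition_liminf:
  assumes [measurable]: "\<And>i. h i \<in> borel_measurable borel"
  shows "transition P X t (\<lambda>x. liminf (\<lambda>i. h i x)) x \<le> liminf (\<lambda>i. transition P X t (h i) x)"
proof -
  have "transition P X t (\<lambda>x. liminf (\<lambda>i. h i x)) x
      = (\<integral>\<^sup>+\<omega>. liminf (\<lambda>i. case_option 0 (h i) (X t \<omega>)) \<partial>P (Some x))"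
    unfolding transition_def
    by (intro nn_integral_cong) (auto split: option.split simp: Liminf_const)
  also have "\<dots> \<le> liminf (\<lambda>i. \<integral>\<^sup>+\<omega>. case_option 0 (h i) (X t \<omega>) \<partial>P (Some x))"
    by (intro nn_integral_liminf) measurable
  finally show ?thesis
    unfolding transition_def .
qed

lemma borel_measurable_transition [measurable (raw)]:
  assumes "h \<in> borel_measurable borel"
  shows "transition P X t h \<in> borel_measurable borel"
  using assms
proof (induction h rule: borel_measurable_induct)
  case (cong f g)
  then have eq: "f = g" by auto
  show ?case unfolding eq by (rule cong.IH)
next
  case (set A)
  then have "transition P X t (indicator A) =
      (\<lambda>x. emeasure (P (Some x)) {\<omega> \<in> space M. X t \<omega> \<in> Some ` A})"
    by (auto simp: transition_indicator)
  then show ?case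
    using set kernel_measurable[of "Some ` A" t] by (simp add: image_Some_in_cemetery_borel)
next
  case (mult u c)
  then have "transition P X t (\<lambda>x. c * u x) = (\<lambda>x. c * transition P X t u x)"
    by (auto simp: transition_cmult)
  with mult show ?case by simp
next
  case (add u v)
  then have "transition P X t (\<lambda>x. v x + u x) = (\<lambda>x. transition P X t v x + transition P X t u x)"
    by (auto simp: transition_add)
  with add show ?case by simp
next
  case (seq U)
  have "(SUP i. U i) = (\<lambda>x. SUP i. U i x)"
    by (auto simp: image_comp)
  then have "transition P X t (SUP i. U i) = (\<lambda>x. SUP i. transition P X t (U i) x)"
    using seq by (auto simp: transition_SUP)
  moreover have "(\<lambda>x. SUP i. transition P X t (U i) x) \<in> borel_measurable borel"
    using seq by measurable
  ultimately show ?case by metis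
qed

text \<open>For indicators this is the strong Markov property at the constant stopping time
  \<open>t\<close>; monotone class induction on \<open>h\<close> does the rest. The past event
  \<open>\<Lambda>\<close> is kept because the grid argument for hitting probabilities conditions on
  not having hit so far.\<close>

lemma markov_property:
  assumes h: "h \<in> borel_measurable borel" and \<Lambda>: "\<Lambda> \<in> sets (F t)"
  shows "(\<integral>\<^sup>+\<omega>. indicator \<Lambda> \<omega> * case_option 0 h (X (t + s) \<omega>) \<partial>P z) =
         (\<integral>\<^sup>+\<omega>. indicator \<Lambda> \<omega> * case_option 0 (transition P X s h) (X t \<omega>) \<partial>P z)"
  using h
proof (induction h rule: borel_measurable_induct)
  case (cong f g)
  then have eq: "f = g" by auto
  show ?case unfolding eq by (rule cong.IH)
next
  case (set B)
  \<comment> \<open>At levels below \<open>t\<close> the trace of \<open>\<Lambda>\<close> is empty,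
    at levels above it is \<open>\<Lambda>\<close> itself.\<close>
  have \<Lambda>': "\<Lambda> \<in> sets (pre_sigma (\<lambda>_. t))"
  proof (rule sets_pre_sigmaI[OF stopping_time_const])
    show "{\<omega> \<in> \<Lambda>. t \<le> t'} \<in> sets (F t')" for t'
      using \<Lambda> sets_F_mono[of t t'] by (cases "t \<le> t'") auto
  qed
  have M: "\<Lambda> \<in> sets M" and [measurable]: "B \<in> sets borel"
    using \<Lambda> set events_filtration by auto
  have sub: "\<Lambda> \<subseteq> space M"
    using M sets.sets_into_space by auto
  have "(\<integral>\<^sup>+\<omega>. indicator \<Lambda> \<omega> * case_option 0 (indicator B) (X (t + s) \<omega>) \<partial>P z)
      = (\<integral>\<^sup>+\<omega>. indicator {\<omega> \<in> \<Lambda>. X (t + s) \<omega> \<in> Some ` B} \<omega> \<partial>P z)"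
    by (intro nn_integral_cong) (auto simp: case_option_indicator indicator_def)
  also have "\<dots> = emeasure (P z) {\<omega> \<in> \<Lambda>. X (t + s) \<omega> \<in> Some ` B}"
  proof (rule nn_integral_indicator)
    have "{\<omega> \<in> \<Lambda>. X (t + s) \<omega> \<in> Some ` B} = \<Lambda> \<inter> {\<omega> \<in> space M. X (t + s) \<omega> \<in> Some ` B}"
      using sub by auto
    then show "{\<omega> \<in> \<Lambda>. X (t + s) \<omega> \<in> Some ` B} \<in> sets (P z)"
      using M by auto
  qed
  also have "\<dots> = (\<integral>\<^sup>+\<omega>. indicator \<Lambda> \<omega> *
      emeasure (P (X t \<omega>)) {\<omega>' \<in> space M. X s \<omega>' \<in> Some ` B} \<partial>P z)"
    using strong_markov[OF stopping_time_const \<Lambda>', of "Some ` B" z s] set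
    by (simp add: image_Some_in_cemetery_borel)
  also have "\<dots> = (\<integral>\<^sup>+\<omega>. indicator \<Lambda> \<omega> * case_option 0 (transition P X s (indicator B)) (X t \<omega>) \<partial>P z)"
  proof (intro nn_integral_cong arg_cong[where f="\<lambda>x. indicator \<Lambda> _ * x"])
    fix \<omega>
    \<comment> \<open>Started in the cemetery the process stays there, which agrees with the
      extension of functions by \<open>0\<close>.\<close>
    have "emeasure (P None) {\<omega>' \<in> space M. X s \<omega>' \<in> Some ` B} = emeasure (P None) {}"
      using cemetery_trap[of s] by (intro emeasure_eq_AE) auto
    then show "emeasure (P (X t \<omega>)) {\<omega>' \<in> space M. X s \<omega>' \<in> Some ` B} =
      case_option 0 (transition P X s (indicator B)) (X t \<omega>)"
      by (auto split: option.split simp: transition_indicator)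
  qed
  finally show ?case .
next
  case (mult u c)
  note [measurable] = mult(2) \<Lambda>
  have *: "case_option 0 (\<lambda>x. c * u x) z = c * case_option 0 u z" for u :: "'a \<Rightarrow> ennreal" and z
    by (auto split: option.split)
  have cm: "(\<integral>\<^sup>+\<omega>. indicator \<Lambda> \<omega> * (c * case_option 0 k (Y \<omega>)) \<partial>P z) =
      c * (\<integral>\<^sup>+\<omega>. indicator \<Lambda> \<omega> * case_option 0 k (Y \<omega>) \<partial>P z)"
    if [measurable]: "k \<in> borel_measurable borel" "Y \<in> M \<rightarrow>\<^sub>M cemetery_borel" for k Y
    by (subst nn_integral_cmult[symmetric]) (measurable, auto simp: mult_ac)
  show ?case
    unfolding transition_cmult[OF mult(2)] * cm[OF mult(2) measurable_X]
      cm[OF borel_measurable_transition[OF mult(2)] measurable_X] mult.IH ..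
next
  case (add u v)
  note [measurable] = add(1,3) \<Lambda>
  have *: "case_option 0 (\<lambda>x. v x + u x) z = case_option 0 v z + case_option 0 u z" for u v :: "'a \<Rightarrow> ennreal" and z
    by (auto split: option.split)
  have ad: "(\<integral>\<^sup>+\<omega>. indicator \<Lambda> \<omega> * (case_option 0 k (Y \<omega>) + case_option 0 k' (Y \<omega>)) \<partial>P z) =
      (\<integral>\<^sup>+\<omega>. indicator \<Lambda> \<omega> * case_option 0 k (Y \<omega>) \<partial>P z) +
      (\<integral>\<^sup>+\<omega>. indicator \<Lambda> \<omega> * case_option 0 k' (Y \<omega>) \<partial>P z)"
    if [measurable]: "k \<in> borel_measurable borel" "k' \<in> borel_measurable borel"
      "Y \<in> M \<rightarrow>\<^sub>M cemetery_borel" for k k' Y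
    by (subst nn_integral_add[symmetric]) (measurable, auto simp: distrib_left)
  show ?case
    unfolding transition_add[OF add(3,1)] * ad[OF add(3,1) measurable_X]
      ad[OF borel_measurable_transition[OF add(3)] borel_measurable_transition[OF add(1)] measurable_X] add.IH ..
next
  case (seq U)
  note [measurable] = seq(1) \<Lambda>
  have *: "case_option 0 (\<lambda>x. SUP i. U i x) z = (SUP i. case_option 0 (U i) z)"
    for U :: "nat \<Rightarrow> 'a \<Rightarrow> ennreal" and z
    by (auto split: option.split)
  have **: "(\<integral>\<^sup>+\<omega>. indicator \<Lambda> \<omega> * case_option 0 (\<lambda>x. SUP i. V i x) (Y \<omega>) \<partial>P z) =
      (SUP i. \<integral>\<^sup>+\<omega>. indicator \<Lambda> \<omega> * case_option 0 (V i) (Y \<omega>) \<partial>P z)"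
    if [measurable]: "\<And>i. V i \<in> borel_measurable borel" "Y \<in> M \<rightarrow>\<^sub>M cemetery_borel" and "incseq V"
    for V :: "nat \<Rightarrow> 'a \<Rightarrow> ennreal" and Y
    unfolding * SUP_mult_left_ennreal using \<open>incseq V\<close>
    by (intro nn_integral_monotone_convergence_SUP)
       (auto simp: incseq_def le_fun_def split: option.split intro!: mult_left_mono)
  have eq: "(SUP i. U i) = (\<lambda>x. SUP i. U i x)"
    by (auto simp: image_comp)
  have inc: "incseq (\<lambda>i. transition P X s (U i))"
    using \<open>incseq U\<close> by (auto simp: incseq_def le_fun_def intro!: transition_mono)
  have tr: "transition P X s (\<lambda>x. SUP i. U i x) = (\<lambda>x. SUP i. transition P X s (U i) x)"
    using seq by (auto simp: transition_SUP)
  show ?case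
    unfolding eq tr **[OF seq(1) measurable_X \<open>incseq U\<close>]
      **[OF borel_measurable_transition[OF seq(1)] measurable_X inc] seq.IH ..
qed

text \<open>Chapman-Kolmogorov, from the Markov property with the whole space as past event.\<close>

lemma transition_transition:
  assumes h: "h \<in> borel_measurable borel"
  shows "transition P X s (transition P X t h) x = transition P X (s + t) h x"
proof -
  have "transition P X (s + t) h x = (\<integral>\<^sup>+\<omega>. indicator (space (F s)) \<omega> * case_option 0 h (X (s + t) \<omega>) \<partial>P (Some x))"
    unfolding transition_def by (intro nn_integral_cong) (simp add: space_F)
  also have "\<dots> = (\<integral>\<^sup>+\<omega>. indicator (space (F s)) \<omega> * case_option 0 (transition P X t h) (X s \<omega>) \<partial>P (Some x))"
    by (rule markov_property[OF h sets.top])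
  also have "\<dots> = (\<integral>\<^sup>+\<omega>. case_option 0 (transition P X t h) (X s \<omega>) \<partial>P (Some x))"
    by (intro nn_integral_cong) (simp add: space_F)
  finally show ?thesis
    unfolding transition_def[of P X s] ..
qed

lemma transition_0: 
  assumes [measurable]: "h \<in> borel_measurable borel"
  shows "transition P X 0 h x = h x"
proof -
  have "transition P X 0 h x = (\<integral>\<^sup>+\<omega>. h x \<partial>P (Some x))"
    unfolding transition_def using normal[of "Some x"] by (intro nn_integral_cong_AE) auto
  then show ?thesis
    by (simp add: nn_integral_const)
qed

end

section \<open>Joint measurability of the paths\<close>

lemma measurable_the_cemetery [measurable]: "the \<in> cemetery_borel \<rightarrow>\<^sub>M borel"
proof (rule measurableI)
  fix A :: "'a set" assume "A \<in> sets borel"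
  moreover have "Some -` (the -` A) = A" by auto
  ultimately show "the -` A \<inter> space cemetery_borel \<in> sets cemetery_borel"
    by (simp add: sets_cemetery_borel_iff)
qed simp

lemma case_option_eq_indicator: "case_option 0 h z = indicator (range Some) z * (h (the z) :: ennreal)"
  by (cases z) auto

lemma borel_measurable_case_option_param:
  assumes k: "(\<lambda>(t, x). k t x) \<in> borel_measurable (N \<Otimes>\<^sub>M (borel :: 'a::topological_space measure))"
  shows "(\<lambda>(t, z). case_option (0::ennreal) (k t) z) \<in> borel_measurable (N \<Otimes>\<^sub>M cemetery_borel)"
proof -
  have [measurable]: "(\<lambda>p. k (fst p) (snd p)) \<in> borel_measurable (N \<Otimes>\<^sub>M (borel :: 'a measure))"
    using k by (simp add: case_prod_beta')
  have "range Some \<in> sets (cemetery_borel :: 'a option measure)"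
    by (rule image_Some_in_cemetery_borel) simp
  then have [measurable]: "(\<lambda>z. indicator (range Some) z :: ennreal) \<in> borel_measurable (cemetery_borel :: 'a option measure)"
    by simp
  have "(\<lambda>p. k (fst p) (the (snd p))) \<in> borel_measurable (N \<Otimes>\<^sub>M (cemetery_borel :: 'a option measure))"
    by (rule measurable_compose[of "\<lambda>p. (fst p, the (snd p))" _ "N \<Otimes>\<^sub>M borel" "\<lambda>p. k (fst p) (snd p)", simplified]) measurable
  then show ?thesis
    unfolding case_option_eq_indicator case_prod_beta' by measurable
qed

text \<open>The argument is cut off at \<open>0\<close> because \<^const>\<open>ennreal\<close> sends negative times to \<open>0\<close>.\<close>

definition right_grid :: "nat \<Rightarrow> real \<Rightarrow> real" where
  "right_grid n t = (of_int \<lfloor>real (Suc n) * max t 0\<rfloor> + 1) / real (Suc n)"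

text \<open>The \<open>+ 1\<close> after the floor makes the inequality strict even when
  \<open>t\<close> is itself a grid time, so the grid approaches from the right only, where the
  paths are continuous.\<close>

lemma right_grid_gt: "max t 0 < right_grid n t"
proof -
  have "x < (of_int \<lfloor>N * x\<rfloor> + 1) / N" if "0 < N" for x N :: real
  proof -
    have "N * x < of_int \<lfloor>N * x\<rfloor> + 1"
      by linarith
    then show ?thesis
      using that by (simp add: pos_less_divide_eq mult.commute)
  qed
  then show ?thesis
    unfolding right_grid_def by (metis of_nat_0_less_iff zero_less_Suc)
qed

lemma right_grid_le: "right_grid n t \<le> max t 0 + 1 / real (Suc n)"
proof -
  have "of_int \<lfloor>real (Suc n) * max t 0\<rfloor> + 1 \<le> real (Suc n) * max t 0 + 1"
    by linarith
  then have "right_grid n t \<le> (real (Suc n) * max t 0 + 1) / real (Suc n)"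
    unfolding right_grid_def by (intro divide_right_mono) auto
  then show ?thesis
    by (simp add: add_divide_distrib del: of_nat_Suc)
qed

lemma right_grid_tendsto: "(\<lambda>n. right_grid n t) \<longlonglongrightarrow> max t 0"
proof (rule tendsto_sandwich[OF _ _ tendsto_const])
  show "(\<lambda>n. max t 0 + 1 / real (Suc n)) \<longlonglongrightarrow> max t 0"
    using tendsto_add[OF tendsto_const LIMSEQ_inverse_real_of_nat, of "max t 0"]
    by (simp add: inverse_eq_divide)
  show "\<forall>\<^sub>F n in sequentially. max t 0 \<le> right_grid n t"
    by (intro always_eventually allI less_imp_le right_grid_gt)
  show "\<forall>\<^sub>F n in sequentially. right_grid n t \<le> max t 0 + 1 / real (Suc n)"
    by (intro always_eventually allI right_grid_le)
qed

text \<open>\<open>right_grid n\<close> takes countably many values, so measurability at each fixed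
  time already gives joint measurability.\<close>

lemma measurable_right_grid:
  assumes f: "\<And>s. f s \<in> borel_measurable N"
  shows "(\<lambda>p. f (right_grid n (fst p)) (snd p)) \<in> borel_measurable (borel \<Otimes>\<^sub>M N)"
proof -
  have "(\<lambda>p. f ((of_int (\<lfloor>real (Suc n) * max (fst p) 0\<rfloor>) + 1) / real (Suc n)) (snd p)) \<in> borel_measurable (borel \<Otimes>\<^sub>M N)"
  proof (rule measurable_compose_countable[where f="\<lambda>(i::int) p. f ((of_int i + 1) / real (Suc n)) (snd p)"])
    show "(\<lambda>p. f ((of_int i + 1) / real (Suc n)) (snd p)) \<in> borel_measurable (borel \<Otimes>\<^sub>M N)" for i :: int
      by (rule measurable_compose[OF measurable_snd f])
  qed measurable
  then show ?thesis
    unfolding right_grid_def .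
qed

section \<open>Relatively compact covers and continuous approximation of open sets\<close>

lemma (in hunt_process_lc) compact_nbhd_basis:
  fixes U :: "'a set"
  assumes "open U"
  obtains \<C> where "countable \<C>" "\<And>V. V \<in> \<C> \<Longrightarrow> open V \<and> (\<exists>C. compact C \<and> V \<subseteq> C)" "\<Union>\<C> = U"
proof -
  define \<A> where "\<A> = {V. open V \<and> V \<subseteq> U \<and> (\<exists>C. compact C \<and> V \<subseteq> C)}"
  have "\<Union>\<A> = U"
  proof safe
    fix x assume "x \<in> U"
    obtain V C where "open V" "compact C" "x \<in> V" "V \<subseteq> C"
      using locally_compact unfolding locally_compact_space_def by simp blast
    then have "V \<inter> U \<in> \<A>"
      using assms by (auto simp: \<A>_def)
    then show "x \<in> \<Union>\<A>"
      using \<open>x \<in> V\<close> \<open>x \<in> U\<close> by auto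
  qed (auto simp: \<A>_def)
  moreover have "\<And>S. S \<in> \<A> \<Longrightarrow> open S"
    by (auto simp: \<A>_def)
  then obtain \<C> where \<C>: "\<C> \<subseteq> \<A>" "countable \<C>" "\<Union>\<C> = \<Union>\<A>"
    using Lindelof by metis
  ultimately have "\<Union>\<C> = U"
    by simp
  with \<C>(1,2) show ?thesis
    by (intro that[of \<C>]) (auto simp: \<A>_def)
qed

text \<open>Urysohn functions increasing to the indicator of \<open>U\<close>. The whole space is
  treated separately because \<open>infdist\<close> to the empty set is \<open>0\<close> by
  convention.\<close>

definition open_approx :: "'a::metric_space set \<Rightarrow> nat \<Rightarrow> 'a \<Rightarrow> real" where
  "open_approx U k x = (if U = UNIV then 1 else min 1 (real k * infdist x (- U)))"

lemma continuous_open_approx: "continuous_on UNIV (open_approx U k)"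
  unfolding open_approx_def
  by (cases "U = UNIV") (auto intro!: continuous_intros)

lemma open_approx_range: "0 \<le> open_approx U k x" "open_approx U k x \<le> 1"
  by (auto simp: open_approx_def infdist_nonneg)

lemma open_approx_outside: "x \<notin> U \<Longrightarrow> open_approx U k x = 0"
  by (auto simp: open_approx_def)

lemma incseq_open_approx: "incseq (\<lambda>k. open_approx U k x)"
proof (cases "U = UNIV")
  case False
  show ?thesis
  proof (rule incseq_SucI)
    fix k
    have "real k * infdist x (- U) \<le> real (Suc k) * infdist x (- U)"
      by (intro mult_right_mono) (auto simp: infdist_nonneg)
    then show "open_approx U k x \<le> open_approx U (Suc k) x"
      unfolding open_approx_def using False by (simp only: if_False)
  qed
qed (simp add: open_approx_def incseq_def)

lemma open_approx_tendsto:
  assumes "open U" and "x \<in> U"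
  shows "(\<lambda>k. open_approx U k x) \<longlonglongrightarrow> 1"
proof (cases "U = UNIV")
  case False
  have "x \<notin> closure (- U)"
    using assms by (auto simp: closure_complement interior_open)
  then have pos: "0 < infdist x (- U)"
    using False in_closure_iff_infdist_zero[of "- U" x] infdist_nonneg[of x "- U"] by force
  obtain K where K: "1 < real K * infdist x (- U)"
    using reals_Archimedean3[OF pos] by blast
  have "open_approx U k x = 1" if "k \<ge> K" for k
  proof -
    have "real K * infdist x (- U) \<le> real k * infdist x (- U)"
      using that pos by (intro mult_right_mono) auto
    then show ?thesis
      using K False by (auto simp: open_approx_def)
  qed
  then have "\<forall>\<^sub>F k in sequentially. open_approx U k x = 1"
    by (auto simp: eventually_sequentially)
  then show ?thesis
    by (rule tendsto_eventually)
qed (simp add: open_approx_def)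

lemma SUP_open_approx:
  assumes "open U"
  shows "(SUP k. ennreal (open_approx U k x)) = indicator U x"
proof (cases "x \<in> U")
  case True
  have "(\<lambda>k. ennreal (open_approx U k x)) \<longlonglongrightarrow> ennreal 1"
    using open_approx_tendsto[OF assms True] by (rule tendsto_ennrealI)
  moreover have "incseq (\<lambda>k. ennreal (open_approx U k x))"
    using incseq_open_approx[of U x] open_approx_range[of U _ x] by (auto simp: incseq_def intro: ennreal_leI)
  ultimately show ?thesis
    using True LIMSEQ_unique[OF LIMSEQ_SUP] by fastforce
qed (simp add: open_approx_outside)

context hunt_process_lc
begin

lemma filterlim_ennreal_at_right:
  assumes "0 \<le> t"
  shows "filterlim ennreal (at_right (ennreal t)) (at_right t)"
  unfolding filterlim_at
proof
  show "(ennreal \<longlongrightarrow> ennreal t) (at_right t)"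
    by (intro tendsto_ennrealI tendsto_ident_at)
  show "\<forall>\<^sub>F x in at_right t. ennreal x \<in> {ennreal t<..} \<and> ennreal x \<noteq> ennreal t"
    unfolding eventually_at_filter using assms
    by (intro always_eventually) (auto simp: ennreal_less_iff)
qed

lemma limitin_X_right:
  assumes "\<omega> \<in> space M" and "0 \<le> t"
  shows "limitin cemetery_topology (\<lambda>s. X (ennreal s) \<omega>) (X (ennreal t) \<omega>) (at_right t)"
  using right_cont[OF assms(1), of "ennreal t"] filterlim_ennreal_at_right[OF assms(2)]
  unfolding limitin_def by (auto simp: filterlim_iff)

lemma eventually_X_right_open:
  assumes "\<omega> \<in> space M" "0 \<le> t" "open U" "X (ennreal t) \<omega> \<in> Some ` U"
  shows "\<forall>\<^sub>F s in at_right t. X (ennreal s) \<omega> \<in> Some ` U"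
  using limitin_X_right[OF assms(1,2)] assms(3,4)
  unfolding limitin_def by (auto dest!: spec[of _ "Some ` U"])

text \<open>The complement of a compact set together with the cemetery is open in the
  compactification; for a set that is merely closed this could fail.\<close>

lemma eventually_X_right_compact:
  assumes "\<omega> \<in> space M" "0 \<le> t" "compact C" "X (ennreal t) \<omega> \<notin> Some ` C"
  shows "\<forall>\<^sub>F s in at_right t. X (ennreal s) \<omega> \<notin> Some ` C"
proof -
  have "openin cemetery_topology (insert None (Some ` (- C)))"
    using assms(3) unfolding openin_Alexandroff_compactification
    by (auto simp: compactin_euclidean_iff compact_imp_closed Compl_eq_Diff_UNIV)
  moreover have "X (ennreal t) \<omega> \<in> insert None (Some ` (- C))"
    using assms(4) by (cases "X (ennreal t) \<omega>") auto
  ultimately have "\<forall>\<^sub>F s in at_right t. X (ennreal s) \<omega> \<in> insert None (Some ` (- C))"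
    using limitin_X_right[OF assms(1,2)] unfolding limitin_def by blast
  then show ?thesis
    by (rule eventually_mono) auto
qed

text \<open>Extended by \<open>0\<close>, the function is continuous on the compactification because
  it vanishes off \<open>C\<close>. The case distinction on \<open>0 \<in> V\<close> decides whether
  the preimage of \<open>V\<close> contains the cemetery, hence whether it is an open set of living
  points or the complement of a compact set.\<close>

lemma right_continuous_observable:
  fixes f :: "'a \<Rightarrow> real"
  assumes \<omega>: "\<omega> \<in> space M" and t: "0 \<le> t"
    and f: "continuous_on UNIV f" and C: "compact C" and out: "\<And>x. x \<notin> C \<Longrightarrow> f x = 0"
  shows "((\<lambda>s. case_option 0 f (X (ennreal s) \<omega>)) \<longlongrightarrow> case_option 0 f (X (ennreal t) \<omega>)) (at_right t)"
proof (rule topological_tendstoI)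
  fix V :: "real set" assume V: "open V" "case_option 0 f (X (ennreal t) \<omega>) \<in> V"
  show "\<forall>\<^sub>F s in at_right t. case_option 0 f (X (ennreal s) \<omega>) \<in> V"
  proof (cases "0 \<in> V")
    case False
    then have "X (ennreal t) \<omega> \<in> Some ` (f -` V)"
      using V(2) by (auto split: option.splits)
    moreover have "open (f -` V)"
      using f V(1) by (simp add: continuous_on_open_vimage)
    ultimately have "\<forall>\<^sub>F s in at_right t. X (ennreal s) \<omega> \<in> Some ` (f -` V)"
      using eventually_X_right_open \<omega> t by blast
    then show ?thesis
      by (rule eventually_mono) auto
  next
    case True
    define C' where "C' = f -` (- V)"
    have "closed C'"
      unfolding C'_def using f V(1) by (intro closed_vimage) (auto simp: continuous_on_eq_continuous_at)
    moreover have "C' \<subseteq> C"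
      using out True unfolding C'_def by force
    ultimately have "compact C'"
      using C compact_Int_closed[of C C'] by (simp add: Int_absorb1)
    moreover have "X (ennreal t) \<omega> \<notin> Some ` C'"
      using V(2) by (auto simp: C'_def)
    ultimately have "\<forall>\<^sub>F s in at_right t. X (ennreal s) \<omega> \<notin> Some ` C'"
      using eventually_X_right_compact \<omega> t by blast
    then show ?thesis
      by (rule eventually_mono) (use True in \<open>auto simp: C'_def split: option.split\<close>)
  qed
qed

lemma right_continuous_observable_grid:
  fixes f :: "'a \<Rightarrow> real"
  assumes \<omega>: "\<omega> \<in> space M"
    and f: "continuous_on UNIV f" and C: "compact C" and out: "\<And>x. x \<notin> C \<Longrightarrow> f x = 0"
  shows "(\<lambda>n. case_option 0 f (X (ennreal (right_grid n t)) \<omega>)) \<longlonglongrightarrow> case_option 0 f (X (ennreal t) \<omega>)"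
proof -
  have "filterlim (\<lambda>n. right_grid n t) (at_right (max t 0)) sequentially"
    unfolding filterlim_at using right_grid_tendsto right_grid_gt[of t]
    by (auto intro!: always_eventually simp del: max_less_iff_conj) (metis less_irrefl)
  moreover have "ennreal (max t 0) = ennreal t"
    by (simp add: max_def ennreal_neg)
  ultimately show ?thesis
    using filterlim_compose[OF right_continuous_observable[OF \<omega> _ f C out, of "max t 0"]] by simp
qed

lemma ennreal_case_option: "ennreal (case_option 0 f z) = case_option 0 (\<lambda>x. ennreal (f x)) z"
  by (cases z) auto

lemma borel_measurable_ennreal_continuous:
  "continuous_on UNIV (f :: 'a \<Rightarrow> real) \<Longrightarrow> (\<lambda>x. ennreal (f x)) \<in> borel_measurable borel"
  by (intro measurable_compose[OF borel_measurable_continuous_onI measurable_ennreal])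

text \<open>Inside a compact set the indicator is a supremum of continuous observables, each of
  which is a limit along \<open>right_grid\<close> of jointly measurable functions. A countable
  cover extends this to all open sets.\<close>

lemma measurable_X_joint_open:
  fixes U :: "'a set"
  assumes U: "open U"
  shows "{p \<in> space (borel \<Otimes>\<^sub>M M). X (ennreal (fst p)) (snd p) \<in> Some ` U} \<in> sets (borel \<Otimes>\<^sub>M M)"
proof -
  have basic: "{p \<in> space (borel \<Otimes>\<^sub>M M). X (ennreal (fst p)) (snd p) \<in> Some ` V} \<in> sets (borel \<Otimes>\<^sub>M M)"
    if V: "open V" "compact C" "V \<subseteq> C" for V C :: "'a set"
  proof -
    let ?g = "\<lambda>k p. case_option 0 (\<lambda>x. ennreal (open_approx V k x)) (X (ennreal (fst p)) (snd p))"
    have lim: "(\<lambda>n. case_option 0 (\<lambda>x. ennreal (open_approx V k x)) (X (ennreal (right_grid n (fst p))) (snd p)))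
        \<longlonglongrightarrow> ?g k p" if "p \<in> space (borel \<Otimes>\<^sub>M M)" for k p
      unfolding ennreal_case_option[symmetric]
      using that V(3) by (intro tendsto_ennrealI right_continuous_observable_grid[OF _ continuous_open_approx V(2)])
        (auto intro!: open_approx_outside simp: space_pair_measure)
    have meas: "?g k \<in> borel_measurable (borel \<Otimes>\<^sub>M M)" for k
    proof (rule borel_measurable_LIMSEQ_order[OF lim])
      fix n
      have [measurable]: "(\<lambda>x. ennreal (open_approx V k x)) \<in> borel_measurable borel"
        by (intro borel_measurable_ennreal_continuous continuous_open_approx)
      show "(\<lambda>p. case_option 0 (\<lambda>x. ennreal (open_approx V k x)) (X (ennreal (right_grid n (fst p))) (snd p))) 
        \<in> borel_measurable (borel \<Otimes>\<^sub>M M)"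
        by (rule measurable_right_grid[where f="\<lambda>s \<omega>. case_option 0 (\<lambda>x. ennreal (open_approx V k x)) (X (ennreal s) \<omega>)"]) measurable
    qed
    have "(SUP k. ?g k p) = indicator (Some ` V) (X (ennreal (fst p)) (snd p))" for p
      using SUP_open_approx[OF V(1)] by (cases "X (ennreal (fst p)) (snd p)") (auto simp: indicator_def)
    moreover have "(\<lambda>p. SUP k. ?g k p) \<in> borel_measurable (borel \<Otimes>\<^sub>M M)"
      using meas by measurable
    ultimately have [measurable]: "(\<lambda>p. indicator (Some ` V) (X (ennreal (fst p)) (snd p)) :: ennreal) \<in> borel_measurable (borel \<Otimes>\<^sub>M M)"
      by simp
    have "{p \<in> space (borel \<Otimes>\<^sub>M M). indicator (Some ` V) (X (ennreal (fst p)) (snd p)) = (1::ennreal)} \<in> sets (borel \<Otimes>\<^sub>M M)"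
      by measurable
    then show ?thesis
      by (simp add: indicator_eq_1_iff)
  qed
  obtain \<C> where \<C>: "countable \<C>" "\<And>V. V \<in> \<C> \<Longrightarrow> open V \<and> (\<exists>C. compact C \<and> V \<subseteq> C)" "\<Union>\<C> = U"
    using compact_nbhd_basis[OF U] by blast
  have "{p \<in> space (borel \<Otimes>\<^sub>M M). X (ennreal (fst p)) (snd p) \<in> Some ` U} =
      (\<Union>V\<in>\<C>. {p \<in> space (borel \<Otimes>\<^sub>M M). X (ennreal (fst p)) (snd p) \<in> Some ` V})"
    using \<C>(3) by auto
  also have "\<dots> \<in> sets (borel \<Otimes>\<^sub>M M)"
    using \<C>(1,2) basic by (intro sets.countable_UN') auto
  finally show ?thesis .
qed

lemma measurable_X_joint [measurable]:
  "(\<lambda>p. X (ennreal (fst p)) (snd p)) \<in> borel \<Otimes>\<^sub>M M \<rightarrow>\<^sub>M cemetery_borel"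
proof (rule measurableI)
  let ?S = "\<lambda>A. {p \<in> space (borel \<Otimes>\<^sub>M M). X (ennreal (fst p)) (snd p) \<in> A}"
  have alive: "?S (Some ` UNIV) \<in> sets (borel \<Otimes>\<^sub>M M)"
    by (rule measurable_X_joint_open) simp
  have "?S (Some ` B) \<in> sets (borel \<Otimes>\<^sub>M M)" if "B \<in> sigma_sets UNIV {S. open S}" for B :: "'a set"
    using that
  proof induction
    case (Basic a)
    then show ?case by (simp add: measurable_X_joint_open)
  next
    case (Compl a)
    have "?S (Some ` (UNIV - a)) = ?S (Some ` UNIV) - ?S (Some ` a)"
      by auto
    then show ?case
      using alive Compl by auto
  next
    case (Union a)
    have "?S (Some ` (\<Union>i. a i)) = (\<Union>i. ?S (Some ` a i))"
      by auto
    then show ?case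
      using Union by auto
  qed auto
  then have Borel: "?S (Some ` B) \<in> sets (borel \<Otimes>\<^sub>M M)" if "B \<in> sets borel" for B :: "'a set"
    using that by (simp add: borel_def)
  fix A :: "'a option set" assume A: "A \<in> sets cemetery_borel"
  \<comment> \<open>The living part of \<open>A\<close> is covered by the Borel case; being dead is
    the complement of being alive.\<close>
  have "?S A = ?S (Some ` (Some -` A)) \<union> (if None \<in> A then space (borel \<Otimes>\<^sub>M M) - ?S (Some ` UNIV) else {})"
    by (auto simp: image_iff) (metis option.exhaust)+
  also have "\<dots> \<in> sets (borel \<Otimes>\<^sub>M M)"
    using A Borel[of "Some -` A"] alive by (auto simp: sets_cemetery_borel_iff)
  finally show "(\<lambda>p. X (ennreal (fst p)) (snd p)) -` A \<inter> space (borel \<Otimes>\<^sub>M M) \<in> sets (borel \<Otimes>\<^sub>M M)"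
    by (simp add: vimage_def Int_def conj_commute)
qed simp

end

section \<open>The Laplace transform and the resolvent\<close>

text \<open>Applied to an orbit \<open>\<lambda>t. \<P> t h x\<close> this is the resolvent
  (\<open>resolvent_eq_laplace\<close>), so resolvent identities reduce to calculus for one function
  of time. The value \<open>\<alpha> = 0\<close> gives the potential operator.\<close>

definition laplace :: "real \<Rightarrow> (real \<Rightarrow> ennreal) \<Rightarrow> ennreal" where
  "laplace \<alpha> p = (\<integral>\<^sup>+t. ennreal (exp (- \<alpha> * t)) * p t * indicator {0..} t \<partial>lborel)"

lemma ennreal_exp_add: "ennreal (exp (a + b)) = ennreal (exp a) * ennreal (exp b)"
  by (simp add: exp_add ennreal_mult)

lemma laplace_mono: "(\<And>t. 0 \<le> t \<Longrightarrow> p t \<le> q t) \<Longrightarrow> laplace \<alpha> p \<le> laplace \<alpha> q"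
  unfolding laplace_def by (intro nn_integral_mono) (auto split: split_indicator intro!: mult_left_mono)

lemma laplace_cong: "(\<And>t. 0 \<le> t \<Longrightarrow> p t = q t) \<Longrightarrow> laplace \<alpha> p = laplace \<alpha> q"
  unfolding laplace_def by (intro nn_integral_cong) (auto split: split_indicator)

lemma laplace_shift:
  assumes [measurable]: "p \<in> borel_measurable borel" and s: "0 \<le> s"
  shows "ennreal (exp (- \<alpha> * s)) * laplace \<alpha> (\<lambda>t. p (s + t))
    = (\<integral>\<^sup>+t. ennreal (exp (- \<alpha> * t)) * p t * indicator {s..} t \<partial>lborel)"
proof -
  have "(\<integral>\<^sup>+t. ennreal (exp (- \<alpha> * t)) * p t * indicator {s..} t \<partial>lborel)
      = (\<integral>\<^sup>+t. ennreal (exp (- \<alpha> * (s + t))) * p (s + t) * indicator {s..} (s + t) \<partial>lborel)"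
    using nn_integral_real_affine[of "\<lambda>t. ennreal (exp (- \<alpha> * t)) * p t * indicator {s..} t" 1 s] by simp
  also have "\<dots> = (\<integral>\<^sup>+t. ennreal (exp (- \<alpha> * s)) * (ennreal (exp (- \<alpha> * t)) * p (s + t) * indicator {0..} t) \<partial>lborel)"
    by (intro nn_integral_cong)
       (auto split: split_indicator simp: distrib_left ennreal_exp_add[of "- (\<alpha> * s)", symmetric] mult.assoc[symmetric])
  also have "\<dots> = ennreal (exp (- \<alpha> * s)) * laplace \<alpha> (\<lambda>t. p (s + t))"
    unfolding laplace_def by (intro nn_integral_cmult) measurable
  finally show ?thesis ..
qed

lemma laplace_shift_le:
  assumes "p \<in> borel_measurable borel" and "0 \<le> s"
  shows "ennreal (exp (- \<alpha> * s)) * laplace \<alpha> (\<lambda>t. p (s + t)) \<le> laplace \<alpha> p"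
  unfolding laplace_shift[OF assms] unfolding laplace_def
  using assms(2) by (intro nn_integral_mono) (auto split: split_indicator)

lemma nn_integral_exp_interval:
  assumes "0 < n" and "0 \<le> t"
  shows "(\<integral>\<^sup>+s. ennreal (exp (- n * s)) * indicator {0..t} s \<partial>lborel) = ennreal ((1 - exp (- n * t)) / n)"
proof -
  have "(\<integral>\<^sup>+s. ennreal (exp (- n * s)) * indicator {0..t} s \<partial>lborel)
      = ennreal ((- exp (- n * t) / n) - (- exp (- n * 0) / n))"
    using assms by (intro nn_integral_FTC_Icc) (auto intro!: derivative_eq_intros)
  then show ?thesis
    by (simp add: diff_divide_distrib)
qed

lemma laplace_scale:
  assumes [measurable]: "p \<in> borel_measurable borel" and n: "0 < n"
  shows "ennreal n * laplace (n * \<beta>) p = laplace \<beta> (\<lambda>s. p (s / n))"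
proof -
  have "laplace (n * \<beta>) p = ennreal (1 / n) *
      (\<integral>\<^sup>+s. ennreal (exp (- (n * \<beta>) * (s / n))) * p (s / n) * indicator {0..} (s / n) \<partial>lborel)"
    using n nn_integral_real_affine[of "\<lambda>t. ennreal (exp (- (n * \<beta>) * t)) * p t * indicator {0..} t" "1 / n" 0]
    unfolding laplace_def by simp
  also have "(\<integral>\<^sup>+s. ennreal (exp (- (n * \<beta>) * (s / n))) * p (s / n) * indicator {0..} (s / n) \<partial>lborel)
      = laplace \<beta> (\<lambda>s. p (s / n))"
    unfolding laplace_def using n
    by (intro nn_integral_cong) (auto split: split_indicator simp: field_simps)
  finally have "ennreal n * laplace (n * \<beta>) p = (ennreal n * ennreal (1 / n)) * laplace \<beta> (\<lambda>s. p (s / n))"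
    by (simp add: mult.assoc)
  also have "ennreal n * ennreal (1 / n) = 1"
    using n by (subst ennreal_mult[symmetric]) auto
  finally show ?thesis
    by simp
qed

lemma laplace_const:
  assumes "0 < \<alpha>"
  shows "laplace \<alpha> (\<lambda>_. c) = c * ennreal (1 / \<alpha>)"
proof -
  have "laplace 1 (\<lambda>_. 1) = 1"
    using nn_intergal_power_times_exp_Ici[of 0] unfolding laplace_def by simp
  then have "ennreal \<alpha> * laplace \<alpha> (\<lambda>_. 1) = 1"
    using laplace_scale[of "\<lambda>_. 1" \<alpha> 1] assms by simp
  then have "ennreal (1 / \<alpha>) * (ennreal \<alpha> * laplace \<alpha> (\<lambda>_. 1)) = ennreal (1 / \<alpha>)"
    by simp
  moreover have "ennreal (1 / \<alpha>) * ennreal \<alpha> = 1"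
    using assms by (subst ennreal_mult[symmetric]) auto
  ultimately have 1: "laplace \<alpha> (\<lambda>_. 1) = ennreal (1 / \<alpha>)"
    by (simp add: mult.assoc[symmetric])
  have "laplace \<alpha> (\<lambda>_. c) = (\<integral>\<^sup>+s. c * (ennreal (exp (- \<alpha> * s)) * 1 * indicator {0..} s) \<partial>lborel)"
    unfolding laplace_def by (intro nn_integral_cong) (simp add: mult_ac)
  also have "\<dots> = c * laplace \<alpha> (\<lambda>_. 1)"
    unfolding laplace_def by (rule nn_integral_cmult) measurable
  finally show ?thesis
    by (simp add: 1)
qed

text \<open>By Tonelli the double integral runs over \<open>0 \<le> s \<le> t\<close>, and
  integrating \<open>exp (- n * s)\<close> over \<open>{0..t}\<close> produces exactly the
  difference of the two exponential weights. The additive form stays meaningful when the values are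
  infinite.\<close>

lemma laplace_resolvent_equation:
  assumes [measurable]: "p \<in> borel_measurable borel" and n: "0 < n"
  shows "laplace \<alpha> p =
    laplace (\<alpha> + n) p + ennreal n * laplace (\<alpha> + n) (\<lambda>s. laplace \<alpha> (\<lambda>u. p (s + u)))"
proof -
  let ?g = "\<lambda>t s. ennreal (exp (- n * s)) * ennreal (exp (- \<alpha> * t)) * p t * indicator {0..} s * indicator {s..} t"
  have "laplace (\<alpha> + n) (\<lambda>s. laplace \<alpha> (\<lambda>u. p (s + u))) = (\<integral>\<^sup>+s. \<integral>\<^sup>+t. ?g t s \<partial>lborel \<partial>lborel)"
    unfolding laplace_def[of "\<alpha> + n"]
  proof (intro nn_integral_cong)
    fix s :: real
    show "ennreal (exp (- (\<alpha> + n) * s)) * laplace \<alpha> (\<lambda>u. p (s + u)) * indicator {0..} s = (\<integral>\<^sup>+t. ?g t s \<partial>lborel)"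
    proof (cases "0 \<le> s")
      case True
      have "ennreal (exp (- (\<alpha> + n) * s)) * laplace \<alpha> (\<lambda>u. p (s + u))
          = ennreal (exp (- n * s)) * (ennreal (exp (- \<alpha> * s)) * laplace \<alpha> (\<lambda>u. p (s + u)))"
      proof -
        have "- (\<alpha> + n) * s = - n * s + - \<alpha> * s"
          by (simp add: algebra_simps)
        then show ?thesis
          by (simp only: ennreal_exp_add mult.assoc)
      qed
      also have "\<dots> = ennreal (exp (- n * s)) * (\<integral>\<^sup>+t. ennreal (exp (- \<alpha> * t)) * p t * indicator {s..} t \<partial>lborel)"
        by (simp only: laplace_shift[OF assms(1) True])
      also have "\<dots> = (\<integral>\<^sup>+t. ?g t s \<partial>lborel)"
        using True by (subst nn_integral_cmult[symmetric]) (auto intro!: nn_integral_cong simp: mult_ac)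
      finally show ?thesis
        using True by simp
    qed simp
  qed
  also have "\<dots> = (\<integral>\<^sup>+t. \<integral>\<^sup>+s. ?g t s \<partial>lborel \<partial>lborel)"
  proof (rule lborel_pair.Fubini')
    have "{x \<in> space (lborel \<Otimes>\<^sub>M lborel). snd x \<le> fst x} \<in> sets (lborel \<Otimes>\<^sub>M (lborel :: real measure))"
      by measurable
    then have "indicator {x. snd x \<le> fst x} \<in> borel_measurable (lborel \<Otimes>\<^sub>M (lborel :: real measure))"
      by (simp add: space_pair_measure)
    also have "indicator {x. snd x \<le> fst x} = (\<lambda>x::real \<times> real. indicator {snd x..} (fst x) :: ennreal)"
      by (auto simp: indicator_def)
    finally have [measurable]: "(\<lambda>x::real \<times> real. indicator {snd x..} (fst x) :: ennreal) \<in> borel_measurable (lborel \<Otimes>\<^sub>M lborel)" .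
    show "case_prod ?g \<in> borel_measurable (lborel \<Otimes>\<^sub>M lborel)"
      unfolding case_prod_beta' by measurable
  qed
  also have "\<dots> = (\<integral>\<^sup>+t. ennreal (exp (- \<alpha> * t)) * p t * indicator {0..} t * ennreal ((1 - exp (- n * t)) / n) \<partial>lborel)"
  proof (intro nn_integral_cong)
    fix t :: real
    show "(\<integral>\<^sup>+s. ?g t s \<partial>lborel) = ennreal (exp (- \<alpha> * t)) * p t * indicator {0..} t * ennreal ((1 - exp (- n * t)) / n)"
    proof (cases "0 \<le> t")
      case True
      have "(\<integral>\<^sup>+s. ?g t s \<partial>lborel) = (\<integral>\<^sup>+s. (ennreal (exp (- \<alpha> * t)) * p t) * (ennreal (exp (- n * s)) * indicator {0..t} s) \<partial>lborel)"
        by (intro nn_integral_cong) (auto split: split_indicator simp: mult_ac)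
      also have "\<dots> = (ennreal (exp (- \<alpha> * t)) * p t) * (\<integral>\<^sup>+s. ennreal (exp (- n * s)) * indicator {0..t} s \<partial>lborel)"
        by (intro nn_integral_cmult) measurable
      finally show ?thesis
        using True by (simp add: nn_integral_exp_interval[OF n True, simplified])
    next
      case False
      then have "?g t = (\<lambda>s. 0)"
        by (auto split: split_indicator)
      then show ?thesis
        using False by (simp only: nn_integral_const mult_zero_left) simp
    qed
  qed
  finally have "ennreal n * laplace (\<alpha> + n) (\<lambda>s. laplace \<alpha> (\<lambda>u. p (s + u)))
     = (\<integral>\<^sup>+t. ennreal n * (ennreal (exp (- \<alpha> * t)) * p t * indicator {0..} t * ennreal ((1 - exp (- n * t)) / n)) \<partial>lborel)"
    by (simp add: nn_integral_cmult)
  then have "laplace (\<alpha> + n) p + ennreal n * laplace (\<alpha> + n) (\<lambda>s. laplace \<alpha> (\<lambda>u. p (s + u)))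
     = (\<integral>\<^sup>+t. ennreal (exp (- (\<alpha> + n) * t)) * p t * indicator {0..} t +
          ennreal n * (ennreal (exp (- \<alpha> * t)) * p t * indicator {0..} t * ennreal ((1 - exp (- n * t)) / n)) \<partial>lborel)"
    unfolding laplace_def[of "\<alpha> + n" p] by (subst nn_integral_add) auto
  also have "\<dots> = laplace \<alpha> p"
    unfolding laplace_def
  proof (intro nn_integral_cong)
    fix t :: real
    have "ennreal n * (ennreal (exp (- \<alpha> * t)) * ennreal ((1 - exp (- n * t)) / n)) = ennreal (exp (- \<alpha> * t) * (1 - exp (- n * t)))"
      if "0 \<le> t" using that n by (simp add: ennreal_mult[symmetric])
    moreover have "ennreal (exp (- (\<alpha> + n) * t)) + ennreal (exp (- \<alpha> * t) * (1 - exp (- n * t))) = ennreal (exp (- \<alpha> * t))"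
      if "0 \<le> t" using that n 
      by (subst ennreal_plus[symmetric]) (auto simp: right_diff_distrib distrib_right exp_add exp_diff exp_minus field_simps)
    ultimately show "ennreal (exp (- (\<alpha> + n) * t)) * p t * indicator {0..} t +
          ennreal n * (ennreal (exp (- \<alpha> * t)) * p t * indicator {0..} t * ennreal ((1 - exp (- n * t)) / n))
      = ennreal (exp (- \<alpha> * t)) * p t * indicator {0..} t"
      by (cases "0 \<le> t") (simp_all, metis distrib_right mult.assoc mult.commute)
  qed
  finally show ?thesis ..
qed

lemma SUP_indicator_UN: "(\<lambda>x. SUP n. indicator (A n) x :: ennreal) = indicator (\<Union>n. A n)"
proof
  fix x
  show "(SUP n. indicator (A n) x :: ennreal) = indicator (\<Union>n. A n) x"
  proof (cases "\<exists>n. x \<in> A n")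
    case True
    then obtain n where n: "x \<in> A n" ..
    have "(SUP n. indicator (A n) x :: ennreal) \<le> 1"
      by (rule SUP_least) (simp add: indicator_def)
    moreover have "1 \<le> (SUP n. indicator (A n) x :: ennreal)"
      using SUP_upper[of n UNIV "\<lambda>n. indicator (A n) x :: ennreal"] n by simp
    ultimately have "(SUP n. indicator (A n) x :: ennreal) = 1"
      by (rule antisym)
    then show ?thesis
      using n by (metis UN_I UNIV_I indicator_simps(1))
  qed auto
qed

section \<open>Joint measurability of the semigroup and calculus of the resolvent\<close>

context hunt_process_lc
begin

lemma transition_right_continuous:
  fixes f :: "'a \<Rightarrow> real"
  assumes f: "continuous_on UNIV f" "\<And>x. 0 \<le> f x" "\<And>x. f x \<le> 1"
    and C: "compact C" "\<And>x. x \<notin> C \<Longrightarrow> f x = 0"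
  shows "(\<lambda>n. \<P> (right_grid n t) (\<lambda>x. ennreal (f x)) x)
    \<longlonglongrightarrow> \<P> t (\<lambda>x. ennreal (f x)) x"
  unfolding transition_def
proof (rule nn_integral_dominated_convergence[where w="\<lambda>_. 1"])
  have [measurable]: "(\<lambda>x. ennreal (f x)) \<in> borel_measurable borel"
    by (rule borel_measurable_ennreal_continuous[OF f(1)])
  show "(\<lambda>\<omega>. case_option 0 (\<lambda>x. ennreal (f x)) (X (ennreal (right_grid n t)) \<omega>)) \<in> borel_measurable (P (Some x))" for n
    by measurable
  show "(\<lambda>\<omega>. case_option 0 (\<lambda>x. ennreal (f x)) (X (ennreal t) \<omega>)) \<in> borel_measurable (P (Some x))"
    by measurable
  show "AE \<omega> in P (Some x). case_option 0 (\<lambda>x. ennreal (f x)) (X (ennreal (right_grid n t)) \<omega>) \<le> 1" for n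
    using f(3) by (auto split: option.split)
  show "(\<integral>\<^sup>+\<omega>. 1 \<partial>P (Some x)) < \<infinity>"
    by simp
  show "AE \<omega> in P (Some x). (\<lambda>n. case_option 0 (\<lambda>x. ennreal (f x)) (X (ennreal (right_grid n t)) \<omega>))
      \<longlonglongrightarrow> case_option 0 (\<lambda>x. ennreal (f x)) (X (ennreal t) \<omega>)"
    unfolding ennreal_case_option[symmetric]
    by (intro AE_I2 tendsto_ennrealI right_continuous_observable_grid[OF _ f(1) C]) simp_all
qed simp

definition relatively_compact_open :: "'a set set" where
  "relatively_compact_open = {V. open V \<and> (\<exists>C. compact C \<and> V \<subseteq> C)}"

lemma measurable_transition_open:
  assumes "V \<in> relatively_compact_open"
  shows "(\<lambda>p. \<P> (fst p) (indicator V) (snd p)) \<in> borel_measurable (borel \<Otimes>\<^sub>M borel)"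
proof -
  obtain C where V: "open V" "compact C" "V \<subseteq> C"
    using assms by (auto simp: relatively_compact_open_def)
  have [measurable]: "(\<lambda>x. ennreal (open_approx V k x)) \<in> borel_measurable borel" for k
    by (intro borel_measurable_ennreal_continuous continuous_open_approx)
  have "(\<lambda>p. \<P> (fst p) (\<lambda>x. ennreal (open_approx V k x)) (snd p)) \<in> borel_measurable (borel \<Otimes>\<^sub>M borel)" for k
  proof (rule borel_measurable_LIMSEQ_order)
    show "(\<lambda>n. \<P> (right_grid n (fst p)) (\<lambda>x. ennreal (open_approx V k x)) (snd p))
        \<longlonglongrightarrow> \<P> (fst p) (\<lambda>x. ennreal (open_approx V k x)) (snd p)" for p
      using V(3) by (intro transition_right_continuous[OF continuous_open_approx open_approx_range V(2)]) 
        (auto intro!: open_approx_outside)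
    show "(\<lambda>p. \<P> (right_grid n (fst p)) (\<lambda>x. ennreal (open_approx V k x)) (snd p)) 
      \<in> borel_measurable (borel \<Otimes>\<^sub>M borel)" for n
      by (rule measurable_right_grid[where f="\<lambda>s. \<P> s (\<lambda>x. ennreal (open_approx V k x))"]) measurable
  qed
  then have "(\<lambda>p. SUP k. \<P> (fst p) (\<lambda>x. ennreal (open_approx V k x)) (snd p)) \<in> borel_measurable (borel \<Otimes>\<^sub>M borel)"
    by measurable
  moreover have "incseq (\<lambda>k x. ennreal (open_approx V k x))"
    using incseq_open_approx[of V] by (auto simp: incseq_def le_fun_def intro!: ennreal_leI)
  then have "transition P X t (\<lambda>x. SUP k. ennreal (open_approx V k x)) x = (SUP k. transition P X t (\<lambda>x. ennreal (open_approx V k x)) x)" for t x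
    by (rule transition_SUP[rotated]) measurable
  ultimately show ?thesis
    unfolding SUP_open_approx[OF V(1)] by simp
qed

lemma relatively_compact_open_exhaustion:
  obtains W :: "nat \<Rightarrow> 'a set" where "range W \<subseteq> relatively_compact_open" "incseq W" "(\<Union>n. W n) = UNIV"
proof -
  obtain \<C> :: "'a set set" where \<C>: "countable \<C>" "\<And>V. V \<in> \<C> \<Longrightarrow> open V \<and> (\<exists>C. compact C \<and> V \<subseteq> C)" "\<Union>\<C> = UNIV"
    using compact_nbhd_basis[OF open_UNIV] by blast
  have ne: "\<C> \<noteq> {}"
    using \<C>(3) by auto
  define W where "W n = (\<Union>i\<le>n. from_nat_into \<C> i)" for n
  have "W n \<in> relatively_compact_open" for n
  proof -
    have *: "\<exists>C. compact C \<and> from_nat_into \<C> i \<subseteq> C" "open (from_nat_into \<C> i)" for i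
      using \<C>(2) from_nat_into[OF ne] by auto
    then obtain C where "\<And>i. compact (C i) \<and> from_nat_into \<C> i \<subseteq> C i"
      by metis
    then have "compact (\<Union>i\<le>n. C i)" "W n \<subseteq> (\<Union>i\<le>n. C i)"
      unfolding W_def by (auto intro!: compact_UN)
    then show ?thesis
      using *(2) unfolding relatively_compact_open_def W_def by blast
  qed
  moreover have "incseq W"
    unfolding W_def incseq_def by (intro allI impI UN_mono) auto
  moreover have "(\<Union>n. W n) = (\<Union>n. from_nat_into \<C> n)"
    unfolding W_def by auto
  then have "(\<Union>n. W n) = \<Union>\<C>"
    using range_from_nat_into[OF ne \<C>(1)] by auto
  ultimately show ?thesis
    using that[of W] \<C>(3) by auto
qed

lemma borel_eq_sigma_relatively_compact_open: "sets borel = sigma_sets UNIV relatively_compact_open"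
proof -
  have "sets (borel :: 'a measure) = sigma_sets UNIV {S. open S}"
    by (simp add: borel_def)
  also have "\<dots> = sigma_sets UNIV relatively_compact_open"
  proof (rule sigma_sets_eqI)
    fix U assume "U \<in> {S :: 'a set. open S}"
    then have "open U" by simp
    then obtain \<C> where \<C>: "countable \<C>" "\<And>V. V \<in> \<C> \<Longrightarrow> open V \<and> (\<exists>C. compact C \<and> V \<subseteq> C)" "\<Union>\<C> = U"
      using compact_nbhd_basis[of U] by blast
    then show "U \<in> sigma_sets UNIV relatively_compact_open"
      using sigma_sets_UNION[of \<C> UNIV relatively_compact_open]
      by (auto simp: relatively_compact_open_def)
  qed (auto simp: relatively_compact_open_def)
  finally show ?thesis .
qed

text \<open>Dynkin's argument over the intersection-stable generator of relatively compact open
  sets. The whole space need not belong to the generator and comes from an exhaustion; the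
  complement step may subtract because transition probabilities are at most
  \<open>1\<close>.\<close>

lemma measurable_transition_indicator:
  assumes "B \<in> sets borel"
  shows "(\<lambda>p. \<P> (fst p) (indicator B) (snd p)) \<in> borel_measurable (borel \<Otimes>\<^sub>M borel)"
    (is "?f B \<in> _")
proof -
  obtain W :: "nat \<Rightarrow> 'a set" where W: "range W \<subseteq> relatively_compact_open" "incseq W" "(\<Union>n. W n) = UNIV"
    using relatively_compact_open_exhaustion by blast
  have univ: "?f UNIV \<in> borel_measurable (borel \<Otimes>\<^sub>M borel)"
  proof -
    have "?f (W n) \<in> borel_measurable (borel \<Otimes>\<^sub>M borel)" for n
      using W(1) by (intro measurable_transition_open) auto
    then have "(\<lambda>p. SUP n. ?f (W n) p) \<in> borel_measurable (borel \<Otimes>\<^sub>M borel)"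
      by measurable
    moreover have "W n \<in> relatively_compact_open" for n
      using W(1) by auto
    then have "W n \<in> sets borel" for n
      by (simp add: relatively_compact_open_def)
    then have "transition P X t (\<lambda>x. SUP n. indicator (W n) x) x = (SUP n. transition P X t (indicator (W n)) x)" for t x
      using W(2) by (intro transition_SUP) (auto simp: incseq_def le_fun_def indicator_def)
    ultimately show ?thesis
      unfolding SUP_indicator_UN W(3) by simp
  qed
  have stable: "Int_stable (relatively_compact_open :: 'a set set)"
    unfolding Int_stable_def relatively_compact_open_def by blast
  have "B \<in> sigma_sets UNIV relatively_compact_open"
    using assms by (simp add: borel_eq_sigma_relatively_compact_open)
  with stable subset_UNIV[of relatively_compact_open, folded Pow_UNIV] show ?thesis
  proof (induction rule: sigma_sets_induct_disjoint)
    case (basic A)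
    then show ?case by (rule measurable_transition_open)
  next
    case empty
    have "(indicator {} :: 'a \<Rightarrow> ennreal) = (\<lambda>_. 0)"
      by auto
    then show ?case
      using transition_const_le[of _ 0] by simp
  next
    case (compl A)
    then have A: "A \<in> sets borel"
      by (simp add: borel_eq_sigma_relatively_compact_open)
    have "transition P X t (indicator A) x \<le> 1" for t x
      by (rule transition_le_const) (simp add: indicator_def)
    then have fin: "transition P X t (indicator A) x \<noteq> \<infinity>" for t x
      by (metis ennreal_one_less_top infinity_ennreal_def leD)
    have "(indicator (UNIV - A) :: 'a \<Rightarrow> ennreal) = (\<lambda>x. indicator UNIV x - indicator A x)"
      by (auto simp: indicator_def)
    then have "transition P X t (indicator (UNIV - A)) x = transition P X t (indicator UNIV) x - transition P X t (indicator A) x" for t x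
      using A transition_diff[OF _ _ _ fin[of t x]] by (simp add: indicator_def[of UNIV] indicator_def[of A])
    then show ?case
      using univ compl by simp
  next
    case (union A)
    have A: "range A \<subseteq> sets borel"
      using union(2) by (simp add: borel_eq_sigma_relatively_compact_open)
    have "transition P X t (indicator (\<Union>i. A i)) x = (\<Sum>i. transition P X t (indicator (A i)) x)" for t x
    proof -
      have "(\<Sum>i. emeasure (P (Some x)) {\<omega> \<in> space M. X t \<omega> \<in> Some ` A i}) =
          emeasure (P (Some x)) (\<Union>i. {\<omega> \<in> space M. X t \<omega> \<in> Some ` A i})"
      proof (rule suminf_emeasure)
        show "range (\<lambda>i. {\<omega> \<in> space M. X t \<omega> \<in> Some ` A i}) \<subseteq> sets (P (Some x))"
          using A by (auto intro!: sets_X_in)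
        show "disjoint_family (\<lambda>i. {\<omega> \<in> space M. X t \<omega> \<in> Some ` A i})"
          unfolding disjoint_family_on_def
        proof (intro ballI impI)
          fix m n :: nat assume "m \<noteq> n"
          then have "A m \<inter> A n = {}"
            using union(1) by (simp add: disjoint_family_on_def)
          then show "{\<omega> \<in> space M. X t \<omega> \<in> Some ` A m} \<inter> {\<omega> \<in> space M. X t \<omega> \<in> Some ` A n} = {}"
            unfolding disjoint_iff by auto
        qed
      qed
      also have "(\<Union>i. {\<omega> \<in> space M. X t \<omega> \<in> Some ` A i}) = {\<omega> \<in> space M. X t \<omega> \<in> Some ` (\<Union>i. A i)}"
        by auto
      finally show ?thesis
        using A by (subst (1 2) transition_indicator) auto
    qed
    then show ?case
      using union(3) by simp
  qed
qed

lemma measurable_transition_joint: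
  assumes "h \<in> borel_measurable borel"
  shows "(\<lambda>p. \<P> (fst p) h (snd p)) \<in> borel_measurable (borel \<Otimes>\<^sub>M borel)"
  using assms
proof (induction h rule: borel_measurable_induct)
  case (cong f g)
  then have eq: "f = g" by auto
  show ?case unfolding eq by (rule cong.IH)
next
  case (set A)
  then show ?case by (rule measurable_transition_indicator)
next
  case (mult u c)
  show ?case
    unfolding transition_cmult[OF mult(2)] using mult.IH by simp
next
  case (add u v)
  show ?case
    unfolding transition_add[OF add(3,1)] using add.IH by simp
next
  case (seq U)
  have eq: "(SUP i. U i) = (\<lambda>x. SUP i. U i x)"
    by (auto simp: image_comp)
  show ?case
    unfolding eq transition_SUP[OF seq(1) \<open>incseq U\<close>] using seq.IH by simp
qed

lemma measurable_transition_time [measurable]: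
  assumes "h \<in> borel_measurable borel"
  shows "(\<lambda>t. \<P> t h x) \<in> borel_measurable borel"
  using measurable_compose[of "\<lambda>t. (t, x)" borel "borel \<Otimes>\<^sub>M borel", OF _ measurable_transition_joint[OF assms]]
  by simp

lemma transition_nn_integral:
  assumes k: "(\<lambda>(t, x). k t x) \<in> borel_measurable (lborel \<Otimes>\<^sub>M borel)"
  shows "transition P X s (\<lambda>y. \<integral>\<^sup>+t. k t y \<partial>lborel) x = (\<integral>\<^sup>+t. transition P X s (k t) x \<partial>lborel)"
proof -
  interpret P: prob_space "P (Some x)" by simp
  interpret pair_sigma_finite lborel "P (Some x)" ..
  have "(\<lambda>p. (fst p, X s (snd p))) \<in> lborel \<Otimes>\<^sub>M P (Some x) \<rightarrow>\<^sub>M lborel \<Otimes>\<^sub>M cemetery_borel"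
    by measurable
  from measurable_compose[OF this borel_measurable_case_option_param[OF k]]
  have meas: "(\<lambda>(t, \<omega>). case_option 0 (k t) (X s \<omega>)) \<in> borel_measurable (lborel \<Otimes>\<^sub>M P (Some x))"
    unfolding case_prod_beta' fst_conv snd_conv .
  have "transition P X s (\<lambda>y. \<integral>\<^sup>+t. k t y \<partial>lborel) x = (\<integral>\<^sup>+\<omega>. \<integral>\<^sup>+t. case_option 0 (k t) (X s \<omega>) \<partial>lborel \<partial>P (Some x))"
    unfolding transition_def by (intro nn_integral_cong) (auto split: option.split)
  also have "\<dots> = (\<integral>\<^sup>+t. \<integral>\<^sup>+\<omega>. case_option 0 (k t) (X s \<omega>) \<partial>P (Some x) \<partial>lborel)"
    by (rule Fubini'[OF meas])
  finally show ?thesis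
    unfolding transition_def .
qed

text \<open>Joint measurability allows the exchange of time and expectation. The cut-off at the
  lifetime can be replaced by \<open>0 \<le> t\<close> since the integrand vanishes in the
  cemetery.\<close>

lemma resolvent_eq_laplace:
  assumes [measurable]: "h \<in> borel_measurable borel"
  shows "\<R> \<alpha> h x = laplace \<alpha> (\<lambda>t. \<P> t h x)"
proof -
  interpret P: prob_space "P (Some x)" by simp
  interpret pair_sigma_finite lborel "P (Some x)" ..
  have "(\<lambda>p. case_option 0 h (X (ennreal (fst p)) (snd p))) \<in> borel_measurable (borel \<Otimes>\<^sub>M M)"
    by measurable
  then have 1: "(\<lambda>p. case_option 0 h (X (ennreal (fst p)) (snd p))) \<in> borel_measurable (lborel \<Otimes>\<^sub>M P (Some x))"
    by (simp cong: measurable_cong_sets sets_pair_measure_cong)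
  have meas: "(\<lambda>(t, \<omega>). ennreal (exp (- \<alpha> * t)) * case_option 0 h (X (ennreal t) \<omega>) * indicator {0..} t)
      \<in> borel_measurable (lborel \<Otimes>\<^sub>M P (Some x))"
    unfolding case_prod_beta' using 1 by measurable
  have alive: "ennreal t < lifetime X \<omega> \<or> X (ennreal t) \<omega> = None" if "\<omega> \<in> space M" for t \<omega>
    using dead_after_lifetime[OF that, of "ennreal t"] by (meson linorder_not_le)
  have "\<R> \<alpha> h x
      = (\<integral>\<^sup>+\<omega>. \<integral>\<^sup>+t. ennreal (exp (- \<alpha> * t)) * case_option 0 h (X (ennreal t) \<omega>) * indicator {0..} t \<partial>lborel \<partial>P (Some x))"
    unfolding resolvent_def
  proof (intro nn_integral_cong)
    fix \<omega> and t :: real assume "\<omega> \<in> space (P (Some x))"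
    then show "indicator {t. 0 \<le> t \<and> ennreal t < lifetime X \<omega>} t *
        (ennreal (exp (- \<alpha> * t)) * case_option 0 h (X (ennreal t) \<omega>)) =
      ennreal (exp (- \<alpha> * t)) * case_option 0 h (X (ennreal t) \<omega>) * indicator {0..} t"
      using alive[of \<omega> t] by (cases "ennreal t < lifetime X \<omega>") (auto simp: mult.commute indicator_def)
  qed
  also have "\<dots> = (\<integral>\<^sup>+t. \<integral>\<^sup>+\<omega>. ennreal (exp (- \<alpha> * t)) * case_option 0 h (X (ennreal t) \<omega>) * indicator {0..} t \<partial>P (Some x) \<partial>lborel)"
    by (rule Fubini'[OF meas])
  also have "\<dots> = laplace \<alpha> (\<lambda>t. \<P> t h x)"
    unfolding laplace_def transition_def
  proof (intro nn_integral_cong)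
    fix t
    show "(\<integral>\<^sup>+\<omega>. ennreal (exp (- \<alpha> * t)) * case_option 0 h (X (ennreal t) \<omega>) * indicator {0..} t \<partial>P (Some x))
      = ennreal (exp (- \<alpha> * t)) * (\<integral>\<^sup>+\<omega>. case_option 0 h (X (ennreal t) \<omega>) \<partial>P (Some x)) * indicator {0..} t"
      by (simp add: nn_integral_cmult nn_integral_multc)
  qed
  finally show ?thesis .
qed

lemma transition_resolvent:
  assumes h[measurable]: "h \<in> borel_measurable borel" and s: "0 \<le> s"
  shows "\<P> s (\<R> \<alpha> h) x = laplace \<alpha> (\<lambda>t. \<P> (s + t) h x)"
proof -
  note joint = measurable_transition_joint[OF h]
  have "(\<lambda>p. \<P> (fst p) h (snd p)) \<in> borel_measurable (lborel \<Otimes>\<^sub>M borel)"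
    using joint by (simp cong: measurable_cong_sets sets_pair_measure_cong)
  then have meas: "(\<lambda>(t, y). ennreal (exp (- \<alpha> * t)) * \<P> t h y * indicator {0..} t) \<in> borel_measurable (lborel \<Otimes>\<^sub>M borel)"
    unfolding case_prod_beta' by measurable
  have "\<R> \<alpha> h = (\<lambda>y. \<integral>\<^sup>+t. ennreal (exp (- \<alpha> * t)) * \<P> t h y * indicator {0..} t \<partial>lborel)"
    unfolding resolvent_eq_laplace[OF h, abs_def] laplace_def ..
  then have "\<P> s (\<R> \<alpha> h) x =
      (\<integral>\<^sup>+t. \<P> s (\<lambda>y. ennreal (exp (- \<alpha> * t)) * \<P> t h y * indicator {0..} t) x \<partial>lborel)"
    by (simp only: transition_nn_integral[OF meas])
  also have "\<dots> = laplace \<alpha> (\<lambda>t. \<P> (s + t) h x)"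
    unfolding laplace_def
  proof (intro nn_integral_cong)
    fix t
    have "\<P> s (\<lambda>y. (ennreal (exp (- \<alpha> * t)) * indicator {0..} t) * \<P> t h y) x
       = (ennreal (exp (- \<alpha> * t)) * indicator {0..} t) * \<P> s (\<P> t h) x"
      by (rule transition_cmult) measurable
    then show "\<P> s (\<lambda>y. ennreal (exp (- \<alpha> * t)) * \<P> t h y * indicator {0..} t) x
      = ennreal (exp (- \<alpha> * t)) * \<P> (s + t) h x * indicator {0..} t"
      using s by (cases "0 \<le> t") (simp_all add: transition_transition mult_ac)
  qed
  finally show ?thesis .
qed

lemma borel_measurable_resolvent [measurable]:
  assumes h[measurable]: "h \<in> borel_measurable borel"
  shows "\<R> \<alpha> h \<in> borel_measurable borel"
proof -
  have [measurable]: "(\<lambda>p. \<P> (snd p) h (fst p)) \<in> borel_measurable (borel \<Otimes>\<^sub>M borel)"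
    using measurable_compose[of "\<lambda>p. (snd p, fst p)" "borel \<Otimes>\<^sub>M borel" "borel \<Otimes>\<^sub>M borel", OF _ measurable_transition_joint[OF h]]
    by simp
  have "(\<lambda>y. \<integral>\<^sup>+t. ennreal (exp (- \<alpha> * t)) * \<P> t h y * indicator {0..} t \<partial>lborel) \<in> borel_measurable borel"
    by (intro lborel.borel_measurable_nn_integral) (unfold case_prod_beta', measurable)
  then show ?thesis
    unfolding resolvent_eq_laplace[OF h, abs_def] laplace_def .
qed

lemma resolvent_supermedian:
  assumes [measurable]: "h \<in> borel_measurable borel" and "0 \<le> s"
  shows "ennreal (exp (- \<alpha> * s)) * \<P> s (\<R> \<alpha> h) x \<le> \<R> \<alpha> h x"
  using laplace_shift_le[of "\<lambda>t. \<P> t h x" s \<alpha>] assms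
  by (simp add: transition_resolvent resolvent_eq_laplace[of h])

lemma resolvent_equation:
  assumes [measurable]: "h \<in> borel_measurable borel" and "0 < n"
  shows "\<R> \<alpha> h x = \<R> (\<alpha> + n) h x + ennreal n * \<R> (\<alpha> + n) (\<R> \<alpha> h) x"
proof -
  have "laplace (\<alpha> + n) (\<lambda>s. laplace \<alpha> (\<lambda>u. \<P> (s + u) h x)) = \<R> (\<alpha> + n) (\<R> \<alpha> h) x"
    unfolding resolvent_eq_laplace[OF borel_measurable_resolvent[OF assms(1)]]
    by (auto intro!: laplace_cong simp: transition_resolvent)
  then show ?thesis
    using laplace_resolvent_equation[of "\<lambda>t. \<P> t h x" n \<alpha>] assms
    by (simp add: resolvent_eq_laplace[of h])
qed

lemma resolvent_mono:
  "(\<And>x. h x \<le> k x) \<Longrightarrow> \<R> \<alpha> h x \<le> \<R> \<alpha> k x"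
  unfolding resolvent_def
  by (intro nn_integral_mono mult_left_mono) (auto split: option.split)

lemma resolvent_add:
  assumes [measurable]: "h \<in> borel_measurable borel" "k \<in> borel_measurable borel"
  shows "\<R> \<alpha> (\<lambda>x. h x + k x) x = \<R> \<alpha> h x + \<R> \<alpha> k x"
  unfolding resolvent_eq_laplace[OF assms(1)] resolvent_eq_laplace[OF assms(2)]
  by (subst resolvent_eq_laplace) (simp_all add: laplace_def transition_add distrib_left distrib_right nn_integral_add)

lemma resolvent_cmult:
  assumes [measurable]: "h \<in> borel_measurable borel"
  shows "\<R> \<alpha> (\<lambda>x. c * h x) x = c * \<R> \<alpha> h x"
proof -
  have "\<R> \<alpha> (\<lambda>x. c * h x) x = (\<integral>\<^sup>+t. c * (ennreal (exp (- \<alpha> * t)) * \<P> t h x * indicator {0..} t) \<partial>lborel)"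
    by (subst resolvent_eq_laplace) (auto simp: laplace_def transition_cmult mult_ac intro!: nn_integral_cong)
  also have "\<dots> = c * \<R> \<alpha> h x"
    unfolding resolvent_eq_laplace[OF assms] laplace_def by (rule nn_integral_cmult) measurable
  finally show ?thesis .
qed

lemma resolvent_SUP:
  assumes [measurable]: "\<And>i::nat. h i \<in> borel_measurable borel" and inc: "incseq h"
  shows "\<R> \<alpha> (\<lambda>x. SUP i. h i x) x = (SUP i. \<R> \<alpha> (h i) x)"
proof -
  have "\<R> \<alpha> (\<lambda>x. SUP i. h i x) x = (\<integral>\<^sup>+t. (SUP i. ennreal (exp (- \<alpha> * t)) * \<P> t (h i) x * indicator {0..} t) \<partial>lborel)"
    by (subst resolvent_eq_laplace)
      (auto simp: laplace_def transition_SUP[OF assms] SUP_mult_left_ennreal SUP_mult_right_ennreal intro!: nn_integral_cong)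
  also have "\<dots> = (SUP i. \<R> \<alpha> (h i) x)"
    unfolding resolvent_eq_laplace[OF assms(1)] laplace_def
    using inc by (intro nn_integral_monotone_convergence_SUP)
      (auto simp: incseq_def le_fun_def intro!: mult_left_mono mult_right_mono transition_mono)
  finally show ?thesis .
qed

lemma resolvent_le_const:
  assumes [measurable]: "h \<in> borel_measurable borel" and "\<And>x. h x \<le> c" and "0 < \<alpha>"
  shows "\<R> \<alpha> h x \<le> c * ennreal (1 / \<alpha>)"
proof -
  have "\<R> \<alpha> h x \<le> laplace \<alpha> (\<lambda>_. c)"
    unfolding resolvent_eq_laplace[OF assms(1)] using assms(2)
    by (intro laplace_mono transition_le_const)
  then show ?thesis
    by (simp add: laplace_const[OF assms(3)])
qed

section \<open>Small-time behaviour of the semigroup and of the resolvent\<close>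

lemma transition_open_tendsto:
  assumes U: "open U" "x \<in> U" and s: "s \<longlonglongrightarrow> 0" "\<And>n. 0 < s n"
  shows "(\<lambda>n. \<P> (s n) (indicator U) x) \<longlonglongrightarrow> 1"
proof -
  have "(\<lambda>n. \<P> (s n) (indicator U) x) \<longlonglongrightarrow> (\<integral>\<^sup>+\<omega>. 1 \<partial>P (Some x))"
    unfolding transition_def
  proof (rule nn_integral_dominated_convergence[where w="\<lambda>_. 1"])
    have [measurable]: "indicator U \<in> borel_measurable borel"
      using U by simp
    show "(\<lambda>\<omega>. case_option 0 (indicator U) (X (ennreal (s n)) \<omega>) :: ennreal) \<in> borel_measurable (P (Some x))" for n
      by measurable
    show "AE \<omega> in P (Some x). case_option 0 (indicator U) (X (ennreal (s n)) \<omega>) \<le> (1::ennreal)" for n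
      by (auto split: option.split simp: indicator_def)
    show "(\<integral>\<^sup>+\<omega>. 1 \<partial>P (Some x)) < \<infinity>"
      by simp
    have "filterlim s (at_right 0) sequentially"
      unfolding filterlim_at using s by (auto intro!: always_eventually simp: less_imp_neq[symmetric])
    then have ev: "\<forall>\<^sub>F n in sequentially. X (ennreal (s n)) \<omega> \<in> Some ` U" if "\<omega> \<in> space M" "X 0 \<omega> = Some x" for \<omega>
      using eventually_X_right_open[OF that(1) order_refl U(1)] that(2) U(2)
      by (auto simp: filterlim_iff)
    have lim: "(\<lambda>n. case_option 0 (indicator U) (X (ennreal (s n)) \<omega>) :: ennreal) \<longlonglongrightarrow> 1" if "\<omega> \<in> space M" "X 0 \<omega> = Some x" for \<omega>
      using ev[OF that] by (intro tendsto_eventually) (auto elim!: eventually_mono)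
    show "AE \<omega> in P (Some x). (\<lambda>n. case_option 0 (indicator U) (X (ennreal (s n)) \<omega>) :: ennreal) \<longlonglongrightarrow> 1"
      using normal[of "Some x"] AE_space by eventually_elim (simp add: lim)
  qed simp_all
  then show ?thesis
    by simp
qed

text \<open>With \<open>N = Suc n\<close>, the substitution \<open>t = s / N\<close> turns the
  expression into a Laplace transform of \<open>\<P> (s / N) (indicator U) x\<close>, which tends to
  \<open>1\<close> by right continuity; Fatou then compares with the integral of
  \<open>exp (- s)\<close>. Discount \<open>1 / N\<close> and penalty \<open>N\<close> are the pair
  used later for the penalized equation.\<close>

lemma resolvent_open_liminf:
  assumes U: "open U" "x \<in> U"
  shows "1 \<le> liminf (\<lambda>n. ennreal (real (Suc n)) * \<R> (1 / real (Suc n) + real (Suc n)) (indicator U) x)"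
proof -
  have [measurable]: "indicator U \<in> borel_measurable borel"
    using U by simp
  \<comment> \<open>The total rate \<open>1 / N + N\<close> divided by the time scale
    \<open>N\<close>.\<close>
  let ?b = "\<lambda>n. 1 / (real (Suc n))\<^sup>2 + 1"
  have eq: "ennreal (real (Suc n)) * \<R> (1 / real (Suc n) + real (Suc n)) (indicator U) x =
      laplace (?b n) (\<lambda>s. \<P> (s / real (Suc n)) (indicator U) x)" for n
  proof -
    have "1 / real (Suc n) + real (Suc n) = real (Suc n) * ?b n"
      by (simp add: field_simps power2_eq_square del: of_nat_Suc)
    then show ?thesis
      using laplace_scale[of "\<lambda>t. \<P> t (indicator U) x" "real (Suc n)" "?b n"]
      by (simp add: resolvent_eq_laplace del: of_nat_Suc)
  qed
  have b: "?b \<longlonglongrightarrow> 1"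
  proof -
    have "(\<lambda>n. (inverse (real (Suc n)))\<^sup>2 + 1) \<longlonglongrightarrow> 0\<^sup>2 + 1"
      by (intro tendsto_intros LIMSEQ_inverse_real_of_nat)
    then show ?thesis
      by (simp add: inverse_eq_divide power_divide)
  qed
  have lim: "(\<lambda>n. ennreal (exp (- ?b n * s)) * \<P> (s / real (Suc n)) (indicator U) x * indicator {0..} s)
     \<longlonglongrightarrow> ennreal (exp (- 1 * s)) * 1 * indicator {0..} s" if "s \<noteq> 0" for s
  proof (cases "0 < s")
    case True
    have "(\<lambda>n. s * inverse (real (Suc n))) \<longlonglongrightarrow> s * 0"
      by (intro tendsto_intros LIMSEQ_inverse_real_of_nat)
    then have "(\<lambda>n. s / real (Suc n)) \<longlonglongrightarrow> 0"
      by (simp add: divide_inverse)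
    then have tr: "(\<lambda>n. \<P> (s / real (Suc n)) (indicator U) x) \<longlonglongrightarrow> 1"
      using True by (intro transition_open_tendsto[OF U]) auto
    have "(\<lambda>n. ennreal (exp (- ?b n * s))) \<longlonglongrightarrow> ennreal (exp (- 1 * s))"
      by (intro tendsto_intros b)
    then have "(\<lambda>n. ennreal (exp (- ?b n * s)) * \<P> (s / real (Suc n)) (indicator U) x) \<longlonglongrightarrow> ennreal (exp (- 1 * s)) * 1"
      by (intro tendsto_mult_ennreal tr) auto
    then show ?thesis
      using True by simp
  qed (use that in simp)
  have "1 = laplace 1 (\<lambda>_. 1)"
    by (simp add: laplace_const)
  also have "\<dots> = (\<integral>\<^sup>+s. liminf (\<lambda>n. ennreal (exp (- ?b n * s)) * \<P> (s / real (Suc n)) (indicator U) x * indicator {0..} s) \<partial>lborel)"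
    unfolding laplace_def
  proof (rule nn_integral_cong_AE)
    have "AE s in lborel. s \<noteq> (0::real)"
      by (rule AE_lborel_singleton)
    then show "AE s in lborel. ennreal (exp (- 1 * s)) * 1 * indicator {0..} s =
        liminf (\<lambda>n. ennreal (exp (- ?b n * s)) * \<P> (s / real (Suc n)) (indicator U) x * indicator {0..} s)"
    proof eventually_elim
      case (elim s)
      show ?case
        using lim_imp_Liminf[OF sequentially_bot lim[OF elim]] by simp
    qed
  qed
  also have "\<dots> \<le> liminf (\<lambda>n. laplace (?b n) (\<lambda>s. \<P> (s / real (Suc n)) (indicator U) x))"
    unfolding laplace_def by (intro nn_integral_liminf) measurable
  finally show ?thesis
    unfolding eq .
qed

section \<open>Hitting probabilities\<close>

text \<open>The lower time bound \<open>s\<close> is a parameter because applying the semigroup at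
  time \<open>s\<close> to the hitting probability gives the probability of a visit from time
  \<open>s\<close> on (\<open>transition_hitting\<close>).\<close>

definition hitting :: "'a set \<Rightarrow> real \<Rightarrow> 'a \<Rightarrow> ennreal" where
  "hitting U s x = emeasure (P (Some x)) {\<omega> \<in> space M. \<exists>t\<ge>s. X (ennreal t) \<omega> \<in> Some ` U}"

text \<open>Backward recursion for the probability of visiting \<open>U\<close> at one of the times
  \<open>0, \<delta>, ..., N * \<delta>\<close>. In this form measurability and domination by
  supermedian functions are plain inductions on \<open>N\<close>.\<close>

primrec grid_hitting :: "'a set \<Rightarrow> real \<Rightarrow> nat \<Rightarrow> 'a \<Rightarrow> ennreal" where
  "grid_hitting U \<delta> 0 = indicator U"
| "grid_hitting U \<delta> (Suc N) = (\<lambda>x. indicator U x + indicator (- U) x * \<P> \<delta> (grid_hitting U \<delta> N) x)"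

lemma borel_measurable_grid_hitting [measurable]:
  assumes [measurable]: "U \<in> sets borel"
  shows "grid_hitting U \<delta> N \<in> borel_measurable borel"
  by (induction N) auto

lemma sets_grid_event:
  assumes "U \<in> sets borel" "\<Lambda> \<in> sets M"
  shows "{\<omega> \<in> \<Lambda>. \<exists>i\<le>N::nat. X (t i) \<omega> \<in> Some ` U} \<in> sets M"
proof -
  have "{\<omega> \<in> \<Lambda>. \<exists>i\<le>N. X (t i) \<omega> \<in> Some ` U} = \<Lambda> \<inter> (\<Union>i\<in>{..N}. {\<omega> \<in> space M. X (t i) \<omega> \<in> Some ` U})"
    using sets.sets_into_space[OF assms(2)] by auto
  then show ?thesis
    using assms by (auto intro!: sets.finite_UN sets_X_in)
qed

text \<open>The time \<open>s\<close> and the past event \<open>\<Lambda>\<close> are general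
  because the induction hypothesis is applied at \<open>s + \<delta>\<close> to the part of
  \<open>\<Lambda>\<close> on which \<open>U\<close> is not met at time \<open>s\<close>; the Markov
  property joins the two times.\<close>

lemma grid_hitting_event:
  assumes U: "U \<in> sets borel" and \<delta>: "0 \<le> \<delta>"
  shows "0 \<le> s \<Longrightarrow> \<Lambda> \<in> sets (F (ennreal s)) \<Longrightarrow>
    (\<integral>\<^sup>+\<omega>. indicator \<Lambda> \<omega> * case_option 0 (grid_hitting U \<delta> N) (X (ennreal s) \<omega>) \<partial>P z) =
    emeasure (P z) {\<omega> \<in> \<Lambda>. \<exists>i\<le>N. X (ennreal (s + real i * \<delta>)) \<omega> \<in> Some ` U}"
proof (induction N arbitrary: s \<Lambda>)
  case 0
  have "{\<omega> \<in> \<Lambda>. X (ennreal s) \<omega> \<in> Some ` U} \<in> sets (P z)"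
    using events_filtration[OF filtration_X_in(1)[OF 0(2) U]] by simp
  moreover have "indicator \<Lambda> \<omega> * indicator (Some ` U) (X (ennreal s) \<omega>)
      = (indicator {\<omega> \<in> \<Lambda>. X (ennreal s) \<omega> \<in> Some ` U} \<omega> :: ennreal)" for \<omega>
    by (auto simp: indicator_def)
  ultimately show ?case
    unfolding grid_hitting.simps case_option_indicator by simp
next
  case (Suc N)
  note \<Lambda> = Suc.prems(2)
  define \<Lambda>\<^sub>1 where "\<Lambda>\<^sub>1 = {\<omega> \<in> \<Lambda>. X (ennreal s) \<omega> \<in> Some ` U}"
  define \<Lambda>\<^sub>2 where "\<Lambda>\<^sub>2 = {\<omega> \<in> \<Lambda>. X (ennreal s) \<omega> \<notin> Some ` U}"
  have sets1: "\<Lambda>\<^sub>1 \<in> sets M" and sets2: "\<Lambda>\<^sub>2 \<in> sets (F (ennreal s))"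
    unfolding \<Lambda>\<^sub>1_def \<Lambda>\<^sub>2_def
    by (rule events_filtration[OF filtration_X_in(1)[OF \<Lambda> U]], rule filtration_X_in(2)[OF \<Lambda> U])
  then have sets2': "\<Lambda>\<^sub>2 \<in> sets (F (ennreal (s + \<delta>)))" "\<Lambda>\<^sub>2 \<in> sets M"
    using sets_F_mono[of "ennreal s" "ennreal (s + \<delta>)"] \<delta> events_filtration[OF sets2] by (auto simp: ennreal_leI)
  let ?B = "{\<omega> \<in> \<Lambda>\<^sub>2. \<exists>i\<le>N. X (ennreal (s + \<delta> + real i * \<delta>)) \<omega> \<in> Some ` U}"
  have "(\<integral>\<^sup>+\<omega>. indicator \<Lambda> \<omega> * case_option 0 (grid_hitting U \<delta> (Suc N)) (X (ennreal s) \<omega>) \<partial>P z)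
     = (\<integral>\<^sup>+\<omega>. indicator \<Lambda>\<^sub>1 \<omega> + indicator \<Lambda>\<^sub>2 \<omega> * case_option 0 (\<P> \<delta> (grid_hitting U \<delta> N)) (X (ennreal s) \<omega>) \<partial>P z)"
    by (intro nn_integral_cong) (auto simp: \<Lambda>\<^sub>1_def \<Lambda>\<^sub>2_def split: option.split split_indicator)
  also have "\<dots> = emeasure (P z) \<Lambda>\<^sub>1 + (\<integral>\<^sup>+\<omega>. indicator \<Lambda>\<^sub>2 \<omega> * case_option 0 (\<P> \<delta> (grid_hitting U \<delta> N)) (X (ennreal s) \<omega>) \<partial>P z)"
  proof (subst nn_integral_add)
    show "indicator \<Lambda>\<^sub>1 \<in> borel_measurable (P z)"
      using sets1 by simp
    have [measurable]: "(indicator \<Lambda>\<^sub>2 :: 'w \<Rightarrow> ennreal) \<in> borel_measurable M"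
      using sets2'(2) by simp
    show "(\<lambda>\<omega>. indicator \<Lambda>\<^sub>2 \<omega> * case_option 0 (\<P> \<delta> (grid_hitting U \<delta> N)) (X (ennreal s) \<omega>)) \<in> borel_measurable (P z)"
      using U by measurable
  qed (simp add: sets1)
  also have "(\<integral>\<^sup>+\<omega>. indicator \<Lambda>\<^sub>2 \<omega> * case_option 0 (\<P> \<delta> (grid_hitting U \<delta> N)) (X (ennreal s) \<omega>) \<partial>P z)
     = (\<integral>\<^sup>+\<omega>. indicator \<Lambda>\<^sub>2 \<omega> * case_option 0 (grid_hitting U \<delta> N) (X (ennreal (s + \<delta>)) \<omega>) \<partial>P z)"
    using markov_property[OF borel_measurable_grid_hitting[OF U] sets2] Suc.prems(1) \<delta> by simp
  also have "\<dots> = emeasure (P z) ?B"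
    using Suc.IH[OF _ sets2'(1)] Suc.prems(1) \<delta> by simp
  also have "emeasure (P z) \<Lambda>\<^sub>1 + emeasure (P z) ?B = emeasure (P z) (\<Lambda>\<^sub>1 \<union> ?B)"
    using sets1 sets_grid_event[OF U sets2'(2)] by (intro plus_emeasure) (auto simp: \<Lambda>\<^sub>1_def \<Lambda>\<^sub>2_def)
  also have "\<Lambda>\<^sub>1 \<union> ?B = {\<omega> \<in> \<Lambda>. \<exists>i\<le>Suc N. X (ennreal (s + real i * \<delta>)) \<omega> \<in> Some ` U}"
  proof -
    have eq: "(\<exists>i\<le>Suc N. X (ennreal (s + real i * \<delta>)) \<omega> \<in> Some ` U) \<longleftrightarrow>
        X (ennreal s) \<omega> \<in> Some ` U \<or> (\<exists>i\<le>N. X (ennreal (s + \<delta> + real i * \<delta>)) \<omega> \<in> Some ` U)" for \<omega>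
    proof -
      have "(\<exists>i\<le>Suc N. Q i) \<longleftrightarrow> Q 0 \<or> (\<exists>i\<le>N. Q (Suc i))" for Q :: "nat \<Rightarrow> bool"
        unfolding less_Suc_eq_le[symmetric] by (rule Ex_less_Suc2)
      then show ?thesis
        by (simp add: distrib_right add.assoc)
    qed
    show ?thesis
      unfolding \<Lambda>\<^sub>1_def \<Lambda>\<^sub>2_def 
    proof (intro set_eqI)
      fix \<omega>
      show "\<omega> \<in> {\<omega> \<in> \<Lambda>. X (ennreal s) \<omega> \<in> Some ` U} \<union>
          {\<omega> \<in> {\<omega> \<in> \<Lambda>. X (ennreal s) \<omega> \<notin> Some ` U}. \<exists>i\<le>N. X (ennreal (s + \<delta> + real i * \<delta>)) \<omega> \<in> Some ` U} \<longleftrightarrow>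
        \<omega> \<in> {\<omega> \<in> \<Lambda>. \<exists>i\<le>Suc N. X (ennreal (s + real i * \<delta>)) \<omega> \<in> Some ` U}"
        unfolding Un_iff mem_Collect_eq eq
        by (cases "X (ennreal s) \<omega> \<in> Some ` U") simp_all
    qed
  qed
  finally show ?case .
qed

text \<open>By right continuity a visit to an open set persists for a short time, and some dyadic
  time of fine enough mesh falls into that interval.\<close>

lemma hitting_iff_grid:
  assumes \<omega>: "\<omega> \<in> space M" and U: "open U" and s: "0 \<le> s"
  shows "(\<exists>t\<ge>s. X (ennreal t) \<omega> \<in> Some ` U) \<longleftrightarrow>
    (\<exists>k::nat. \<exists>i\<le>4 ^ k. X (ennreal (s + real i * (1 / 2 ^ k))) \<omega> \<in> Some ` U)"
proof
  assume "\<exists>t\<ge>s. X (ennreal t) \<omega> \<in> Some ` U"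
  then obtain t where t: "s \<le> t" "X (ennreal t) \<omega> \<in> Some ` U"
    by auto
  with s have "\<forall>\<^sub>F s in at_right t. X (ennreal s) \<omega> \<in> Some ` U"
    by (intro eventually_X_right_open[OF \<omega> _ U]) auto
  then obtain b where b: "t < b" "\<And>y. t < y \<Longrightarrow> y < b \<Longrightarrow> X (ennreal y) \<omega> \<in> Some ` U"
    unfolding eventually_at_right_field by auto
  \<comment> \<open>One bound makes the mesh smaller than \<open>b - t\<close>. The other makes the
    horizon \<open>4 ^ k * (1 / 2 ^ k) = 2 ^ k\<close> reach beyond \<open>t - s\<close>, with one
    unit to spare for rounding up.\<close>
  obtain k where k: "max (1 / (b - t)) (t - s + 1) < 2 ^ k"
    using real_arch_pow[of 2 "max (1 / (b - t)) (t - s + 1)"] by auto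
  \<comment> \<open>The first grid index strictly beyond \<open>t\<close>.\<close>
  define i where "i = nat (\<lfloor>(t - s) * 2 ^ k\<rfloor> + 1)"
  have "0 \<le> (t - s) * 2 ^ k"
    using t by simp
  then have i: "(t - s) * 2 ^ k < real i" "real i \<le> (t - s) * 2 ^ k + 1"
    unfolding i_def by linarith+
  have "(t - s) * 2 ^ k + 1 \<le> (t - s + 1) * 2 ^ k"
    by (simp add: distrib_right)
  also have "\<dots> \<le> 2 ^ k * 2 ^ k"
    using k by (intro mult_right_mono) auto
  also have "\<dots> = real (4 ^ k)"
    by (simp add: power_mult_distrib[symmetric])
  finally have "i \<le> 4 ^ k"
    using i(2) by linarith
  moreover have "t < s + real i * (1 / 2 ^ k)"
    using i(1) by (simp add: field_simps)
  moreover have "s + real i * (1 / 2 ^ k) < b"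
  proof -
    have "real i * (1 / 2 ^ k) \<le> t - s + 1 / 2 ^ k"
      using i(2) by (simp add: field_simps)
    moreover have "1 / 2 ^ k < b - t"
      using k b(1) by (simp add: field_simps)
    ultimately show ?thesis
      by linarith
  qed
  ultimately show "\<exists>k::nat. \<exists>i\<le>4 ^ k. X (ennreal (s + real i * (1 / 2 ^ k))) \<omega> \<in> Some ` U"
    by (intro exI[of _ k] exI[of _ i] conjI b(2))
next
  assume "\<exists>k::nat. \<exists>i\<le>4 ^ k. X (ennreal (s + real i * (1 / 2 ^ k))) \<omega> \<in> Some ` U"
  then obtain k i :: nat where "X (ennreal (s + real i * (1 / 2 ^ k))) \<omega> \<in> Some ` U"
    by metis
  then show "\<exists>t\<ge>s. X (ennreal t) \<omega> \<in> Some ` U"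
    by (intro exI[of _ "s + real i * (1 / 2 ^ k)"]) auto
qed

abbreviation dyadic_event :: "'a set \<Rightarrow> real \<Rightarrow> nat \<Rightarrow> 'w set" where
  "dyadic_event U s k \<equiv> {\<omega> \<in> space M. \<exists>i\<le>4 ^ k. X (ennreal (s + real i * (1 / 2 ^ k))) \<omega> \<in> Some ` U}"

lemma incseq_dyadic_event: "incseq (dyadic_event U s)"
proof (rule incseq_SucI)
  fix k
  show "dyadic_event U s k \<subseteq> dyadic_event U s (Suc k)"
  proof safe
    fix \<omega> i x assume i: "i \<le> 4 ^ k" "X (ennreal (s + real i * (1 / 2 ^ k))) \<omega> = Some x" "x \<in> U"
    have "s + real i * (1 / 2 ^ k) = s + real (2 * i) * (1 / 2 ^ Suc k)"
      by simp
    then show "\<exists>i\<le>4 ^ Suc k. X (ennreal (s + real i * (1 / 2 ^ Suc k))) \<omega> \<in> Some ` U"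
      using i by (intro exI[of _ "2 * i"]) auto
  qed
qed

lemma hitting_event_eq:
  assumes "open U" "0 \<le> s"
  shows "{\<omega> \<in> space M. \<exists>t\<ge>s. X (ennreal t) \<omega> \<in> Some ` U} = (\<Union>k. dyadic_event U s k)"
  by (intro set_eqI) (simp add: hitting_iff_grid[OF _ assms] cong: conj_cong)

lemma sets_hitting_event:
  assumes "open U" "0 \<le> s"
  shows "{\<omega> \<in> space M. \<exists>t\<ge>s. X (ennreal t) \<omega> \<in> Some ` U} \<in> sets M"
  unfolding hitting_event_eq[OF assms] using assms(1)
  by (intro sets.countable_UN image_subsetI sets_grid_event) simp_all

lemma emeasure_dyadic_event:
  assumes U: "open U" and s: "0 \<le> s"
  shows "emeasure (P (Some x)) (dyadic_event U s k) =
    \<P> s (grid_hitting U (1 / 2 ^ k) (4 ^ k)) x"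
proof -
  have "space M \<in> sets (F (ennreal s))"
    using sets.top[of "F (ennreal s)"] by (simp add: space_F)
  then have "emeasure (P (Some x)) (dyadic_event U s k) =
     (\<integral>\<^sup>+\<omega>. indicator (space M) \<omega> * case_option 0 (grid_hitting U (1 / 2 ^ k) (4 ^ k)) (X (ennreal s) \<omega>) \<partial>P (Some x))"
    using U s by (intro grid_hitting_event[symmetric]) auto
  also have "\<dots> = \<P> s (grid_hitting U (1 / 2 ^ k) (4 ^ k)) x"
    unfolding transition_def by (intro nn_integral_cong) simp
  finally show ?thesis .
qed

lemma hitting_eq_SUP:
  assumes U: "open U" and s: "0 \<le> s"
  shows "hitting U s x = (SUP k. \<P> s (grid_hitting U (1 / 2 ^ k) (4 ^ k)) x)"
proof -
  have "(SUP k. emeasure (P (Some x)) (dyadic_event U s k)) = emeasure (P (Some x)) (\<Union>k. dyadic_event U s k)"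
    using U by (intro SUP_emeasure_incseq incseq_dyadic_event image_subsetI) (simp add: sets_grid_event)
  then show ?thesis
    unfolding hitting_def hitting_event_eq[OF assms] emeasure_dyadic_event[OF assms] by simp
qed

lemma hitting_0_eq_SUP:
  assumes U: "open U"
  shows "hitting U 0 x = (SUP k. grid_hitting U (1 / 2 ^ k) (4 ^ k) x)"
  using hitting_eq_SUP[OF U order_refl, of x] U by (simp add: transition_0)

lemma borel_measurable_hitting:
  assumes "open U"
  shows "hitting U 0 \<in> borel_measurable borel"
proof -
  have "hitting U 0 = (\<lambda>x. SUP k. grid_hitting U (1 / 2 ^ k) (4 ^ k) x)"
    using hitting_0_eq_SUP[OF assms] by auto
  then show ?thesis
    using assms by simp
qed

lemma transition_hitting:
  assumes U: "open U" and s: "0 \<le> s"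
  shows "\<P> s (hitting U 0) x = hitting U s x"
proof -
  have eq: "grid_hitting U (1 / 2 ^ k) (4 ^ k) x = emeasure (P (Some x)) (dyadic_event U 0 k)" for k x
    using emeasure_dyadic_event[OF U order_refl, of x k] U by (simp add: transition_0)
  have inc: "incseq (\<lambda>k. grid_hitting U (1 / 2 ^ k) (4 ^ k))"
    unfolding incseq_def le_fun_def eq
    by (intro allI impI emeasure_mono incseqD[OF incseq_dyadic_event]) (use U in \<open>simp_all add: sets_grid_event\<close>)
  have "hitting U 0 = (\<lambda>x. SUP k. grid_hitting U (1 / 2 ^ k) (4 ^ k) x)"
    using hitting_0_eq_SUP[OF U] by (intro ext)
  then have "\<P> s (hitting U 0) x =
      \<P> s (\<lambda>x. SUP k. grid_hitting U (1 / 2 ^ k) (4 ^ k) x) x"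
    by (simp only:)
  also have "\<dots> = (SUP k. \<P> s (grid_hitting U (1 / 2 ^ k) (4 ^ k)) x)"
    by (rule transition_SUP[OF _ inc]) (use U in simp)
  also have "\<dots> = hitting U s x"
    by (rule hitting_eq_SUP[OF U s, symmetric])
  finally show ?thesis .
qed

text \<open>On \<open>U\<close> the function \<open>e\<close> is at least \<open>1\<close>; off
  \<open>U\<close> one grid step is absorbed by \<open>\<P> \<delta> e \<le> e\<close>. Since
  \<open>e\<close> may be any measurable supermedian function, a lower limit of such functions is
  admissible.\<close>

lemma hitting_le_supermedian:
  assumes U: "open U" and e: "e \<in> borel_measurable borel" "\<And>x. x \<in> U \<Longrightarrow> 1 \<le> e x"
    "\<And>t x. 0 \<le> t \<Longrightarrow> \<P> t e x \<le> e x"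
  shows "hitting U 0 x \<le> e x"
proof -
  have "grid_hitting U \<delta> N x \<le> e x" if "0 \<le> \<delta>" for \<delta> N x
  proof (induction N arbitrary: x)
    case 0
    then show ?case using e(2) by (auto simp: indicator_def)
  next
    case (Suc N)
    have "\<P> \<delta> (grid_hitting U \<delta> N) x \<le> e x"
      by (rule order_trans[OF transition_mono[OF Suc] e(3)[OF that]])
    then show ?case
      using e(2)[of x] by (cases "x \<in> U") auto
  qed
  then show ?thesis
    unfolding hitting_0_eq_SUP[OF U] by (intro SUP_least) auto
qed

lemma hitting_ge_indicator:
  assumes "open U"
  shows "indicator U x \<le> hitting U 0 x"
proof -
  have "indicator U x \<le> grid_hitting U (1 / 2 ^ 0) (4 ^ 0) x"
    unfolding power_0 One_nat_def by simp
  also have "\<dots> \<le> hitting U 0 x"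
    unfolding hitting_0_eq_SUP[OF assms] by (rule SUP_upper) simp
  finally show ?thesis .
qed

lemma hitting_le_1: "hitting U s x \<le> 1"
  unfolding hitting_def by (rule emeasure_P_le_1)

lemma hitting_antimono:
  assumes "open U" "0 \<le> s" "s \<le> t"
  shows "hitting U t x \<le> hitting U s x"
  unfolding hitting_def
proof (rule emeasure_mono)
  show "{\<omega> \<in> space M. \<exists>r\<ge>t. X (ennreal r) \<omega> \<in> Some ` U} \<subseteq> {\<omega> \<in> space M. \<exists>r\<ge>s. X (ennreal r) \<omega> \<in> Some ` U}"
    using assms(3) by (intro Collect_mono) (metis order_trans)
qed (simp add: sets_hitting_event[OF assms(1,2)])

section \<open>Visits during a short initial time interval\<close>

abbreviation early_event :: "'a set \<Rightarrow> real \<Rightarrow> 'w set" where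
  "early_event V s \<equiv> {\<omega> \<in> space M. \<exists>t. 0 \<le> t \<and> t < s \<and> X (ennreal t) \<omega> \<in> Some ` V}"

lemma sets_early_event:
  assumes V: "open V"
  shows "early_event V s \<in> sets M"
proof -
  have "early_event V s = (\<Union>q\<in>{q\<in>\<rat>. 0 \<le> q \<and> q < s}. {\<omega> \<in> space M. X (ennreal q) \<omega> \<in> Some ` V})"
  proof (intro equalityI subsetI)
    fix \<omega> assume "\<omega> \<in> early_event V s"
    then obtain t where \<omega>: "\<omega> \<in> space M" and t: "0 \<le> t" "t < s" "X (ennreal t) \<omega> \<in> Some ` V"
      by auto
    have "\<forall>\<^sub>F s in at_right t. X (ennreal s) \<omega> \<in> Some ` V"
      using eventually_X_right_open[OF \<omega> t(1) V t(3)] .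
    then obtain b where b: "t < b" "\<And>y. t < y \<Longrightarrow> y < b \<Longrightarrow> X (ennreal y) \<omega> \<in> Some ` V"
      unfolding eventually_at_right_field by auto
    obtain q where "q \<in> \<rat>" "t < q" "q < min b s"
      using Rats_dense_in_real[of t "min b s"] b(1) t(2) by auto
    then show "\<omega> \<in> (\<Union>q\<in>{q\<in>\<rat>. 0 \<le> q \<and> q < s}. {\<omega> \<in> space M. X (ennreal q) \<omega> \<in> Some ` V})"
      using b(2)[of q] \<omega> t(1) by (intro UN_I[of q] CollectI conjI) simp_all
  qed auto
  also have "\<dots> \<in> sets M"
    using V by (intro sets.countable_UN' sets_X_in) (auto intro: countable_subset[OF _ countable_rat])
  finally show ?thesis .
qed

text \<open>A visit happens before time \<open>s\<close> or from time \<open>s\<close> on. The early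
  part is estimated with a larger set \<open>V\<close>, so that one bound serves a whole sequence of
  sets \<open>U\<close>.\<close>

lemma hitting_split:
  assumes U: "open U" "U \<subseteq> V" and V: "open V" and s: "0 \<le> s"
  shows "hitting U 0 x \<le> emeasure (P (Some x)) (early_event V s) + hitting U s x"
proof -
  let ?H = "{\<omega> \<in> space M. \<exists>t\<ge>s. X (ennreal t) \<omega> \<in> Some ` U}"
  have "hitting U 0 x \<le> emeasure (P (Some x)) (early_event V s \<union> ?H)"
    unfolding hitting_def
  proof (rule emeasure_mono, rule subsetI)
    fix \<omega> assume "\<omega> \<in> {\<omega> \<in> space M. \<exists>t\<ge>0. X (ennreal t) \<omega> \<in> Some ` U}"
    then obtain t where t: "\<omega> \<in> space M" "0 \<le> t" "X (ennreal t) \<omega> \<in> Some ` U"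
      by auto
    show "\<omega> \<in> early_event V s \<union> ?H"
    proof (cases "t < s")
      case True
      have "X (ennreal t) \<omega> \<in> Some ` V"
        using t(3) image_mono[OF U(2)] by (rule subsetD[rotated])
      then have "\<omega> \<in> early_event V s"
        using t True by (intro CollectI conjI exI[of _ t])
      then show ?thesis ..
    next
      case False
      then have "\<omega> \<in> ?H"
        using t by (intro CollectI conjI exI[of _ t]) simp_all
      then show ?thesis ..
    qed
  qed (use sets_early_event[OF V] sets_hitting_event[OF U(1) s] in simp)
  also have "\<dots> \<le> emeasure (P (Some x)) (early_event V s) + hitting U s x"
    unfolding hitting_def using sets_early_event[OF V] sets_hitting_event[OF U(1) s]
    by (intro emeasure_subadditive) auto
  finally show ?thesis .
qed

text \<open>A path starting in the open complement of \<open>closure V\<close> stays there for a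
  positive time, so almost surely it is not in all the decreasing events.\<close>

lemma early_event_tendsto:
  assumes V: "open V" and x: "x \<notin> closure V"
  shows "(\<lambda>n. emeasure (P (Some x)) (early_event V (1 / real (Suc n)))) \<longlonglongrightarrow> 0"
proof -
  have "(\<lambda>n. emeasure (P (Some x)) (early_event V (1 / real (Suc n))))
      \<longlonglongrightarrow> emeasure (P (Some x)) (\<Inter>n. early_event V (1 / real (Suc n)))"
  proof (rule Lim_emeasure_decseq)
    show "range (\<lambda>n. early_event V (1 / real (Suc n))) \<subseteq> sets (P (Some x))"
      using sets_early_event[OF V] by auto
    show "decseq (\<lambda>n. early_event V (1 / real (Suc n)))"
    proof (rule decseq_SucI)
      fix n
      have "1 / real (Suc (Suc n)) \<le> 1 / real (Suc n)"
        by (intro divide_left_mono) auto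
      moreover have "early_event V a \<subseteq> early_event V b" if "a \<le> b" for a b
        using that by (intro Collect_mono) (metis less_le_trans)
      ultimately show "early_event V (1 / real (Suc (Suc n))) \<subseteq> early_event V (1 / real (Suc n))"
        by blast
    qed
    show "emeasure (P (Some x)) (early_event V (1 / real (Suc n))) \<noteq> \<infinity>" for n
      by (simp add: finite_measure.emeasure_finite[OF prob_space.finite_measure[OF prob_space_P]])
  qed
  also have "emeasure (P (Some x)) (\<Inter>n. early_event V (1 / real (Suc n))) = emeasure (P (Some x)) {}"
  proof (rule emeasure_eq_AE)
    show "AE \<omega> in P (Some x). \<omega> \<in> (\<Inter>n. early_event V (1 / real (Suc n))) \<longleftrightarrow> \<omega> \<in> {}"
      using normal[of "Some x"] AE_space
    proof eventually_elim
      case (elim \<omega>)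
      then have \<omega>: "\<omega> \<in> space M" "X (ennreal 0) \<omega> \<in> Some ` (- closure V)"
        using x by auto
      from eventually_X_right_open[OF \<omega>(1) order_refl _ \<omega>(2)]
      obtain b where b: "0 < b" "\<And>y. 0 < y \<Longrightarrow> y < b \<Longrightarrow> X (ennreal y) \<omega> \<in> Some ` (- closure V)"
        unfolding eventually_at_right_field by auto
      have out: "X (ennreal y) \<omega> \<notin> Some ` V" if "0 \<le> y" "y < b" for y
      proof
        assume V: "X (ennreal y) \<omega> \<in> Some ` V"
        have "X (ennreal y) \<omega> \<in> Some ` (- closure V)"
          using b(2)[of y] \<omega>(2) that by (cases "y = 0") simp_all
        then show False
          using V closure_subset[of V] by auto
      qed
      obtain n where "1 / real (Suc n) < b"
        by (rule nat_approx_posE[OF b(1)])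
      then have "\<omega> \<notin> early_event V (1 / real (Suc n))"
        using out by (simp del: of_nat_Suc)
      then show ?case
        by (simp only: INT_iff empty_iff) blast
    qed
    show "(\<Inter>n. early_event V (1 / real (Suc n))) \<in> sets (P (Some x))"
      using sets_early_event[OF V] by auto
  qed auto
  finally show ?thesis
    by simp
qed

end

section \<open>The penalized equation and the energy of hitting probabilities\<close>

lemma ennreal_mult_liminf_le: "(c :: ennreal) * liminf a \<le> liminf (\<lambda>k. c * a k)"
  unfolding liminf_SUP_INF SUP_mult_left_ennreal
  by (intro SUP_mono' INF_greatest mult_left_mono INF_lower) auto

lemma L2_mult_integrable:
  assumes "f \<in> L2 m" "g \<in> L2 m"
  shows "integrable m (\<lambda>x. f x * g x)"
proof (rule Bochner_Integration.integrable_bound)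
  show "integrable m (\<lambda>x. (f x)\<^sup>2 + (g x)\<^sup>2)"
    using assms by (auto simp: L2_def)
  show "(\<lambda>x. f x * g x) \<in> borel_measurable m"
    using assms by (auto simp: L2_def)
  have "\<bar>f x * g x\<bar> \<le> (f x)\<^sup>2 + (g x)\<^sup>2" for x
  proof -
    have "2 * \<bar>f x\<bar> * \<bar>g x\<bar> \<le> \<bar>f x\<bar>\<^sup>2 + \<bar>g x\<bar>\<^sup>2"
      by (rule sum_squares_bound)
    moreover have "0 \<le> \<bar>f x\<bar> * \<bar>g x\<bar>"
      by simp
    ultimately show ?thesis
      unfolding abs_mult power2_abs by linarith
  qed
  then show "AE x in m. norm (f x * g x) \<le> norm ((f x)\<^sup>2 + (g x)\<^sup>2)"
    by auto
qed

locale hunt_dirichlet = hunt_process_lc M F P X + dirichlet_form m D \<E>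
  for M :: "'w measure" and F :: "ennreal \<Rightarrow> 'w measure"
    and P :: "'a::{metric_space, second_countable_topology} option \<Rightarrow> 'w measure"
    and X :: "ennreal \<Rightarrow> 'w \<Rightarrow> 'a option"
    and m :: "'a measure" and D :: "('a \<Rightarrow> real) set"
    and \<E> :: "('a \<Rightarrow> real) \<Rightarrow> ('a \<Rightarrow> real) \<Rightarrow> real" +
  fixes r :: "real \<Rightarrow> 'a \<Rightarrow> 'a \<Rightarrow> ennreal"
  assumes radon: "radon_measure m"
    and transient: "transient_form m D \<E>"
    and associated: "associated_process m D \<E> P X"
    and kernel: "resolvent_kernel m P X r"
begin

lemma sets_m [simp, measurable_cong]: "sets m = sets borel"
  using radon by (simp add: radon_measure_def)

lemma space_m [simp]: "space m = UNIV"
  using sets_eq_imp_space_eq[OF sets_m] by simp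

lemma sigma_finite_m: "sigma_finite_measure m"
proof
  obtain W :: "nat \<Rightarrow> 'a set" where W: "range W \<subseteq> relatively_compact_open" "(\<Union>n. W n) = UNIV"
    using relatively_compact_open_exhaustion by metis
  have "emeasure m (W n) \<noteq> \<infinity>" for n
  proof -
    have "W n \<in> relatively_compact_open"
      using W(1) by auto
    then obtain C where C: "compact C" "W n \<subseteq> C"
      by (auto simp: relatively_compact_open_def)
    then have "emeasure m (W n) \<le> emeasure m C"
      by (intro emeasure_mono) (auto simp: compact_imp_closed)
    also have "\<dots> < \<infinity>"
      using radon C by (simp add: radon_measure_def)
    finally show ?thesis by simp
  qed
  moreover have "range W \<subseteq> sets m"
    using W(1) by (auto simp: relatively_compact_open_def)
  ultimately show "\<exists>A. countable A \<and> A \<subseteq> sets m \<and> \<Union>A = space m \<and> (\<forall>a\<in>A. emeasure m a \<noteq> \<infinity>)"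
    using W(2) by (intro exI[of _ "range W"]) auto
qed

section \<open>Consequences of the symmetric kernel\<close>

lemma resolvent_kernelD:
  assumes "0 \<le> \<alpha>"
  shows "(\<lambda>(x, y). r \<alpha> x y) \<in> borel_measurable borel \<and>
    (\<forall>x y. r \<alpha> x y = r \<alpha> y x) \<and>
    (\<forall>y. excessive P X \<alpha> (\<lambda>x. r \<alpha> x y)) \<and>
    (\<forall>x. excessive P X \<alpha> (\<lambda>y. r \<alpha> x y)) \<and>
    (\<forall>h\<in>borel_measurable borel. \<forall>x. \<R> \<alpha> h x = (\<integral>\<^sup>+y. h y * r \<alpha> x y \<partial>m))"
  by (rule spec[OF kernel[unfolded resolvent_kernel_def], THEN mp, OF assms])

lemma borel_measurable_kernel:
  assumes "0 \<le> \<alpha>"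
  shows "(\<lambda>p. r \<alpha> (fst p) (snd p)) \<in> borel_measurable (borel \<Otimes>\<^sub>M borel)"
  using resolvent_kernelD[OF assms, THEN conjunct1] unfolding borel_prod case_prod_beta' .

lemma borel_measurable_kernel_section [measurable]:
  assumes "0 \<le> \<alpha>"
  shows "r \<alpha> x \<in> borel_measurable borel"
  using measurable_compose[of "\<lambda>y. (x, y)" borel "borel \<Otimes>\<^sub>M borel", OF _ borel_measurable_kernel[OF assms]] by simp

lemma kernel_sym: "0 \<le> \<alpha> \<Longrightarrow> r \<alpha> x y = r \<alpha> y x"
  by (rule resolvent_kernelD[THEN conjunct2, THEN conjunct1, THEN spec, THEN spec])

lemma excessive_kernel: "0 \<le> \<alpha> \<Longrightarrow> excessive P X \<alpha> (r \<alpha> x)"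
  by (rule resolvent_kernelD[THEN conjunct2, THEN conjunct2, THEN conjunct2, THEN conjunct1, THEN spec])

lemma resolvent_eq_kernel:
  "0 \<le> \<alpha> \<Longrightarrow> h \<in> borel_measurable borel \<Longrightarrow> \<R> \<alpha> h x = (\<integral>\<^sup>+y. h y * r \<alpha> x y \<partial>m)"
  by (rule resolvent_kernelD[THEN conjunct2, THEN conjunct2, THEN conjunct2, THEN conjunct2, THEN bspec, THEN spec])

text \<open>The duality behind the whole argument: by symmetry of the kernel, integrating the
  potential of a function against \<open>\<nu>\<close> equals integrating the function against the
  potential of \<open>\<nu>\<close>.\<close>

lemma Fubini_kernel:
  assumes \<alpha>: "0 \<le> \<alpha>" and \<nu>: "sets \<nu> = sets borel" "sigma_finite_measure \<nu>"
    and [measurable]: "h \<in> borel_measurable borel"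
  shows "(\<integral>\<^sup>+x. \<R> \<alpha> h x \<partial>\<nu>) = (\<integral>\<^sup>+y. h y * (\<integral>\<^sup>+x. r \<alpha> y x \<partial>\<nu>) \<partial>m)"
proof -
  interpret m: sigma_finite_measure m by (rule sigma_finite_m)
  interpret \<nu>: sigma_finite_measure \<nu> by (rule \<nu>(2))
  interpret pair_sigma_finite m \<nu> ..
  note [measurable_cong] = \<nu>(1)
  have [measurable]: "(\<lambda>p. r \<alpha> (fst p) (snd p)) \<in> borel_measurable (borel \<Otimes>\<^sub>M borel)"
    by (rule borel_measurable_kernel[OF \<alpha>])
  have "(\<integral>\<^sup>+x. \<R> \<alpha> h x \<partial>\<nu>) = (\<integral>\<^sup>+x. \<integral>\<^sup>+y. h y * r \<alpha> y x \<partial>m \<partial>\<nu>)"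
    by (intro nn_integral_cong) (simp add: resolvent_eq_kernel[OF \<alpha>] kernel_sym[OF \<alpha>])
  also have "\<dots> = (\<integral>\<^sup>+y. \<integral>\<^sup>+x. h y * r \<alpha> y x \<partial>\<nu> \<partial>m)"
    by (rule Fubini') (unfold case_prod_beta', measurable)
  also have "\<dots> = (\<integral>\<^sup>+y. h y * (\<integral>\<^sup>+x. r \<alpha> y x \<partial>\<nu>) \<partial>m)"
    using \<alpha> by (intro nn_integral_cong nn_integral_cmult) measurable
  finally show ?thesis .
qed

text \<open>By symmetry the integral bound is dual to the bound of the resolvent of the constant
  \<open>1\<close> by \<open>1 / \<alpha>\<close>.\<close>

lemma integral_resolvent_le:
  assumes \<alpha>: "0 < \<alpha>" and h[measurable]: "h \<in> borel_measurable borel"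
  shows "(\<integral>\<^sup>+x. \<R> \<alpha> h x \<partial>m) \<le> ennreal (1 / \<alpha>) * (\<integral>\<^sup>+x. h x \<partial>m)"
proof -
  have "(\<integral>\<^sup>+x. r \<alpha> y x \<partial>m) \<le> ennreal (1 / \<alpha>)" for y
    using resolvent_le_const[of "\<lambda>_. 1" 1 \<alpha> y] resolvent_eq_kernel[of \<alpha> "\<lambda>_. 1" y] \<alpha> by simp
  then have "(\<integral>\<^sup>+x. \<R> \<alpha> h x \<partial>m) \<le> (\<integral>\<^sup>+y. h y * ennreal (1 / \<alpha>) \<partial>m)"
    using \<alpha> Fubini_kernel[OF _ sets_m sigma_finite_m h, of \<alpha>]
    by (auto intro!: nn_integral_mono mult_left_mono)
  then show ?thesis
    by (simp add: nn_integral_multc mult.commute)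
qed

text \<open>Adding \<open>n\<close> times the solution on both sides of the penalized equation
  leaves \<open>n\<close> times \<open>indicator U + indicator (- U) * \<phi>\<close> on the right
  of \<open>\<alpha> + n - A\<close>. This is a monotone fixed-point problem, and its iteration from
  \<open>0\<close> increases.\<close>

primrec penalized_iter :: "'a set \<Rightarrow> real \<Rightarrow> real \<Rightarrow> nat \<Rightarrow> 'a \<Rightarrow> ennreal" where
  "penalized_iter U \<alpha> n 0 = (\<lambda>_. 0)"
| "penalized_iter U \<alpha> n (Suc k) =
    (\<lambda>x. ennreal n * \<R> (\<alpha> + n) (\<lambda>y. indicator U y + indicator (- U) y * penalized_iter U \<alpha> n k y) x)"

text \<open>The minimal solution of \<open>(\<alpha> - A + n 1\<^bsub>U\<^esub>) \<phi> = n 1\<^bsub>U\<^esub>\<close>, an approximation of the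
  \<open>\<alpha>\<close>-equilibrium potential of \<open>U\<close> as \<open>n\<close> tends to infinity.\<close>

definition penalized :: "'a set \<Rightarrow> real \<Rightarrow> real \<Rightarrow> 'a \<Rightarrow> ennreal" where
  "penalized U \<alpha> n x = (SUP k. penalized_iter U \<alpha> n k x)"

lemma borel_measurable_penalized_iter [measurable]:
  "U \<in> sets borel \<Longrightarrow> penalized_iter U \<alpha> n k \<in> borel_measurable borel"
  by (induction k) auto

lemma borel_measurable_penalized [measurable]:
  "U \<in> sets borel \<Longrightarrow> penalized U \<alpha> n \<in> borel_measurable borel"
  unfolding penalized_def[abs_def] by (intro borel_measurable_SUP) auto

section \<open>Properties of the penalized solution\<close>

context
  fixes U :: "'a set" and \<alpha> n :: real
  assumes U: "open U" and \<alpha>: "0 < \<alpha>" and n: "0 < n"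
begin

lemma borel_U [measurable]: "U \<in> sets borel"
  using U by simp

lemma incseq_penalized_iter: "incseq (penalized_iter U \<alpha> n)"
proof (rule incseq_SucI)
  let ?T = "\<lambda>g x. ennreal n * \<R> (\<alpha> + n) (\<lambda>y. indicator U y + indicator (- U) y * g y) x"
  have mono: "?T f \<le> ?T g" if "f \<le> g" for f g
    using that by (intro le_funI mult_left_mono resolvent_mono add_left_mono) (auto simp: le_fun_def)
  show "penalized_iter U \<alpha> n k \<le> penalized_iter U \<alpha> n (Suc k)" for k
  proof (induction k)
    case (Suc k)
    show ?case
      using mono[OF Suc] by (simp only: penalized_iter.simps(2))
  qed (simp add: le_fun_def)
qed

lemma penalized_iter_le_1: "penalized_iter U \<alpha> n k x \<le> 1"
proof (induction k arbitrary: x)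
  case (Suc k)
  have "\<R> (\<alpha> + n) (\<lambda>y. indicator U y + indicator (- U) y * penalized_iter U \<alpha> n k y) x \<le> 1 * ennreal (1 / (\<alpha> + n))"
    using Suc \<alpha> n by (intro resolvent_le_const) (auto simp: indicator_def)
  then have "penalized_iter U \<alpha> n (Suc k) x \<le> ennreal n * ennreal (1 / (\<alpha> + n))"
    by (auto intro: mult_left_mono)
  also have "\<dots> \<le> 1"
    using \<alpha> n by (simp add: ennreal_mult[symmetric])
  finally show ?case .
qed simp

lemma penalized_le_1: "penalized U \<alpha> n x \<le> 1"
  unfolding penalized_def by (intro SUP_least penalized_iter_le_1)

lemma penalized_fixpoint:
  "penalized U \<alpha> n x =
    ennreal n * \<R> (\<alpha> + n) (\<lambda>y. indicator U y + indicator (- U) y * penalized U \<alpha> n y) x"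
proof -
  have "penalized U \<alpha> n x = (SUP k. penalized_iter U \<alpha> n (Suc k) x)"
    unfolding penalized_def using incseq_penalized_iter
    by (intro antisym SUP_mono) (auto simp: incseq_Suc_iff le_fun_def simp del: penalized_iter.simps)
  also have "\<dots> = ennreal n * (SUP k. \<R> (\<alpha> + n) (\<lambda>y. indicator U y + indicator (- U) y * penalized_iter U \<alpha> n k y) x)"
    by (simp add: SUP_mult_left_ennreal)
  also have "(SUP k. \<R> (\<alpha> + n) (\<lambda>y. indicator U y + indicator (- U) y * penalized_iter U \<alpha> n k y) x)
      = \<R> (\<alpha> + n) (\<lambda>y. SUP k. indicator U y + indicator (- U) y * penalized_iter U \<alpha> n k y) x"
  proof (rule resolvent_SUP[symmetric])
    show "incseq (\<lambda>k y. indicator U y + indicator (- U) y * penalized_iter U \<alpha> n k y)"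
      using incseq_penalized_iter by (auto simp: incseq_def le_fun_def intro!: add_left_mono mult_left_mono)
  qed measurable
  also have "(\<lambda>y. SUP k. indicator U y + indicator (- U) y * penalized_iter U \<alpha> n k y)
      = (\<lambda>y. indicator U y + indicator (- U) y * penalized U \<alpha> n y)"
    unfolding penalized_def by (auto simp: fun_eq_iff indicator_def)
  finally show ?thesis .
qed

text \<open>The bound \<open>n / \<alpha> * u\<close> is the fixed point of
  \<open>c \<mapsto> n / (\<alpha> + n) * (u + c)\<close>, which controls one step of the iteration.
  Integrability yields square integrability, as the values are at most \<open>1\<close>.\<close>

lemma penalized_integral_finite:
  assumes fin: "emeasure m U < \<infinity>"
  shows "(\<integral>\<^sup>+x. penalized U \<alpha> n x \<partial>m) < \<infinity>"
proof -
  obtain u where u: "0 \<le> u" "emeasure m U = ennreal u"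
    using fin by (cases "emeasure m U") auto
  have "(\<integral>\<^sup>+x. penalized_iter U \<alpha> n k x \<partial>m) \<le> ennreal (n / \<alpha> * u)" for k
  proof (induction k)
    case (Suc k)
    have "(\<integral>\<^sup>+x. penalized_iter U \<alpha> n (Suc k) x \<partial>m)
        = ennreal n * (\<integral>\<^sup>+x. \<R> (\<alpha> + n) (\<lambda>y. indicator U y + indicator (- U) y * penalized_iter U \<alpha> n k y) x \<partial>m)"
      by (simp add: nn_integral_cmult)
    also have "\<dots> \<le> ennreal n * (ennreal (1 / (\<alpha> + n)) * (\<integral>\<^sup>+x. indicator U x + indicator (- U) x * penalized_iter U \<alpha> n k x \<partial>m))"
      using \<alpha> n by (intro mult_left_mono integral_resolvent_le) auto
    also have "\<dots> \<le> ennreal n * (ennreal (1 / (\<alpha> + n)) * (\<integral>\<^sup>+x. indicator U x + penalized_iter U \<alpha> n k x \<partial>m))"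
      by (intro mult_left_mono nn_integral_mono) (auto simp: indicator_def)
    also have "(\<integral>\<^sup>+x. indicator U x + penalized_iter U \<alpha> n k x \<partial>m) \<le> ennreal (u + n / \<alpha> * u)"
      using Suc u \<alpha> n by (simp add: nn_integral_add add_left_mono)
    also have "ennreal n * (ennreal (1 / (\<alpha> + n)) * ennreal (u + n / \<alpha> * u)) = ennreal (n / \<alpha> * u)"
    proof -
      have "n * (1 / (\<alpha> + n) * (u + n / \<alpha> * u)) = n / \<alpha> * u"
      proof -
        have "u + n / \<alpha> * u = (\<alpha> + n) * (u / \<alpha>)"
          using \<alpha> by (simp add: field_simps)
        then show ?thesis
          using \<alpha> n by simp
      qed
      moreover have "ennreal n * (ennreal (1 / (\<alpha> + n)) * ennreal (u + n / \<alpha> * u)) = ennreal (n * (1 / (\<alpha> + n) * (u + n / \<alpha> * u)))"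
      proof -
        have "ennreal a * (ennreal b * ennreal c) = ennreal (a * (b * c))" if "0 \<le> a" "0 \<le> b" "0 \<le> c" for a b c
          using that by (simp add: ennreal_mult)
        from this[of n "1 / (\<alpha> + n)" "u + n / \<alpha> * u"] show ?thesis
          using \<alpha> n u(1) by (simp only: add_nonneg_nonneg mult_nonneg_nonneg divide_nonneg_nonneg less_imp_le zero_le_one)
      qed
      ultimately show ?thesis
        by simp
    qed
    finally show ?case
      by (simp add: mult_left_mono)
  qed simp
  then have "(SUP k. \<integral>\<^sup>+x. penalized_iter U \<alpha> n k x \<partial>m) \<le> ennreal (n / \<alpha> * u)"
    by (intro SUP_least)
  moreover have "(\<integral>\<^sup>+x. penalized U \<alpha> n x \<partial>m) = (SUP k. \<integral>\<^sup>+x. penalized_iter U \<alpha> n k x \<partial>m)"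
    unfolding penalized_def by (rule nn_integral_monotone_convergence_SUP[OF incseq_penalized_iter]) simp
  ultimately show ?thesis
    by (simp add: le_less_trans)
qed

text \<open>The map \<open>n * \<R> (\<alpha> + n)\<close> contracts constants by
  \<open>n / (\<alpha> + n) < 1\<close>, so the excess of \<open>v\<close> over \<open>w\<close>,
  initially at most \<open>c\<close>, is driven to zero by iterating the common equation.\<close>

lemma renewal_le:
  assumes [measurable]: "v \<in> borel_measurable borel" "w \<in> borel_measurable borel"
    and v: "\<And>x. v x = b x + ennreal n * \<R> (\<alpha> + n) v x"
    and w: "\<And>x. w x = b x + ennreal n * \<R> (\<alpha> + n) w x"
    and c: "\<And>x. v x \<le> ennreal c" "0 \<le> c"
  shows "v x \<le> w x"
proof -
  let ?q = "n / (\<alpha> + n)"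
  have q: "0 \<le> ?q" "?q < 1"
    using \<alpha> n by auto
  have "v x \<le> w x + ennreal (c * ?q ^ k)" for k x
  proof (induction k arbitrary: x)
    case 0
    then show ?case using c by (simp add: add_increasing)
  next
    case (Suc k)
    have "v x \<le> b x + ennreal n * \<R> (\<alpha> + n) (\<lambda>x. w x + ennreal (c * ?q ^ k)) x"
      using Suc by (subst v) (intro add_left_mono mult_left_mono resolvent_mono, auto)
    also have "\<dots> = w x + ennreal n * \<R> (\<alpha> + n) (\<lambda>x. ennreal (c * ?q ^ k)) x"
      by (subst (2) w) (simp add: resolvent_add distrib_left add.assoc)
    also have "\<dots> \<le> w x + ennreal n * (ennreal (c * ?q ^ k) * ennreal (1 / (\<alpha> + n)))"
      using \<alpha> n by (intro add_left_mono mult_left_mono resolvent_le_const) auto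
    also have "ennreal n * (ennreal (c * ?q ^ k) * ennreal (1 / (\<alpha> + n))) = ennreal (c * ?q ^ Suc k)"
      using \<alpha> n c(2) by (simp add: ennreal_mult[symmetric] mult_ac)
    finally show ?case .
  qed
  moreover have "(\<lambda>k. w x + ennreal (c * ?q ^ k)) \<longlonglongrightarrow> w x + ennreal (c * 0)"
    using q by (intro tendsto_intros LIMSEQ_realpow_zero) auto
  ultimately show ?thesis
    by (intro LIMSEQ_le_const) auto
qed

abbreviation penalty :: "'a \<Rightarrow> ennreal" where
  "penalty y \<equiv> ennreal n * (indicator U y * (1 - penalized U \<alpha> n y))"

text \<open>Both sides are bounded solutions of the same renewal equation, one by the fixed-point
  property and the other by the resolvent equation. The representation as an
  \<open>\<alpha>\<close>-potential is what makes the penalized solution supermedian.\<close>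

lemma penalized_eq_resolvent: "penalized U \<alpha> n x = \<R> \<alpha> penalty x"
proof -
  let ?b = "\<R> (\<alpha> + n) penalty"
  \<comment> \<open>On \<open>U\<close> the missing amount \<open>1 - penalized\<close> is put back;
    subtraction in \<open>ennreal\<close> allows this because the solution is at most
    \<open>1\<close>.\<close>
  have eq: "ennreal n * (indicator U y + indicator (- U) y * penalized U \<alpha> n y) = penalty y + ennreal n * penalized U \<alpha> n y" for y
  proof (cases "y \<in> U")
    case True
    have "1 - penalized U \<alpha> n y + penalized U \<alpha> n y = 1"
      using penalized_le_1 by (simp add: diff_add_cancel_ennreal)
    then show ?thesis
      using True by (simp add: distrib_left[symmetric])
  qed simp
  have 1: "penalized U \<alpha> n x = ?b x + ennreal n * \<R> (\<alpha> + n) (penalized U \<alpha> n) x" for x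
  proof -
    have "penalized U \<alpha> n x = \<R> (\<alpha> + n) (\<lambda>y. penalty y + ennreal n * penalized U \<alpha> n y) x"
      by (subst penalized_fixpoint) (simp only: eq[symmetric], subst resolvent_cmult, simp_all)
    then show ?thesis
      by (simp add: resolvent_add resolvent_cmult)
  qed
  have 2: "\<R> \<alpha> penalty x = ?b x + ennreal n * \<R> (\<alpha> + n) (\<R> \<alpha> penalty) x" for x
    using n by (intro resolvent_equation) auto
  have bound: "\<R> \<alpha> penalty x \<le> ennreal (n * (1 / \<alpha>))" for x
  proof -
    have "penalty y \<le> ennreal n" for y
      by (auto simp: indicator_def intro: order_trans[OF mult_left_mono[of _ 1]])
    then have "\<R> \<alpha> penalty x \<le> ennreal n * ennreal (1 / \<alpha>)"
      using \<alpha> by (intro resolvent_le_const) auto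
    then show ?thesis
      using \<alpha> n by (simp add: ennreal_mult[symmetric])
  qed
  show ?thesis
  proof (rule antisym)
    show "penalized U \<alpha> n x \<le> \<R> \<alpha> penalty x"
      using penalized_le_1 by (intro renewal_le[OF _ _ 1 2, of 1]) auto
    show "\<R> \<alpha> penalty x \<le> penalized U \<alpha> n x"
      using bound \<alpha> n by (intro renewal_le[OF _ _ 2 1, of "n * (1 / \<alpha>)"]) auto
  qed
qed

lemma penalized_supermedian:
  "0 \<le> s \<Longrightarrow> ennreal (exp (- \<alpha> * s)) * \<P> s (penalized U \<alpha> n) x \<le> penalized U \<alpha> n x"
  using resolvent_supermedian[of penalty s \<alpha> x]
  by (simp add: penalized_eq_resolvent[abs_def, symmetric])

lemma penalized_ge: "ennreal n * \<R> (\<alpha> + n) (indicator U) x \<le> penalized U \<alpha> n x"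
  by (subst penalized_fixpoint) (intro mult_left_mono resolvent_mono, auto)

end

end

lemma L2I:
  assumes "g \<in> borel_measurable m" and "(\<integral>\<^sup>+x. ennreal ((g x)\<^sup>2) \<partial>m) < \<infinity>"
  shows "g \<in> L2 m"
  using assms by (auto simp: L2_def intro!: integrableI_nonneg)

section \<open>Energy bounds and sets of capacity zero\<close>

context hunt_dirichlet
begin

lemma emeasure_finite_of_majorant:
  assumes \<psi>: "\<psi> \<in> D" "AE x in m. indicator U x \<le> \<psi> x" and U: "open U"
  shows "emeasure m U < \<infinity>"
proof -
  have "\<psi> \<in> L2 m"
    using \<psi>(1) domain_L2 by auto
  then have "integrable m (\<lambda>x. (\<psi> x)\<^sup>2)"
    by (simp add: L2_def)
  then have fin: "(\<integral>\<^sup>+x. ennreal ((\<psi> x)\<^sup>2) \<partial>m) < \<infinity>"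
    by (simp add: integrable_iff_bounded)
  have "emeasure m U = (\<integral>\<^sup>+x. indicator U x \<partial>m)"
    using U by simp
  also have "\<dots> \<le> (\<integral>\<^sup>+x. ennreal ((\<psi> x)\<^sup>2) \<partial>m)"
    using \<psi>(2)
  proof (intro nn_integral_mono_AE, eventually_elim)
    case (elim x)
    then have "x \<in> U \<Longrightarrow> 1 \<le> (\<psi> x)\<^sup>2"
      by (simp add: power2_eq_square mult_ge1_I)
    then show ?case
      by (auto simp: indicator_def)
  qed
  finally show ?thesis
    using fin by simp
qed

text \<open>Let \<open>E'\<close> be \<open>\<E>\<close> plus \<open>\<alpha>\<close> times the L2
  product. The equation reads \<open>E' f v = (a, v)\<close> with \<open>a \<ge> 0\<close> supported
  in \<open>U\<close>, where \<open>f \<le> 1 \<le> \<psi>\<close> almost everywhere; hence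
  \<open>E' f f \<le> E' f \<psi>\<close>. Together with
  \<open>E' (f - \<psi>) (f - \<psi>) \<ge> 0\<close> this gives
  \<open>E' f f \<le> E' \<psi> \<psi>\<close>.\<close>

lemma penalized_energy:
  assumes U: "open U" and \<alpha>: "0 < \<alpha>" and n: "0 < n"
    and \<psi>: "\<psi> \<in> D" "AE x in m. indicator U x \<le> \<psi> x"
  defines "f \<equiv> \<lambda>x. enn2real (penalized U \<alpha> n x)"
  shows "f \<in> D" and "\<E> f f \<le> \<E> \<psi> \<psi> + \<alpha> * L2_inner m \<psi> \<psi>"
proof -
  have [measurable]: "U \<in> sets borel"
    using U by simp
  have finU: "emeasure m U < \<infinity>"
    using emeasure_finite_of_majorant[OF \<psi> U] .
  note pen_le = penalized_le_1[OF U \<alpha> n]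
  have f_eq: "ennreal (f x) = penalized U \<alpha> n x" for x
    unfolding f_def using le_less_trans[OF pen_le ennreal_one_less_top] by simp
  have f0: "0 \<le> f x" for x
    by (simp add: f_def)
  have f1: "f x \<le> 1" for x
    using pen_le[of x] unfolding f_eq[symmetric] by simp
  have [measurable]: "f \<in> borel_measurable borel"
    unfolding f_def by measurable
  have fint: "(\<integral>\<^sup>+x. ennreal (f x) \<partial>m) < \<infinity>"
    unfolding f_eq by (rule penalized_integral_finite[OF U \<alpha> n finU])
  have sq: "(f x)\<^sup>2 \<le> f x" for x
    using f0 f1 by (simp add: power2_eq_square mult_left_le)
  have fL2: "f \<in> L2 m"
  proof (rule L2I)
    have "(\<integral>\<^sup>+x. ennreal ((f x)\<^sup>2) \<partial>m) \<le> (\<integral>\<^sup>+x. ennreal (f x) \<partial>m)"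
      using sq by (intro nn_integral_mono ennreal_leI)
    then show "(\<integral>\<^sup>+x. ennreal ((f x)\<^sup>2) \<partial>m) < \<infinity>"
      using fint by simp
  qed measurable
  \<comment> \<open>The right-hand side for which \<open>f\<close> is the resolvent of order
    \<open>\<alpha> + n\<close>; association with the form then puts \<open>f\<close> into the
    domain.\<close>
  define w where "w x = n * (indicator U x + indicator (- U) x * f x)" for x
  have [measurable]: "w \<in> borel_measurable borel"
    unfolding w_def[abs_def] by measurable
  have wL2: "w \<in> L2 m"
  proof (rule L2I)
    have "(\<integral>\<^sup>+x. ennreal ((w x)\<^sup>2) \<partial>m) \<le> (\<integral>\<^sup>+x. ennreal (n\<^sup>2) * (indicator U x + ennreal (f x)) \<partial>m)"
    proof (intro nn_integral_mono)
      fix x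
      show "ennreal ((w x)\<^sup>2) \<le> ennreal (n\<^sup>2) * (indicator U x + ennreal (f x))"
      proof (cases "x \<in> U")
        case True
        have "ennreal (n\<^sup>2) * 1 \<le> ennreal (n\<^sup>2) * (1 + ennreal (f x))"
          by (intro mult_left_mono) auto
        then show ?thesis
          using True by (simp add: w_def)
      next
        case False
        have "ennreal (n\<^sup>2 * (f x)\<^sup>2) \<le> ennreal (n\<^sup>2 * f x)"
          using sq by (intro ennreal_leI mult_left_mono) auto
        then show ?thesis
          using False f0 by (simp add: w_def power_mult_distrib ennreal_mult)
      qed
    qed
    also have "\<dots> = ennreal (n\<^sup>2) * (emeasure m U + (\<integral>\<^sup>+x. ennreal (f x) \<partial>m))"
      by (simp add: nn_integral_cmult nn_integral_add)
    also have "\<dots> < \<infinity>"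
      using finU fint by (simp add: ennreal_mult_less_top)
    finally show "(\<integral>\<^sup>+x. ennreal ((w x)\<^sup>2) \<partial>m) < \<infinity>" .
  qed measurable
  define a where "a x = n * indicator U x * (1 - f x)" for x
  have [measurable]: "a \<in> borel_measurable borel"
    unfolding a_def[abs_def] by measurable
  have aL2: "a \<in> L2 m"
  proof (rule L2I)
    have "(\<integral>\<^sup>+x. ennreal ((a x)\<^sup>2) \<partial>m) \<le> (\<integral>\<^sup>+x. ennreal (n\<^sup>2) * indicator U x \<partial>m)"
    proof (intro nn_integral_mono)
      fix x
      have "(1 - f x)\<^sup>2 \<le> 1"
        using f0[of x] f1[of x] by (simp add: power_le_one)
      then have "n\<^sup>2 * (1 - f x)\<^sup>2 \<le> n\<^sup>2 * 1"
        by (intro mult_left_mono) auto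
      then show "ennreal ((a x)\<^sup>2) \<le> ennreal (n\<^sup>2) * indicator U x"
        by (auto simp: a_def indicator_def power_mult_distrib intro: ennreal_leI)
    qed
    also have "\<dots> < \<infinity>"
      using finU by (simp add: nn_integral_cmult ennreal_mult_less_top)
    finally show "(\<integral>\<^sup>+x. ennreal ((a x)\<^sup>2) \<partial>m) < \<infinity>" .
  qed measurable
  have res: "resolvent_real P X (\<alpha> + n) w = f"
  proof
    fix x
    have w0: "0 \<le> w y" for y
      using n f0 by (simp add: w_def)
    have pos: "ennreal (max (w y) 0) = ennreal n * (indicator U y + indicator (- U) y * penalized U \<alpha> n y)" for y
      using n w0[of y] unfolding f_eq[symmetric] by (cases "y \<in> U") (simp_all add: w_def ennreal_mult f0)
    have neg: "ennreal (max (- w y) 0) = 0" for y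
      using w0[of y] by (simp add: max_def ennreal_neg)
    have "\<R> (\<alpha> + n) (\<lambda>_. 0) x \<le> 0 * ennreal (1 / (\<alpha> + n))"
      using \<alpha> n by (intro resolvent_le_const) auto
    then have "\<R> (\<alpha> + n) (\<lambda>_. 0) x = 0"
      by simp
    moreover have "\<R> (\<alpha> + n) (\<lambda>y. ennreal n * (indicator U y + indicator (- U) y * penalized U \<alpha> n y)) x = penalized U \<alpha> n x"
      by (subst (2) penalized_fixpoint[OF U \<alpha> n]) (rule resolvent_cmult, measurable)
    ultimately show "resolvent_real P X (\<alpha> + n) w x = f x"
      unfolding resolvent_real_def pos neg by (simp add: f_def)
  qed
  have "generator m D \<E> (resolvent_real P X (\<alpha> + n) w) (\<lambda>x. (\<alpha> + n) * resolvent_real P X (\<alpha> + n) w x - w x)"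
    using associated wL2 \<alpha> n unfolding associated_process_def by simp
  then have fD: "f \<in> D" and gen: "\<And>v. v \<in> D \<Longrightarrow> \<E> f v = L2_inner m (\<lambda>x. - ((\<alpha> + n) * f x - w x)) v"
    unfolding res generator_def by auto
  show "f \<in> D" by (rule fD)
  have weak: "\<E> f v + \<alpha> * L2_inner m f v = L2_inner m a v" if v: "v \<in> D" for v
  proof -
    have vL2: "v \<in> L2 m"
      using v domain_L2 by auto
    have "- ((\<alpha> + n) * f x - w x) = a x - \<alpha> * f x" for x
      by (cases "x \<in> U") (simp_all add: a_def w_def algebra_simps)
    then have "\<E> f v = (\<integral>x. a x * v x - \<alpha> * (f x * v x) \<partial>m)"
      using gen[OF v] by (simp add: L2_inner_def left_diff_distrib mult.assoc)
    also have "\<dots> = L2_inner m a v - \<alpha> * L2_inner m f v"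
      unfolding L2_inner_def using L2_mult_integrable[OF aL2 vL2] L2_mult_integrable[OF fL2 vL2] by simp
    finally show ?thesis by simp
  qed
  have \<psi>L2: "\<psi> \<in> L2 m"
    using \<psi>(1) domain_L2 by auto
  have le: "L2_inner m a f \<le> L2_inner m a \<psi>"
    unfolding L2_inner_def
  proof (rule integral_mono_AE[OF L2_mult_integrable[OF aL2 fL2] L2_mult_integrable[OF aL2 \<psi>L2]])
    show "AE x in m. a x * f x \<le> a x * \<psi> x"
      using \<psi>(2)
    proof eventually_elim
      case (elim x)
      have "0 \<le> a x"
        using n f1 by (simp add: a_def)
      moreover have "f x \<le> \<psi> x" if "x \<in> U"
        using elim that f1[of x] by simp
      ultimately show ?case
        by (cases "x \<in> U") (auto simp: a_def intro!: mult_left_mono)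
    qed
  qed
  \<comment> \<open>Written with \<open>+ - 1 *\<close> so that the additivity and scaling axioms of
    the form apply literally.\<close>
  define d where "d = (\<lambda>x. f x + - 1 * \<psi> x)"
  have \<psi>': "(\<lambda>x. - 1 * \<psi> x) \<in> D"
    by (rule domain_scale[OF \<psi>(1)])
  have dD: "d \<in> D"
    unfolding d_def by (rule domain_add[OF fD \<psi>'])
  have Ed: "\<E> d v = \<E> f v - \<E> \<psi> v" if "v \<in> D" for v
    using form_add[OF fD \<psi>' that] form_scale[OF \<psi>(1) that, of "- 1"] by (simp add: d_def)
  have Edd: "\<E> d d = \<E> f f - 2 * \<E> f \<psi> + \<E> \<psi> \<psi>"
    using Ed[OF dD] Ed[OF fD] Ed[OF \<psi>(1)] form_sym[OF fD dD] form_sym[OF \<psi>(1) dD] form_sym[OF fD \<psi>(1)] by simp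
  have Ldd: "L2_inner m d d = L2_inner m f f - 2 * L2_inner m f \<psi> + L2_inner m \<psi> \<psi>"
  proof -
    have "L2_inner m d d = (\<integral>x. f x * f x - 2 * (f x * \<psi> x) + \<psi> x * \<psi> x \<partial>m)"
      unfolding L2_inner_def d_def by (intro Bochner_Integration.integral_cong) (auto simp: algebra_simps)
    then show ?thesis
      unfolding L2_inner_def using L2_mult_integrable[OF fL2 fL2] L2_mult_integrable[OF fL2 \<psi>L2] L2_mult_integrable[OF \<psi>L2 \<psi>L2]
      by simp
  qed
  have "0 \<le> L2_inner m d d" "0 \<le> L2_inner m f f"
    unfolding L2_inner_def by (auto intro!: integral_nonneg_AE)
  then have "0 \<le> \<alpha> * L2_inner m d d" "0 \<le> \<alpha> * L2_inner m f f"
    using \<alpha> by simp_all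
  moreover have "\<alpha> * L2_inner m d d = \<alpha> * L2_inner m f f - 2 * (\<alpha> * L2_inner m f \<psi>) + \<alpha> * L2_inner m \<psi> \<psi>"
    unfolding Ldd by (simp add: algebra_simps)
  ultimately show "\<E> f f \<le> \<E> \<psi> \<psi> + \<alpha> * L2_inner m \<psi> \<psi>"
    using le weak[OF fD] weak[OF \<psi>(1)] form_nonneg[OF dD] Edd by linarith
qed

text \<open>Let \<open>e\<close> be the lower limit of the penalized solutions with discount
  \<open>1 / Suc k\<close> and penalty \<open>Suc k\<close>. It is supermedian and at least
  \<open>1\<close> on \<open>U\<close>, so it dominates the hitting probability. Fatou, transience
  and the energy bound estimate its integral, and the L2 term disappears with the discount.\<close>

lemma hitting_integral_le:
  assumes U: "open U" and \<psi>: "\<psi> \<in> D" "AE x in m. indicator U x \<le> \<psi> x"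
    and g: "g \<in> borel_measurable m" "\<And>x. 0 < g x"
    and trans: "\<And>u. u \<in> D \<Longrightarrow> (\<integral>\<^sup>+x. ennreal (\<bar>u x\<bar> * g x) \<partial>m) \<le> ennreal (sqrt (\<E> u u))"
  shows "(\<integral>\<^sup>+x. hitting U 0 x * ennreal (g x) \<partial>m) \<le> ennreal (sqrt (\<E> \<psi> \<psi>))"
proof -
  have [measurable]: "U \<in> sets borel"
    using U by simp
  note [measurable] = g(1)
  let ?\<phi> = "\<lambda>k::nat. penalized U (1 / real (Suc k)) (real (Suc k))"
  define e where "e x = liminf (\<lambda>k. ?\<phi> k x)" for x
  have e_borel: "e \<in> borel_measurable borel"
    unfolding e_def[abs_def] by measurable
  have pos: "0 < 1 / real (Suc k)" "0 < real (Suc k)" for k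
    by auto
  have "\<P> t e x \<le> e x" if t: "0 \<le> t" for t x
  proof -
    \<comment> \<open>For \<open>k \<ge> j\<close> the discount rate is at most
      \<open>1 / Suc j\<close>, so the factor is frozen at \<open>j\<close> during the lower limit
      in \<open>k\<close> and is sent to \<open>1\<close> afterwards.\<close>
    have "ennreal (exp (- (1 / real (Suc j)) * t)) * \<P> t e x \<le> e x" for j
    proof -
      let ?c = "ennreal (exp (- (1 / real (Suc j)) * t))"
      have "?c * \<P> t e x \<le> ?c * liminf (\<lambda>k. \<P> t (?\<phi> k) x)"
        unfolding e_def by (intro mult_left_mono transition_liminf) auto
      also have "\<dots> \<le> liminf (\<lambda>k. ?c * \<P> t (?\<phi> k) x)"
        by (rule ennreal_mult_liminf_le)
      also have "\<dots> \<le> e x"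
        unfolding e_def
      proof (rule Liminf_mono)
        show "\<forall>\<^sub>F k in sequentially. ?c * \<P> t (?\<phi> k) x \<le> ?\<phi> k x"
          using eventually_ge_at_top[of j]
        proof eventually_elim
          case (elim k)
          have "1 / real (Suc k) \<le> 1 / real (Suc j)"
            using elim by (intro divide_left_mono) auto
          then have "?c \<le> ennreal (exp (- (1 / real (Suc k)) * t))"
            using mult_right_mono[OF _ t] by (intro ennreal_leI iffD2[OF exp_le_cancel_iff]) (simp only: mult_minus_left neg_le_iff_le)
          then have "?c * \<P> t (?\<phi> k) x \<le> ennreal (exp (- (1 / real (Suc k)) * t)) * \<P> t (?\<phi> k) x"
            by (rule mult_right_mono) simp
          also have "\<dots> \<le> ?\<phi> k x"
            by (rule penalized_supermedian[OF U pos t])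
          finally show ?case .
        qed
      qed
      finally show ?thesis .
    qed
    moreover have "(\<lambda>j. ennreal (exp (- (1 / real (Suc j)) * t)) * \<P> t e x)
        \<longlonglongrightarrow> ennreal (exp (- 0 * t)) * \<P> t e x"
      using LIMSEQ_inverse_real_of_nat
      by (intro tendsto_mult_ennreal tendsto_intros) (simp_all add: inverse_eq_divide del: of_nat_Suc)
    ultimately show ?thesis
      using LIMSEQ_le_const2 by fastforce
  qed
  moreover have "1 \<le> e x" if "x \<in> U" for x
  proof -
    have "1 \<le> liminf (\<lambda>k. ennreal (real (Suc k)) * \<R> (1 / real (Suc k) + real (Suc k)) (indicator U) x)"
      by (rule resolvent_open_liminf[OF U that])
    also have "\<dots> \<le> e x"
      unfolding e_def by (intro Liminf_mono always_eventually allI penalized_ge[OF U pos])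
    finally show ?thesis .
  qed
  ultimately have "hitting U 0 x \<le> e x" for x
    using hitting_le_supermedian[OF U e_borel] by blast
  then have "(\<integral>\<^sup>+x. hitting U 0 x * ennreal (g x) \<partial>m) \<le> (\<integral>\<^sup>+x. ennreal (g x) * e x \<partial>m)"
    by (subst mult.commute) (intro nn_integral_mono mult_left_mono, simp_all)
  also have "\<dots> \<le> (\<integral>\<^sup>+x. liminf (\<lambda>k. ennreal (g x) * ?\<phi> k x) \<partial>m)"
    unfolding e_def by (intro nn_integral_mono ennreal_mult_liminf_le)
  also have "\<dots> \<le> liminf (\<lambda>k. \<integral>\<^sup>+x. ennreal (g x) * ?\<phi> k x \<partial>m)"
    by (intro nn_integral_liminf) measurable
  also have "\<dots> \<le> liminf (\<lambda>k. ennreal (sqrt (\<E> \<psi> \<psi> + 1 / real (Suc k) * L2_inner m \<psi> \<psi>)))"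
  proof (intro Liminf_mono always_eventually allI)
    fix k
    note en = penalized_energy[OF U pos[of k] \<psi>]
    have "?\<phi> k x = ennreal (enn2real (?\<phi> k x))" for x
      using le_less_trans[OF penalized_le_1[OF U pos[of k], of x] ennreal_one_less_top] by simp
    then have "ennreal (g x) * ?\<phi> k x = ennreal (\<bar>enn2real (?\<phi> k x)\<bar> * g x)" for x
      using g(2)[of x] by (metis abs_of_nonneg enn2real_nonneg ennreal_mult less_imp_le mult.commute)
    then have "(\<integral>\<^sup>+x. ennreal (g x) * ?\<phi> k x \<partial>m) = (\<integral>\<^sup>+x. ennreal (\<bar>enn2real (?\<phi> k x)\<bar> * g x) \<partial>m)"
      by (intro nn_integral_cong)
    also have "\<dots> \<le> ennreal (sqrt (\<E> (\<lambda>x. enn2real (?\<phi> k x)) (\<lambda>x. enn2real (?\<phi> k x))))"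
      by (rule trans[OF en(1)])
    also have "\<dots> \<le> ennreal (sqrt (\<E> \<psi> \<psi> + 1 / real (Suc k) * L2_inner m \<psi> \<psi>))"
      using en(2) by (intro ennreal_leI real_sqrt_le_mono)
    finally show "(\<integral>\<^sup>+x. ennreal (g x) * ?\<phi> k x \<partial>m) \<le> ennreal (sqrt (\<E> \<psi> \<psi> + 1 / real (Suc k) * L2_inner m \<psi> \<psi>))" .
  qed
  also have "\<dots> = ennreal (sqrt (\<E> \<psi> \<psi> + 0 * L2_inner m \<psi> \<psi>))"
    using LIMSEQ_inverse_real_of_nat
    by (intro lim_imp_Liminf tendsto_intros) (simp_all add: inverse_eq_divide del: of_nat_Suc)
  finally show ?thesis
    by simp
qed

lemma capacity_zero_open:
  assumes "capacity m D \<E> K = 0" and "0 < (\<epsilon>::real)"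
  obtains U \<psi> where "open U" "K \<subseteq> U" "\<psi> \<in> D" "AE x in m. indicator U x \<le> \<psi> x" "\<E> \<psi> \<psi> < \<epsilon>"
proof -
  have "capacity m D \<E> K < ennreal \<epsilon>"
    using assms by simp
  then obtain U where U: "open U" "K \<subseteq> U" "open_capacity m D \<E> U < ennreal \<epsilon>"
    unfolding capacity_def INF_less_iff by auto
  from U(3) obtain \<psi> where \<psi>: "\<psi> \<in> D" "AE x in m. indicator U x \<le> \<psi> x" "ennreal (\<E> \<psi> \<psi>) < ennreal \<epsilon>"
    unfolding open_capacity_def INF_less_iff by auto
  then have "\<E> \<psi> \<psi> < \<epsilon>"
    using form_nonneg by (simp add: ennreal_less_iff)
  with U \<psi> show ?thesis
    by (intro that[of U \<psi>])
qed

text \<open>Hitting probabilities are \<open>1\<close> on \<open>U\<close>, so the integral of the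
  positive function \<open>g\<close> over open supersets of \<open>N\<close> becomes arbitrarily
  small. This is how every quasi everywhere hypothesis enters.\<close>

lemma capacity_zero_AE:
  assumes "capacity m D \<E> N = 0"
  shows "AE x in m. x \<notin> N"
proof -
  obtain g where g: "g \<in> borel_measurable m" "\<And>x. 0 < g x"
    and trans: "\<And>u. u \<in> D \<Longrightarrow> (\<integral>\<^sup>+x. ennreal (\<bar>u x\<bar> * g x) \<partial>m) \<le> ennreal (sqrt (\<E> u u))"
    using transient unfolding transient_form_def by auto
  note [measurable] = g(1)
  have "\<exists>U. open U \<and> N \<subseteq> U \<and> (\<integral>\<^sup>+x. indicator U x * ennreal (g x) \<partial>m) \<le> ennreal (1 / real (Suc k))" for k
  proof -
    \<comment> \<open>Squared because the integral bound is the root of the energy.\<close>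
    have "0 < (1 / real (Suc k))\<^sup>2"
      by simp
    from capacity_zero_open[OF assms this]
    obtain U \<psi> where U: "open U" "N \<subseteq> U" "\<psi> \<in> D" "AE x in m. indicator U x \<le> \<psi> x" "\<E> \<psi> \<psi> < (1 / real (Suc k))\<^sup>2"
      by blast
    have "(\<integral>\<^sup>+x. indicator U x * ennreal (g x) \<partial>m) \<le> (\<integral>\<^sup>+x. hitting U 0 x * ennreal (g x) \<partial>m)"
      using hitting_ge_indicator[OF U(1)] by (intro nn_integral_mono mult_right_mono) auto
    also have "\<dots> \<le> ennreal (sqrt (\<E> \<psi> \<psi>))"
      by (rule hitting_integral_le[OF U(1,3,4) g trans])
    also have "\<dots> \<le> ennreal (1 / real (Suc k))"
      using U(5) by (intro ennreal_leI real_le_lsqrt) auto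
    finally show ?thesis
      using U by blast
  qed
  then obtain U where U: "\<And>k. open (U k)" "\<And>k. N \<subseteq> U k"
      "\<And>k. (\<integral>\<^sup>+x. indicator (U k) x * ennreal (g x) \<partial>m) \<le> ennreal (1 / real (Suc k))"
    by metis
  \<comment> \<open>\<open>N\<close> is arbitrary; the intersection provides a Borel set containing
    it.\<close>
  define Z where "Z = (\<Inter>k. U k)"
  have [measurable]: "Z \<in> sets borel"
    unfolding Z_def using U(1) by auto
  have "(\<integral>\<^sup>+x. indicator Z x * ennreal (g x) \<partial>m) \<le> ennreal (1 / real (Suc k))" for k
    by (rule order_trans[OF nn_integral_mono U(3)[of k]]) (auto simp: Z_def indicator_def)
  moreover have "(\<lambda>k. ennreal (1 / real (Suc k))) \<longlonglongrightarrow> ennreal 0"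
    using LIMSEQ_inverse_real_of_nat by (intro tendsto_ennrealI) (simp add: inverse_eq_divide del: of_nat_Suc)
  ultimately have "(\<integral>\<^sup>+x. indicator Z x * ennreal (g x) \<partial>m) \<le> ennreal 0"
    by (intro LIMSEQ_le_const) auto
  then have "AE x in m. indicator Z x * ennreal (g x) = 0"
    by (subst nn_integral_0_iff_AE[symmetric]) auto
  then show ?thesis
  proof eventually_elim
    case (elim x)
    then have "x \<notin> Z"
      using g(2)[of x] by (auto simp: indicator_def ennreal_eq_0_iff split: if_splits)
    then show ?case
      using U(2) by (auto simp: Z_def)
  qed
qed

lemma quasi_everywhere_AE:
  assumes "quasi_everywhere m D \<E> Q"
  shows "AE x in m. Q x"
proof -
  obtain N where "capacity m D \<E> N = 0" and Q: "\<And>x. x \<notin> N \<Longrightarrow> Q x"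
    using assms unfolding quasi_everywhere_def by auto
  from capacity_zero_AE[OF this(1)] show ?thesis
    by eventually_elim (rule Q)
qed

end

section \<open>Potentials of measures\<close>

text \<open>Approximating from inside and outside at once makes the property stable under
  complements, so it passes through the generation of the Borel sets. The metric supplies the closed
  sets that exhaust an open set.\<close>

lemma finite_measure_closed_open_approx:
  fixes \<nu> :: "'a::metric_space measure"
  assumes \<nu>: "sets \<nu> = sets borel" "finite_measure \<nu>" and B: "B \<in> sets borel" and e: "0 < (e::real)"
  shows "\<exists>C U. closed C \<and> open U \<and> C \<subseteq> B \<and> B \<subseteq> U \<and> measure \<nu> (U - C) < e"
proof -
  interpret finite_measure \<nu> by (rule \<nu>(2))
  have [simp]: "S \<in> sets borel \<Longrightarrow> S \<in> sets \<nu>" for S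
    using \<nu>(1) by simp
  have "B \<in> sigma_sets UNIV {S. open S}"
    using B by (simp add: borel_def)
  then show ?thesis
    using e
  proof (induction arbitrary: e)
    case (Basic U)
    then have U: "open U" by simp
    define C where "C k = {x. 1 / real (Suc k) \<le> infdist x (- U)}" for k
    show ?case
    proof (cases "U = UNIV")
      case True
      then show ?thesis
        using Basic by (intro exI[of _ UNIV]) auto
    next
      case False
      have cl: "closed (C k)" for k
        unfolding C_def by (intro closed_Collect_le continuous_intros)
      have sub: "C k \<subseteq> U" for k
      proof
        fix x assume "x \<in> C k"
        moreover have "infdist x (- U) = 0" if "x \<notin> U"
          using that by simp
        ultimately show "x \<in> U"
          unfolding C_def by (cases "x \<in> U") (auto simp: field_simps)
      qed
      have "(\<lambda>k. measure \<nu> (U - C k)) \<longlonglongrightarrow> measure \<nu> (\<Inter>k. U - C k)"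
      proof (rule finite_Lim_measure_decseq)
        show "range (\<lambda>k. U - C k) \<subseteq> sets \<nu>"
          using U cl by auto
        show "decseq (\<lambda>k. U - C k)"
        proof (rule decseq_SucI)
          fix k
          have "1 / real (Suc (Suc k)) \<le> 1 / real (Suc k)"
            by (intro divide_left_mono) auto
          then show "U - C (Suc k) \<subseteq> U - C k"
            unfolding C_def by (auto intro: order_trans)
        qed
      qed
      moreover have "(\<Inter>k. U - C k) = {}"
      proof (rule ccontr)
        assume "(\<Inter>k. U - C k) \<noteq> {}"
        then obtain x where x: "x \<in> U" "\<And>k. x \<notin> C k" by auto
        have "x \<notin> closure (- U)"
          using U x(1) by (auto simp: closure_complement interior_open)
        then have "0 < infdist x (- U)"
          using False in_closure_iff_infdist_zero[of "- U" x] infdist_nonneg[of x "- U"] by force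
        then obtain k where "1 / real (Suc k) < infdist x (- U)"
          by (rule nat_approx_posE)
        then show False
          using x(2)[of k] unfolding C_def by simp
      qed
      ultimately have "(\<lambda>k. measure \<nu> (U - C k)) \<longlonglongrightarrow> 0"
        by (simp only: measure_empty)
      then have "\<forall>\<^sub>F k in sequentially. measure \<nu> (U - C k) < e"
        using Basic.prems by (intro order_tendstoD(2))
      then obtain k where "measure \<nu> (U - C k) < e"
        by (auto simp: eventually_sequentially)
      then show ?thesis
        using U cl sub by (intro exI[of _ "C k"] exI[of _ U]) auto
    qed
  next
    case Empty
    then show ?case
      by (intro exI[of _ "{}"]) auto
  next
    case (Compl B)
    obtain C U where "closed C" "open U" "C \<subseteq> B" "B \<subseteq> U" "measure \<nu> (U - C) < e"
      using Compl.IH[OF Compl.prems] by blast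
    moreover have "- C - - U = U - C" by auto
    ultimately show ?case
      by (intro exI[of _ "- U"] exI[of _ "- C"]) auto
  next
    case (Union B)
    \<comment> \<open>The tolerances sum to \<open>e / 2\<close>. The other half of \<open>e\<close>
      leaves room for replacing the infinite union of closed sets, which need not be closed, by a
      finite one.\<close>
    have "\<exists>C U. closed C \<and> open U \<and> C \<subseteq> B i \<and> B i \<subseteq> U \<and> measure \<nu> (U - C) < e / 2 * (1 / 2) ^ Suc i" for i
      using Union.IH[of "e / 2 * (1 / 2) ^ Suc i"] Union.prems by simp
    then obtain C U where CU: "\<And>i. closed (C i)" "\<And>i. open (U i)" "\<And>i. C i \<subseteq> B i" "\<And>i. B i \<subseteq> U i"
        "\<And>i. measure \<nu> (U i - C i) < e / 2 * (1 / 2) ^ Suc i"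
      by metis
    have meas: "C i \<in> sets \<nu>" "U i \<in> sets \<nu>" for i
      using CU(1,2) by auto
    have sums: "(\<lambda>i. e / 2 * (1 / 2) ^ Suc i) sums (e / 2 * 1)"
      by (intro sums_mult power_half_series)
    have "measure \<nu> ((\<Union>i. U i) - (\<Union>i. C i)) \<le> measure \<nu> (\<Union>i. U i - C i)"
      using meas by (intro finite_measure_mono) auto
    also have "\<dots> \<le> (\<Sum>i. measure \<nu> (U i - C i))"
    proof (rule finite_measure_subadditive_countably)
      show "range (\<lambda>i. U i - C i) \<subseteq> sets \<nu>"
        using meas by auto
      show "summable (\<lambda>i. measure \<nu> (U i - C i))"
        by (rule summable_comparison_test'[OF sums_summable[OF sums], of 0])
           (use CU(5) in \<open>auto intro: less_imp_le\<close>)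
    qed
    also have "\<dots> \<le> (\<Sum>i. e / 2 * (1 / 2) ^ Suc i)"
    proof (rule suminf_le)
      show "summable (\<lambda>i. measure \<nu> (U i - C i))"
        by (rule summable_comparison_test'[OF sums_summable[OF sums], of 0])
           (use CU(5) in \<open>auto intro: less_imp_le\<close>)
    qed (use CU(5) sums_summable[OF sums] in \<open>auto intro: less_imp_le\<close>)
    also have "\<dots> = e / 2"
      using sums_unique[OF sums] by simp
    finally have half: "measure \<nu> ((\<Union>i. U i) - (\<Union>i. C i)) < e"
      using Union.prems by simp
    have "(\<lambda>n. measure \<nu> ((\<Union>i. U i) - (\<Union>i\<le>n. C i))) \<longlonglongrightarrow> measure \<nu> (\<Inter>n. (\<Union>i. U i) - (\<Union>i\<le>n. C i))"
    proof (rule finite_Lim_measure_decseq)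
      show "range (\<lambda>n. (\<Union>i. U i) - (\<Union>i\<le>n. C i)) \<subseteq> sets \<nu>"
        using meas by (auto intro!: sets.Diff)
      show "decseq (\<lambda>n. (\<Union>i. U i) - (\<Union>i\<le>n. C i))"
        by (rule decseq_SucI) (auto simp: le_Suc_eq)
    qed
    also have "(\<Inter>n. (\<Union>i. U i) - (\<Union>i\<le>n. C i)) = (\<Union>i. U i) - (\<Union>i. C i)"
      by auto
    finally have "\<forall>\<^sub>F n in sequentially. measure \<nu> ((\<Union>i. U i) - (\<Union>i\<le>n. C i)) < e"
      using half by (intro order_tendstoD(2))
    then obtain n where "measure \<nu> ((\<Union>i. U i) - (\<Union>i\<le>n. C i)) < e"
      by (auto simp: eventually_sequentially)
    moreover have "closed (\<Union>i\<le>n. C i)" "open (\<Union>i. U i)"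
      using CU(1,2) by auto
    moreover have "(\<Union>i\<le>n. C i) \<subseteq> (\<Union>i. B i)" "(\<Union>i. B i) \<subseteq> (\<Union>i. U i)"
      using CU(3,4) by blast+
    ultimately show ?case
      by blast
  qed
qed

text \<open>Inner regularity after restriction to a set of finite measure that meets
  \<open>B\<close> with positive mass. It reduces the vanishing of a measure on a Borel set to
  closed subsets, which have good neighbourhoods.\<close>

lemma sigma_finite_closed_subset_pos:
  fixes \<nu> :: "'a::metric_space measure"
  assumes \<nu>: "sets \<nu> = sets borel" "sigma_finite_measure \<nu>" and B: "B \<in> sets borel" "0 < emeasure \<nu> B"
  obtains K where "closed K" "K \<subseteq> B" "0 < emeasure \<nu> K"
proof -
  interpret sigma_finite_measure \<nu> by (rule \<nu>(2))
  note [measurable_cong] = \<nu>(1)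
  have sp: "space \<nu> = UNIV"
    using sets_eq_imp_space_eq[OF \<nu>(1)] by simp
  obtain A :: "nat \<Rightarrow> 'a set" where A: "range A \<subseteq> sets \<nu>" "(\<Union>i. A i) = space \<nu>" "\<And>i. emeasure \<nu> (A i) \<noteq> \<infinity>"
    using sigma_finite by blast
  have "\<exists>i. 0 < emeasure \<nu> (B \<inter> A i)"
  proof (rule ccontr)
    assume "\<not> (\<exists>i. 0 < emeasure \<nu> (B \<inter> A i))"
    then have "emeasure \<nu> (\<Union>i. B \<inter> A i) = 0"
      using A(1) B(1) \<nu>(1) by (intro emeasure_UN_eq_0) auto
    moreover have "(\<Union>i. B \<inter> A i) = B"
      using A(2) sp by auto
    ultimately show False
      using B(2) by simp
  qed
  then obtain i where i: "0 < emeasure \<nu> (B \<inter> A i)" ..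
  have Ai: "A i \<in> sets borel"
    using A(1) \<nu>(1) by auto
  define \<nu>' where "\<nu>' = density \<nu> (indicator (A i))"
  have s': "sets \<nu>' = sets borel"
    by (simp add: \<nu>'_def \<nu>(1))
  have em: "emeasure \<nu>' C = emeasure \<nu> (C \<inter> A i)" if "C \<in> sets borel" for C
    using that Ai \<nu>(1) by (simp add: \<nu>'_def emeasure_restricted Int_commute)
  have fin: "finite_measure \<nu>'"
    by (rule finite_measureI) (use em[of UNIV] A(3)[of i] sp in \<open>simp add: \<nu>'_def\<close>)
  interpret \<nu>': finite_measure \<nu>' by (rule fin)
  have "0 < measure \<nu>' B"
    unfolding ennreal_less_zero_iff[symmetric] \<nu>'.emeasure_eq_measure[symmetric] em[OF B(1)] by (rule i)
  from finite_measure_closed_open_approx[OF s' fin B(1) this]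
  obtain C U where CU: "closed C" "open U" "C \<subseteq> B" "B \<subseteq> U" "measure \<nu>' (U - C) < measure \<nu>' B"
    by blast
  have "0 < measure \<nu>' C"
  proof -
    have "measure \<nu>' B \<le> measure \<nu>' (C \<union> (U - C))"
      using CU s' by (intro \<nu>'.finite_measure_mono) auto
    also have "\<dots> \<le> measure \<nu>' C + measure \<nu>' (U - C)"
      using CU s' by (intro measure_Un_le) auto
    finally show ?thesis
      using CU(5) by simp
  qed
  then have "0 < emeasure \<nu>' C"
    by (simp add: \<nu>'.emeasure_eq_measure)
  also have "\<dots> \<le> emeasure \<nu> C"
    using CU(1) \<nu>(1) by (simp add: em emeasure_mono)
  finally show ?thesis
    using that CU(1,3) by blast
qed

section \<open>Positivity of potentials and sigma-finiteness\<close>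

context hunt_dirichlet
begin

text \<open>Along the semigroup a supermedian function decreases in time, so the value at
  \<open>t\<^sub>0\<close> is a lower bound on all of \<open>{0..t\<^sub>0}\<close>.\<close>

lemma resolvent_pos_of_supermedian:
  assumes e: "e \<in> borel_measurable borel" and super: "\<And>t z. 0 \<le> t \<Longrightarrow> \<P> t e z \<le> e z"
    and t0: "0 < t\<^sub>0" "0 < \<P> t\<^sub>0 e y"
  shows "0 < \<R> 0 e y"
proof -
  let ?c = "\<P> t\<^sub>0 e y"
  have "0 < ?c * ennreal t\<^sub>0"
    using t0 by (simp add: ennreal_zero_less_mult_iff)
  also have "?c * ennreal t\<^sub>0 = (\<integral>\<^sup>+t. ?c * indicator {0..t\<^sub>0} t \<partial>lborel)"
    using t0 by (simp add: nn_integral_cmult)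
  also have "\<dots> \<le> laplace 0 (\<lambda>t. \<P> t e y)"
    unfolding laplace_def
  proof (intro nn_integral_mono)
    fix t :: real
    have "?c \<le> \<P> t e y" if t: "0 \<le> t" "t \<le> t\<^sub>0"
    proof -
      have "?c = \<P> t (\<P> (t\<^sub>0 - t) e) y"
        using t by (simp add: transition_transition[OF e] ennreal_plus[symmetric] del: ennreal_plus)
      also have "\<dots> \<le> \<P> t e y"
        using t by (intro transition_mono super) auto
      finally show ?thesis .
    qed
    then show "?c * indicator {0..t\<^sub>0} t \<le> ennreal (exp (- 0 * t)) * \<P> t e y * indicator {0..} t"
      by (auto simp: indicator_def)
  qed
  finally show ?thesis
    by (simp add: resolvent_eq_laplace[OF e])
qed

lemma resolvent_one_pos: "0 < \<R> 0 (\<lambda>_. 1) y"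
proof -
  have "(\<lambda>n. \<P> (1 / real (Suc n)) (indicator UNIV) y) \<longlonglongrightarrow> 1"
    using LIMSEQ_inverse_real_of_nat
    by (intro transition_open_tendsto) (auto simp: inverse_eq_divide simp del: of_nat_Suc)
  then have "\<forall>\<^sub>F n in sequentially. 0 < \<P> (1 / real (Suc n)) (indicator UNIV) y"
    by (rule order_tendstoD(1)) simp
  then obtain n where "0 < \<P> (1 / real (Suc n)) (indicator UNIV) y"
    by (auto simp: eventually_sequentially)
  then show ?thesis
    by (intro resolvent_pos_of_supermedian[of _ "1 / real (Suc n)"] transition_const_le)
       (simp_all add: indicator_def[abs_def] del: of_nat_Suc)
qed

text \<open>The potential has a density with respect to \<open>m\<close>: if it vanished at
  \<open>y\<close>, then \<open>r 0 y\<close> would vanish almost everywhere and the potential of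
  \<open>1\<close> at \<open>y\<close> would be zero too. Thus almost everywhere positivity becomes
  positivity at every point.\<close>

lemma resolvent_pos:
  assumes h: "h \<in> borel_measurable borel" "AE x in m. 0 < h x"
  shows "0 < \<R> 0 h y"
proof (rule ccontr)
  assume "\<not> 0 < \<R> 0 h y"
  then have "(\<integral>\<^sup>+x. h x * r 0 y x \<partial>m) = 0"
    using resolvent_eq_kernel[OF order_refl h(1), of y] by simp
  then have "AE x in m. h x * r 0 y x = 0"
    using h(1) by (subst (asm) nn_integral_0_iff_AE) auto
  then have "AE x in m. r 0 y x = 0"
    using h(2) by eventually_elim auto
  then have "(\<integral>\<^sup>+x. 1 * r 0 y x \<partial>m) = 0"
    by (subst nn_integral_0_iff_AE) auto
  then show False
    using resolvent_one_pos[of y] resolvent_eq_kernel[OF order_refl, of "\<lambda>_. 1" y] by simp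
qed

lemma resolvent_AE_zero:
  assumes e: "e \<in> borel_measurable borel" "AE x in m. e x = 0"
  shows "\<R> 0 e y = 0"
  unfolding resolvent_eq_kernel[OF order_refl e(1)] using e
  by (subst nn_integral_0_iff_AE) auto

lemma kernel_supermedian:
  assumes "0 \<le> t"
  shows "\<P> t (r 0 x) y \<le> r 0 x y"
  using spec[OF conjunct2[OF excessive_kernel[OF order_refl, of x, unfolded excessive_def]], of y,
      THEN conjunct1, rule_format, OF assms] by simp

text \<open>Excessivity gives convergence of the semigroup at time zero, so a positive value at the
  single point \<open>y\<close> persists for small positive times.\<close>

lemma kernel_resolvent_pos:
  assumes "0 < r 0 x y"
  shows "0 < \<R> 0 (r 0 x) y"
proof -
  have "((\<lambda>t. \<P> t (r 0 x) y) \<longlongrightarrow> r 0 x y) (at_right 0)"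
    using spec[OF conjunct2[OF excessive_kernel[OF order_refl, of x, unfolded excessive_def]], of y,
      THEN conjunct2] by simp
  then have "\<forall>\<^sub>F t in at_right 0. 0 < \<P> t (r 0 x) y"
    using assms by (rule order_tendstoD(1))
  then obtain b where b: "(0::real) < b" "\<And>t. 0 < t \<Longrightarrow> t < b \<Longrightarrow> 0 < \<P> t (r 0 x) y"
    unfolding eventually_at_right_field by auto
  then show ?thesis
    by (intro resolvent_pos_of_supermedian[of _ "b / 2"] kernel_supermedian) auto
qed

text \<open>The sequence maximizes the measure of the union of the sets \<open>{r(x\<^sub>i, -) > 0}\<close>. This only covers
  almost every point, and excessivity of \<open>r(x, -)\<close> excludes exceptional points.\<close>

lemma countable_kernel_cover:
  assumes L: "AE x in m. x \<in> L"
  obtains x :: "nat \<Rightarrow> 'a" where "range x \<subseteq> L" "\<And>y. \<exists>i. 0 < r 0 (x i) y"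
proof -
  interpret m: sigma_finite_measure m by (rule sigma_finite_m)
  obtain \<rho> where \<rho>: "\<rho> \<in> borel_measurable m" "\<And>x. 0 < (\<rho> x :: real)" "integrable m \<rho>"
    using m.obtain_positive_integrable_function by metis
  note [measurable] = \<rho>(1)
  \<comment> \<open>A finite measure with the null sets of \<open>m\<close>; finiteness permits the
    cancellation that proves \<open>null\<close>.\<close>
  define \<theta> where "\<theta> = density m (\<lambda>x. ennreal (\<rho> x))"
  have sets_\<theta>[simp, measurable_cong]: "sets \<theta> = sets borel"
    by (simp add: \<theta>_def)
  have "(\<integral>\<^sup>+x. ennreal (\<rho> x) \<partial>m) < \<infinity>"
    using \<rho>(2,3) by (simp add: integrable_iff_bounded less_imp_le)
  then have fin\<theta>: "finite_measure \<theta>"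
    by (intro finite_measureI) (simp add: \<theta>_def emeasure_density)
  interpret \<theta>: finite_measure \<theta> by (rule fin\<theta>)
  define S where "S x = {y. 0 < r 0 x y}" for x
  have [measurable]: "S x \<in> sets borel" for x
    unfolding S_def by measurable
  define G where "G x = (\<Union>i. S (x i))" for x :: "nat \<Rightarrow> 'a"
  have [measurable]: "G x \<in> sets borel" for x
    unfolding G_def by measurable
  define \<X> where "\<X> = {x :: nat \<Rightarrow> 'a. range x \<subseteq> L}"
  have "L \<noteq> {}"
  proof
    assume "L = {}"
    then have "AE x in m. (1 :: ennreal) = 0"
      using L by simp
    then have "\<R> 0 (\<lambda>_. 1) y = 0" for y
      by (intro resolvent_AE_zero) auto
    then show False
      using resolvent_one_pos by simp
  qed
  then have "\<X> \<noteq> {}"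
    unfolding \<X>_def by (auto intro!: exI[of _ "\<lambda>_. SOME x. x \<in> L"] some_in_eq[THEN iffD2])
  from ennreal_SUP_countable_SUP[OF this, of "\<lambda>x. emeasure \<theta> (G x)"]
  obtain f :: "nat \<Rightarrow> ennreal" where f: "range f \<subseteq> (\<lambda>x. emeasure \<theta> (G x)) ` \<X>"
      "(SUP x\<in>\<X>. emeasure \<theta> (G x)) = Sup (range f)"
    by blast
  have "\<exists>x\<in>\<X>. f k = emeasure \<theta> (G x)" for k
    using f(1) by auto
  then obtain xx where xx: "\<And>k. xx k \<in> \<X>" "\<And>k. f k = emeasure \<theta> (G (xx k))"
    by metis
  \<comment> \<open>Merges countably many sequences whose unions approach the supremum into one
    sequence that attains it.\<close>
  define x where "x n = (case prod_decode n of (k, i) \<Rightarrow> xx k i)" for n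
  have xL: "range x \<subseteq> L"
  proof -
    have "xx k i \<in> L" for k i
      using xx(1)[of k] by (auto simp: \<X>_def)
    then show ?thesis
      by (auto simp: x_def split: prod.split)
  qed
  have Gxx: "G (xx k) \<subseteq> G x" for k
  proof
    fix y assume "y \<in> G (xx k)"
    then obtain i where "y \<in> S (xx k i)"
      by (auto simp: G_def)
    then have "y \<in> S (x (prod_encode (k, i)))"
      by (simp add: x_def)
    then show "y \<in> G x"
      by (auto simp: G_def)
  qed
  have max: "emeasure \<theta> (G z) \<le> emeasure \<theta> (G x)" if "z \<in> \<X>" for z
  proof -
    have "emeasure \<theta> (G z) \<le> (SUP x\<in>\<X>. emeasure \<theta> (G x))"
      using that by (rule SUP_upper)
    also have "\<dots> \<le> emeasure \<theta> (G x)"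
      unfolding f(2) xx(2) using Gxx by (intro SUP_least emeasure_mono) auto
    finally show ?thesis .
  qed
  have null: "AE z in m. z \<in> S w \<longrightarrow> z \<in> G x" if w: "w \<in> L" for w
  proof -
    define z where "z = case_nat w x"
    have "z \<in> \<X>"
      using w subsetD[OF xL rangeI] by (auto simp: \<X>_def z_def split: nat.split)
    moreover have Gz: "G z = S w \<union> G x"
      unfolding G_def z_def by (subst UNIV_nat_eq) auto
    ultimately have "emeasure \<theta> (S w \<union> G x) \<le> emeasure \<theta> (G x)"
      using max by metis
    moreover have "emeasure \<theta> (S w \<union> G x) = emeasure \<theta> (G x) + emeasure \<theta> (S w - G x)"
      by (subst plus_emeasure) (auto intro!: arg_cong[where f="emeasure \<theta>"])
    ultimately have "emeasure \<theta> (S w - G x) = 0"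
      using ennreal_add_left_cancel_le[of "emeasure \<theta> (G x)" "emeasure \<theta> (S w - G x)" 0] by simp
    then have "AE z in \<theta>. z \<notin> S w - G x"
      by (intro AE_not_in) (auto simp: null_sets_def)
    then have "AE z in m. 0 < ennreal (\<rho> z) \<longrightarrow> z \<notin> S w - G x"
      unfolding \<theta>_def by (subst (asm) AE_density) auto
    then show ?thesis
      by eventually_elim (use \<rho>(2) in auto)
  qed
  have "\<exists>i. 0 < r 0 (x i) y" for y
  proof (rule ccontr)
    assume "\<not> (\<exists>i. 0 < r 0 (x i) y)"
    then have zero: "r 0 (x i) y = 0" for i
      by (auto simp: not_gr_zero)
    have "\<R> 0 (r 0 (x i)) y = 0" for i
    proof -
      have "\<P> t (r 0 (x i)) y = 0" if "0 \<le> t" for t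
        using kernel_supermedian[OF that, of "x i" y] zero[of i] by simp
      then have "laplace 0 (\<lambda>t. \<P> t (r 0 (x i)) y) \<le> laplace 0 (\<lambda>t. 0)"
        by (intro laplace_mono) simp
      then show ?thesis
        by (simp add: resolvent_eq_laplace laplace_def)
    qed
    then have "(\<integral>\<^sup>+z. r 0 (x i) z * r 0 y z \<partial>m) = 0" for i
      using resolvent_eq_kernel[OF order_refl, of "r 0 (x i)" y] by simp
    then have "AE z in m. r 0 (x i) z * r 0 y z = 0" for i
      using nn_integral_0_iff_AE[of "\<lambda>z. r 0 (x i) z * r 0 y z" m] by simp
    then have "AE z in m. \<forall>i. r 0 (x i) z * r 0 y z = 0"
      unfolding AE_all_countable by (rule allI)
    then have off: "AE z in m. z \<in> G x \<longrightarrow> r 0 y z = 0"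
    proof eventually_elim
      case (elim z)
      then show ?case
        by (auto simp: G_def S_def)
    qed
    \<comment> \<open>Otherwise \<open>r 0 y\<close> would vanish almost everywhere, against the
      positivity of the potential of \<open>1\<close>.\<close>
    have "\<exists>w\<in>L. 0 < r 0 y w"
    proof (rule ccontr)
      assume none: "\<not> (\<exists>w\<in>L. 0 < r 0 y w)"
      have "AE z in m. r 0 y z = 0"
        using L by eventually_elim (use none in \<open>auto simp: not_gr_zero\<close>)
      then have "(\<integral>\<^sup>+z. 1 * r 0 y z \<partial>m) = 0"
        by (subst nn_integral_0_iff_AE) auto
      then show False
        using resolvent_one_pos[of y] resolvent_eq_kernel[OF order_refl, of "\<lambda>_. 1" y] by simp
    qed
    then obtain w where "w \<in> L" "0 < r 0 y w" ..
    then have w: "w \<in> L" "0 < r 0 w y"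
      by (simp_all add: kernel_sym[OF order_refl, of w y])
    \<comment> \<open>Up to null sets, \<open>r 0 y\<close> vanishes on \<open>G x\<close>, and
      \<open>r 0 w\<close> vanishes off it by maximality.\<close>
    have "AE z in m. r 0 w z * r 0 y z = 0"
      using off null[OF w(1)]
    proof eventually_elim
      case (elim z)
      then show ?case
        by (auto simp: S_def not_gr_zero)
    qed
    then have "\<R> 0 (r 0 w) y = 0"
      using resolvent_eq_kernel[OF order_refl, of "r 0 w" y] nn_integral_0_iff_AE[of "\<lambda>z. r 0 w z * r 0 y z" m]
      by simp
    then show False
      using kernel_resolvent_pos[OF w(2)] by simp
  qed
  with xL show ?thesis
    by (rule that)
qed

text \<open>By Markov's inequality a level set of \<open>r 0 x\<close> has finite measure wherever
  the potential is finite at \<open>x\<close>; the countable cover by kernels makes such sets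
  exhaust the space.\<close>

lemma sigma_finite_of_potential:
  assumes \<nu>[measurable_cong]: "sets \<nu> = sets borel" and fin: "AE x in m. (\<integral>\<^sup>+y. r 0 x y \<partial>\<nu>) < \<infinity>"
  shows "sigma_finite_measure \<nu>"
proof
  obtain x :: "nat \<Rightarrow> 'a" where x: "range x \<subseteq> {x. (\<integral>\<^sup>+y. r 0 x y \<partial>\<nu>) < \<infinity>}" "\<And>y. \<exists>i. 0 < r 0 (x i) y"
    using countable_kernel_cover[of "{x. (\<integral>\<^sup>+y. r 0 x y \<partial>\<nu>) < \<infinity>}"] fin by auto
  define A where "A i k = {y. ennreal (1 / real (Suc k)) \<le> r 0 (x i) y}" for i k
  have [measurable]: "A i k \<in> sets \<nu>" for i k
    unfolding A_def \<nu> by measurable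
  have "emeasure \<nu> (A i k) \<noteq> \<infinity>" for i k
  proof -
    have "ennreal (1 / real (Suc k)) * emeasure \<nu> (A i k) = (\<integral>\<^sup>+y. ennreal (1 / real (Suc k)) * indicator (A i k) y \<partial>\<nu>)"
      by (subst nn_integral_cmult) auto
    also have "\<dots> \<le> (\<integral>\<^sup>+y. r 0 (x i) y \<partial>\<nu>)"
      by (intro nn_integral_mono) (auto simp: A_def indicator_def)
    also have "\<dots> < \<infinity>"
      using x(1) by auto
    finally show ?thesis
      by (auto simp: ennreal_mult_less_top)
  qed
  moreover have "(\<Union>p. A (fst p) (snd p)) = space \<nu>"
  proof -
    have "\<exists>p. y \<in> A (fst p) (snd p)" for y
    proof -
      obtain i where "0 < r 0 (x i) y"
        using x(2) by blast
      \<comment> \<open>Cut off at \<open>1\<close> since the kernel may be infinite.\<close>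
      define c where "c = enn2real (min 1 (r 0 (x i) y))"
      have "min 1 (r 0 (x i) y) < top"
        by (simp add: min_less_iff_disj)
      then have "ennreal c = min 1 (r 0 (x i) y)"
        unfolding c_def by (rule ennreal_enn2real)
      then have c: "0 < c" "ennreal c \<le> r 0 (x i) y"
        using \<open>0 < r 0 (x i) y\<close> by (simp_all flip: ennreal_less_zero_iff)
      obtain k where "1 / real (Suc k) < c"
        by (rule nat_approx_posE[OF c(1)])
      then have "ennreal (1 / real (Suc k)) \<le> r 0 (x i) y"
        using c(2) by (meson ennreal_leI less_imp_le order_trans)
      then show ?thesis
        by (intro exI[of _ "(i, k)"]) (simp add: A_def)
    qed
    then show ?thesis
      using sets_eq_imp_space_eq[OF \<nu>] by auto
  qed
  ultimately show "\<exists>\<A>. countable \<A> \<and> \<A> \<subseteq> sets \<nu> \<and> \<Union>\<A> = space \<nu> \<and> (\<forall>a\<in>\<A>. emeasure \<nu> a \<noteq> \<infinity>)"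
    by (intro exI[of _ "range (\<lambda>p. A (fst p) (snd p))"]) auto
qed

end

lemma capacity_mono: "A \<subseteq> B \<Longrightarrow> capacity m D \<E> A \<le> capacity m D \<E> B"
  unfolding capacity_def by (rule INF_superset_mono) auto

section \<open>Potentials of semigroup increments\<close>

context hunt_dirichlet
begin

lemma transition_decreasing:
  assumes v: "v \<in> borel_measurable borel" and super: "\<And>s x. 0 \<le> s \<Longrightarrow> \<P> s v x \<le> v x"
    and st: "0 \<le> s" "s \<le> t"
  shows "\<P> t v x \<le> \<P> s v x"
proof -
  have "\<P> t v x = \<P> s (\<P> (t - s) v) x"
    using st by (simp add: transition_transition[OF v] ennreal_plus[symmetric] del: ennreal_plus)
  also have "\<dots> \<le> \<P> s v x"
    using st by (intro transition_mono super) auto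
  finally show ?thesis .
qed

lemma resolvent_0_supermedian:
  assumes "h \<in> borel_measurable borel" "0 \<le> s"
  shows "\<P> s (\<R> 0 h) x \<le> \<R> 0 h x"
  using resolvent_supermedian[OF assms, of 0 x] by simp

text \<open>The value at time \<open>n\<close> is the tail from \<open>n\<close> on of the
  convergent integral that defines the potential.\<close>

lemma transition_resolvent_tendsto_0:
  assumes h[measurable]: "h \<in> borel_measurable borel" and fin: "\<R> 0 h y < \<infinity>"
  shows "(\<lambda>n. \<P> (real n) (\<R> 0 h) y) \<longlonglongrightarrow> 0"
proof -
  let ?p = "\<lambda>t. \<P> t h y"
  have eq: "\<P> (real n) (\<R> 0 h) y = (\<integral>\<^sup>+t. ?p t * indicator {real n..} t \<partial>lborel)" for n
    using laplace_shift[of ?p "real n" 0] by (simp add: transition_resolvent[OF h])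
  have "(\<lambda>n. \<integral>\<^sup>+t. ?p t * indicator {real n..} t \<partial>lborel) \<longlonglongrightarrow> (\<integral>\<^sup>+t. 0 \<partial>(lborel :: real measure))"
  proof (rule nn_integral_dominated_convergence[where u'="\<lambda>_. 0" and w="\<lambda>t. ?p t * indicator {0..} t"])
    show "(\<integral>\<^sup>+t. ?p t * indicator {0..} t \<partial>lborel) < \<infinity>"
      using fin by (simp add: resolvent_eq_laplace[OF h] laplace_def)
    show "AE t in lborel. (\<lambda>n. ?p t * indicator {real n..} t) \<longlonglongrightarrow> 0"
    proof (intro AE_I2 tendsto_eventually)
      fix t :: real
      obtain N where "t < real N"
        using reals_Archimedean2 by blast
      then show "\<forall>\<^sub>F n in sequentially. ?p t * indicator {real n..} t = 0"
        by (intro eventually_sequentiallyI[of N]) (auto simp: indicator_def)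
    qed
  qed (auto simp: indicator_def)
  then show ?thesis
    by (simp add: eq)
qed

text \<open>The potential of \<open>v - P\<^sub>t v\<close> telescopes to \<open>\<integral>\<^bsub>0\<^esub>\<^bsup>t\<^esup> P\<^sub>s v ds\<close>, up to a limit at infinity which
  vanishes if \<open>v\<close> is dominated by a finite potential.\<close>

lemma resolvent_increment:
  assumes v[measurable]: "v \<in> borel_measurable borel" and v1: "\<And>x. v x \<le> 1"
    and super: "\<And>s x. 0 \<le> s \<Longrightarrow> \<P> s v x \<le> v x"
    and t: "0 < t"
  defines "a \<equiv> \<lambda>x. v x - \<P> t v x"
  shows "\<R> 0 a y \<le> ennreal t * v y"
    and "h \<in> borel_measurable borel \<Longrightarrow> (\<And>x. v x \<le> \<R> 0 h x) \<Longrightarrow> \<R> 0 h y < \<infinity> \<Longrightarrow>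
      ennreal t * \<P> t v y \<le> \<R> 0 a y"
proof -
  let ?p = "\<lambda>s. \<P> s v y"
  have a[measurable]: "a \<in> borel_measurable borel"
    unfolding a_def by measurable
  have p1: "?p s \<le> 1" for s
    by (rule transition_le_const[OF v1])
  have pfin: "?p s \<noteq> \<infinity>" for s
    using le_less_trans[OF p1 ennreal_one_less_top, of s] by simp
  have pa: "\<P> s a y + ?p (s + t) = ?p s" if s: "0 \<le> s" for s
  proof -
    have "\<P> s a y = ?p s - \<P> s (\<P> t v) y"
      unfolding a_def using t s super pfin[of "s + t"]
      by (intro transition_diff) (auto simp: transition_transition[OF v])
    also have "\<dots> = ?p s - ?p (s + t)"
      using s t by (simp add: transition_transition[OF v])
    finally show ?thesis
      using transition_decreasing[OF v super, of s "s + t" y] s t by (simp add: diff_add_cancel_ennreal)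
  qed
  define I where "I A = (\<integral>\<^sup>+s. ?p s * indicator A s \<partial>lborel)" for A
  have I_fin: "I {b..c} \<noteq> \<infinity>" if "b \<le> c" for b c
  proof -
    have "I {b..c} \<le> (\<integral>\<^sup>+s. indicator {b..c} s \<partial>lborel)"
      unfolding I_def using p1 by (intro nn_integral_mono) (auto simp: indicator_def)
    also have "\<dots> < \<infinity>"
      using that by simp
    finally show ?thesis by simp
  qed
  have I_split: "I {b..d} = I {b..c} + I {c..d}" if "b \<le> c" "c \<le> d" for b c d
  proof -
    have "I {b..d} = (\<integral>\<^sup>+s. ?p s * indicator {b..c} s + ?p s * indicator {c..d} s \<partial>lborel)"
      unfolding I_def
    proof (rule nn_integral_cong_AE)
      have "AE s in lborel. s \<noteq> c"
        by (rule AE_lborel_singleton)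
      then show "AE s in lborel. ?p s * indicator {b..d} s = ?p s * indicator {b..c} s + ?p s * indicator {c..d} s"
        by eventually_elim (use that in \<open>auto simp: indicator_def\<close>)
    qed
    then show ?thesis
      unfolding I_def by (simp add: nn_integral_add)
  qed
  have const: "(\<integral>\<^sup>+s. c * indicator {b..b + t} s \<partial>lborel) = ennreal t * c" for b c
    using t by (subst nn_integral_cmult) (auto simp: mult.commute)
  let ?J = "\<lambda>T. \<integral>\<^sup>+s. \<P> s a y * indicator {0..T} s \<partial>lborel"
  \<comment> \<open>The telescoping identity, kept additive because subtraction in
    \<open>ennreal\<close> is truncated. The common integral over \<open>{t..T + t}\<close> may be
    cancelled: it is finite as \<open>v \<le> 1\<close>.\<close>
  have J: "?J T + I {T..T + t} = I {0..t}" if T: "t \<le> T" for T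
  proof -
    have "?J T + I {t..T + t} = I {0..T}"
    proof -
      have "I {t..T + t} = (\<integral>\<^sup>+s. ?p (s + t) * indicator {0..T} s \<partial>lborel)"
        unfolding I_def using nn_integral_real_affine[of "\<lambda>s. ?p s * indicator {t..T + t} s" 1 t]
        by (auto simp: add.commute indicator_def intro!: nn_integral_cong)
      then have "?J T + I {t..T + t} = (\<integral>\<^sup>+s. \<P> s a y * indicator {0..T} s + ?p (s + t) * indicator {0..T} s \<partial>lborel)"
        by (simp add: nn_integral_add)
      also have "\<dots> = I {0..T}"
        unfolding I_def using pa by (intro nn_integral_cong) (auto simp: indicator_def)
      finally show ?thesis .
    qed
    then have "?J T + I {t..T + t} + I {T..T + t} = I {0..T} + I {T..T + t}"
      by simp
    also have "\<dots> = I {0..t} + I {t..T + t}"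
      using I_split[of 0 T "T + t"] I_split[of 0 t "T + t"] T t by simp
    finally have "I {t..T + t} + (?J T + I {T..T + t}) = I {t..T + t} + I {0..t}"
      by (simp add: ac_simps)
    then show ?thesis
      using I_fin[of t "T + t"] T t by (subst (asm) ennreal_add_left_cancel) auto
  qed
  have R: "\<R> 0 a y = (SUP n. ?J (real n))"
  proof -
    have "(SUP n. ?J (real n)) = (\<integral>\<^sup>+s. (SUP n. \<P> s a y * indicator {0..real n} s) \<partial>lborel)"
      by (intro nn_integral_monotone_convergence_SUP[symmetric])
        (auto simp: incseq_def le_fun_def indicator_def)
    also have "\<dots> = \<R> 0 a y"
      unfolding resolvent_eq_laplace[OF a] laplace_def
    proof (intro nn_integral_cong)
      fix s :: real
      have "(SUP n. indicator {0..real n} s :: ennreal) = indicator (\<Union>n. {0..real n}) s"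
        using fun_cong[OF SUP_indicator_UN[of "\<lambda>n. {0..real n}"], of s] .
      also have "(\<Union>n. {0..real n}) = {0..}"
        using real_arch_simple by auto
      finally show "(SUP n. \<P> s a y * indicator {0..real n} s)
          = ennreal (exp (- 0 * s)) * \<P> s a y * indicator {0..} s"
        by (simp add: SUP_mult_left_ennreal[symmetric])
    qed
    finally show ?thesis ..
  qed
  have J_le: "?J T \<le> I {0..t}" for T
  proof -
    have "?J T \<le> ?J (max t T)"
      by (intro nn_integral_mono) (auto simp: indicator_def)
    also have "\<dots> \<le> ?J (max t T) + I {max t T..max t T + t}"
      by simp
    also have "\<dots> = I {0..t}"
      by (rule J) simp
    finally show ?thesis .
  qed
  have "I {0..t} \<le> (\<integral>\<^sup>+s. v y * indicator {0..t} s \<partial>lborel)"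
    unfolding I_def using super by (intro nn_integral_mono) (auto simp: indicator_def)
  also have "\<dots> = ennreal t * v y"
    using const[of "v y" 0] by simp
  finally show "\<R> 0 a y \<le> ennreal t * v y"
    unfolding R using J_le by (intro SUP_least) (rule order_trans)
  assume h: "h \<in> borel_measurable borel" and dom: "\<And>x. v x \<le> \<R> 0 h x" and fin: "\<R> 0 h y < \<infinity>"
  have "ennreal t * ?p t = (\<integral>\<^sup>+s. ?p t * indicator {0..t} s \<partial>lborel)"
    using const[of "?p t" 0] by simp
  also have "\<dots> \<le> I {0..t}"
    unfolding I_def using transition_decreasing[OF v super, of _ t y] by (intro nn_integral_mono) (auto simp: indicator_def)
  finally have lower: "ennreal t * ?p t \<le> I {0..t}" .
  have tail: "I {0..t} \<le> \<R> 0 a y + ennreal t * \<P> (real n) (\<R> 0 h) y"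
    if n: "t \<le> real n" for n
  proof -
    have "I {real n..real n + t} \<le> (\<integral>\<^sup>+s. ?p (real n) * indicator {real n..real n + t} s \<partial>lborel)"
      unfolding I_def using transition_decreasing[OF v super, of "real n" _ y] by (intro nn_integral_mono) (auto simp: indicator_def)
    also have "\<dots> = ennreal t * ?p (real n)"
      by (rule const)
    also have "\<dots> \<le> ennreal t * \<P> (real n) (\<R> 0 h) y"
      by (intro mult_left_mono transition_mono dom) simp
    finally have "I {real n..real n + t} \<le> ennreal t * \<P> (real n) (\<R> 0 h) y" .
    moreover have "?J (real n) \<le> \<R> 0 a y"
      unfolding R by (rule SUP_upper) simp
    ultimately show ?thesis
      unfolding J[OF n, symmetric] by (rule add_mono[rotated])
  qed
  have "(\<lambda>n. \<R> 0 a y + ennreal t * \<P> (real n) (\<R> 0 h) y)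
     \<longlonglongrightarrow> \<R> 0 a y + ennreal t * 0"
    by (intro tendsto_add tendsto_const ennreal_tendsto_cmult transition_resolvent_tendsto_0[OF h fin]) simp
  then have "I {0..t} \<le> \<R> 0 a y + ennreal t * 0"
  proof (rule LIMSEQ_le_const)
    obtain N where "t \<le> real N"
      using real_arch_simple by blast
    then show "\<exists>N. \<forall>n\<ge>N. I {0..t} \<le> \<R> 0 a y + ennreal t * \<P> (real n) (\<R> 0 h) y"
      using tail by (intro exI[of _ N]) auto
  qed
  with lower show "ennreal t * ?p t \<le> \<R> 0 a y"
    by simp
qed

text \<open>The two bounds of \<open>resolvent_increment\<close> are used on opposite sides of the
  duality: the upper one everywhere under \<open>\<sigma>\<close>, the lower one under
  \<open>\<nu>\<close>, where the potential of \<open>h\<close> is finite almost everywhere.\<close>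

lemma potential_domination:
  assumes \<sigma>: "sets \<sigma> = sets borel" "sigma_finite_measure \<sigma>" and \<nu>: "sets \<nu> = sets borel" "sigma_finite_measure \<nu>"
    and dom: "AE x in m. (\<integral>\<^sup>+y. r 0 x y \<partial>\<nu>) \<le> (\<integral>\<^sup>+y. r 0 x y \<partial>\<sigma>)"
    and h: "h \<in> borel_measurable borel" and fin: "(\<integral>\<^sup>+x. \<R> 0 h x \<partial>\<nu>) < \<infinity>"
    and v: "v \<in> borel_measurable borel" "\<And>x. v x \<le> 1" "\<And>x. v x \<le> \<R> 0 h x"
      "\<And>s x. 0 \<le> s \<Longrightarrow> \<P> s v x \<le> v x"
    and t: "0 < t"
  shows "(\<integral>\<^sup>+x. \<P> t v x \<partial>\<nu>) \<le> (\<integral>\<^sup>+x. v x \<partial>\<sigma>)"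
proof -
  note [measurable_cong] = \<sigma>(1) \<nu>(1)
  note [measurable] = h v(1)
  define a where "a x = v x - \<P> t v x" for x
  have [measurable]: "a \<in> borel_measurable borel"
    unfolding a_def[abs_def] by measurable
  have "AE x in \<nu>. \<R> 0 h x \<noteq> \<infinity>"
    using fin by (intro nn_integral_noteq_infinite) auto
  then have "AE x in \<nu>. ennreal t * \<P> t v x \<le> \<R> 0 a x"
    by eventually_elim
      (use resolvent_increment(2)[OF v(1,2,4) t h v(3)] in \<open>simp add: a_def[abs_def] top.not_eq_extremum\<close>)
  then have "(\<integral>\<^sup>+x. ennreal t * \<P> t v x \<partial>\<nu>) \<le> (\<integral>\<^sup>+x. \<R> 0 a x \<partial>\<nu>)"
    by (rule nn_integral_mono_AE)
  also have "\<dots> = (\<integral>\<^sup>+x. a x * (\<integral>\<^sup>+y. r 0 x y \<partial>\<nu>) \<partial>m)"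
    by (rule Fubini_kernel[OF order_refl \<nu>]) measurable
  also have "\<dots> \<le> (\<integral>\<^sup>+x. a x * (\<integral>\<^sup>+y. r 0 x y \<partial>\<sigma>) \<partial>m)"
    using dom by (intro nn_integral_mono_AE, eventually_elim) (rule mult_left_mono, auto)
  also have "\<dots> = (\<integral>\<^sup>+x. \<R> 0 a x \<partial>\<sigma>)"
    by (rule Fubini_kernel[OF order_refl \<sigma>, symmetric]) measurable
  also have "\<dots> \<le> (\<integral>\<^sup>+x. ennreal t * v x \<partial>\<sigma>)"
    using resolvent_increment(1)[OF v(1,2,4) t] by (intro nn_integral_mono) (simp add: a_def[abs_def])
  finally have "ennreal t * (\<integral>\<^sup>+x. \<P> t v x \<partial>\<nu>) \<le> ennreal t * (\<integral>\<^sup>+x. v x \<partial>\<sigma>)"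
    by (simp add: nn_integral_cmult)
  then have "ennreal (1 / t) * (ennreal t * (\<integral>\<^sup>+x. \<P> t v x \<partial>\<nu>)) \<le> ennreal (1 / t) * (ennreal t * (\<integral>\<^sup>+x. v x \<partial>\<sigma>))"
    by (rule mult_left_mono) simp
  moreover have cancel: "ennreal (1 / t) * ennreal t = 1"
    using t by (subst ennreal_mult[symmetric]) auto
  ultimately show ?thesis
    unfolding mult.assoc[symmetric] cancel mult_1_left by simp
qed

section \<open>The inverse maximum principle\<close>

text \<open>A Borel-Cantelli argument: energies below \<open>(1 / 4) ^ j\<close> give weighted
  integrals below \<open>(1 / 2) ^ j\<close>, whose sum converges, so the series of hitting
  probabilities converges almost everywhere.\<close>

lemma hitting_sequence_AE_tendsto_0:
  assumes U: "\<And>j::nat. open (U j)" and \<psi>: "\<And>j. \<psi> j \<in> D" "\<And>j. AE x in m. indicator (U j) x \<le> \<psi> j x"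
    "\<And>j. \<E> (\<psi> j) (\<psi> j) < (1 / 4) ^ j"
  shows "AE x in m. (\<lambda>j. hitting (U j) 0 x) \<longlonglongrightarrow> 0"
proof -
  obtain g where g: "g \<in> borel_measurable m" "\<And>x. 0 < g x"
    and trans: "\<And>u. u \<in> D \<Longrightarrow> (\<integral>\<^sup>+x. ennreal (\<bar>u x\<bar> * g x) \<partial>m) \<le> ennreal (sqrt (\<E> u u))"
    using transient unfolding transient_form_def by auto
  note [measurable] = g(1) borel_measurable_hitting[OF U]
  have "(\<integral>\<^sup>+x. (\<Sum>j. hitting (U j) 0 x * ennreal (g x)) \<partial>m) = (\<Sum>j. \<integral>\<^sup>+x. hitting (U j) 0 x * ennreal (g x) \<partial>m)"
    by (rule nn_integral_suminf) measurable
  also have "\<dots> \<le> (\<Sum>j. ennreal ((1 / 2) ^ j))"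
  proof (intro suminf_le summableI)
    fix j
    have "(\<integral>\<^sup>+x. hitting (U j) 0 x * ennreal (g x) \<partial>m) \<le> ennreal (sqrt (\<E> (\<psi> j) (\<psi> j)))"
      by (rule hitting_integral_le[OF U \<psi>(1,2) g trans])
    also have "\<dots> \<le> ennreal ((1 / 2) ^ j)"
    proof (intro ennreal_leI real_le_lsqrt)
      have "((1 / 2 :: real) ^ j)\<^sup>2 = (1 / 4) ^ j"
        by (simp add: power_mult_distrib[symmetric] power2_eq_square)
      then show "\<E> (\<psi> j) (\<psi> j) \<le> ((1 / 2) ^ j)\<^sup>2"
        using \<psi>(3)[of j] by simp
    qed simp
    finally show "(\<integral>\<^sup>+x. hitting (U j) 0 x * ennreal (g x) \<partial>m) \<le> ennreal ((1 / 2) ^ j)" .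
  qed
  also have "\<dots> = ennreal (\<Sum>j. (1 / 2) ^ j)"
    by (rule suminf_ennreal2) (auto intro: summable_geometric)
  also have "\<dots> < \<infinity>"
    by simp
  finally have "AE x in m. (\<Sum>j. hitting (U j) 0 x * ennreal (g x)) \<noteq> \<infinity>"
    by (intro nn_integral_noteq_infinite) auto
  then show ?thesis
  proof eventually_elim
    case (elim x)
    define c where "c j = enn2real (hitting (U j) 0 x)" for j
    have c: "hitting (U j) 0 x = ennreal (c j)" for j
      using le_less_trans[OF hitting_le_1 ennreal_one_less_top, of "U j" 0 x] by (simp add: c_def)
    have c0: "0 \<le> c j" for j
      by (simp add: c_def)
    have "(\<Sum>j. ennreal (c j * g x)) \<noteq> top"
      using elim g(2)[of x] c0 by (simp add: c ennreal_mult)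
    then have "summable (\<lambda>j. c j * g x)"
      using g(2)[of x] c0 by (intro summable_suminf_not_top) auto
    then have "(\<lambda>j. c j * g x * (1 / g x)) \<longlonglongrightarrow> 0 * (1 / g x)"
      by (intro tendsto_mult tendsto_const summable_LIMSEQ_zero)
    then have "c \<longlonglongrightarrow> 0"
      using g(2)[of x] by simp
    then have "(\<lambda>j. ennreal (c j)) \<longlonglongrightarrow> ennreal 0"
      by (rule tendsto_ennrealI)
    then show ?case
      by (simp add: c)
  qed
qed

text \<open>Why the limit is zero at every point and not only almost everywhere: started outside
  the closure of \<open>V\<close> the process avoids \<open>V\<close> for a short time, and for almost every \<open>t\<close> its law at time
  \<open>t\<close> does not charge \<open>m\<close>-null sets.\<close>

lemma hitting_sequence_tendsto_0:
  assumes U: "\<And>j::nat. open (U j)" and V: "\<And>j. open (V j)" "\<And>j. U j \<subseteq> V j" "decseq V"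
    and ae: "AE x in m. (\<lambda>j. hitting (U j) 0 x) \<longlonglongrightarrow> 0"
    and y: "y \<notin> closure (V i)"
  shows "(\<lambda>j. hitting (U j) 0 y) \<longlonglongrightarrow> 0"
proof -
  note [measurable] = borel_measurable_hitting[OF U]
  define f where "f x = limsup (\<lambda>j. hitting (U j) 0 x)" for x
  have [measurable]: "f \<in> borel_measurable borel"
    unfolding f_def[abs_def] by measurable
  have "AE x in m. f x = 0"
    using ae unfolding f_def by eventually_elim (rule lim_imp_Limsup[OF sequentially_bot])
  then have "laplace 0 (\<lambda>t. \<P> t f y) = 0"
    using resolvent_AE_zero[of f y] by (simp add: resolvent_eq_laplace)
  then have ae_t: "AE t in lborel. \<P> t f y * indicator {0..} t = 0"
    unfolding laplace_def by (subst (asm) nn_integral_0_iff_AE) auto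
  let ?early = "\<lambda>n. emeasure (P (Some y)) (early_event (V i) (1 / real (Suc n)))"
  have "limsup (\<lambda>j. hitting (U j) 0 y) \<le> ?early n" for n
  proof -
    \<comment> \<open>The potential of the null function \<open>f\<close> vanishes at
      \<open>y\<close>, so almost every time is admissible, and the interval has positive
      length.\<close>
    obtain t where t: "0 < t" "t < 1 / real (Suc n)" "\<P> t f y = 0"
    proof -
      have "\<not> (AE t in lborel. t \<notin> {0<..<1 / real (Suc n)})"
      proof
        assume "AE t in lborel. t \<notin> {0<..<1 / real (Suc n)}"
        then have "{0<..<1 / real (Suc n)} \<in> null_sets lborel"
          by (subst AE_iff_null_sets) auto
        then have "ennreal (1 / real (Suc n) - 0) = 0"
          using emeasure_lborel_Ioo[of 0 "1 / real (Suc n)"] by (simp add: null_sets_def del: of_nat_Suc)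
        then show False
          by (simp add: ennreal_eq_0_iff del: of_nat_Suc)
      qed
      note not_AE = this
      have "\<exists>t\<in>{0<..<1 / real (Suc n)}. \<P> t f y * indicator {0..} t = 0"
      proof (rule ccontr)
        assume none: "\<not> (\<exists>t\<in>{0<..<1 / real (Suc n)}. \<P> t f y * indicator {0..} t = 0)"
        have "AE t in lborel. t \<notin> {0<..<1 / real (Suc n)}"
          using ae_t by eventually_elim (use none in blast)
        with not_AE show False ..
      qed
      then show ?thesis
        using that by (auto simp: indicator_def)
    qed
    have "limsup (\<lambda>j. hitting (U j) t y) = limsup (\<lambda>j. \<P> t (hitting (U j) 0) y)"
      using t(1) by (simp add: transition_hitting[OF U])
    also have "\<dots> \<le> (\<integral>\<^sup>+\<omega>. limsup (\<lambda>j. case_option 0 (hitting (U j) 0) (X (ennreal t) \<omega>)) \<partial>P (Some y))"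
      unfolding transition_def
    proof (rule nn_integral_limsup[where w="\<lambda>_. 1"])
      show "(\<integral>\<^sup>+\<omega>. 1 \<partial>P (Some y)) < \<infinity>"
        by simp
    qed (auto simp: hitting_le_1 split: option.split)
    also have "\<dots> = \<P> t f y"
      unfolding transition_def f_def by (intro nn_integral_cong) (auto simp: Limsup_const split: option.split)
    finally have lim: "limsup (\<lambda>j. hitting (U j) t y) = 0"
      using t(3) by simp
    have "limsup (\<lambda>j. hitting (U j) 0 y) \<le> limsup (\<lambda>j. ?early n + hitting (U j) t y)"
    proof (rule Limsup_mono)
      show "\<forall>\<^sub>F j in sequentially. hitting (U j) 0 y \<le> ?early n + hitting (U j) t y"
        using eventually_ge_at_top[of i]
      proof eventually_elim
        case (elim j)
        \<comment> \<open>\<open>V\<close> decreases, so the neighbourhood whose closure misses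
          \<open>y\<close> contains all later \<open>U j\<close>, and the bound for early visits
          does not depend on \<open>j\<close>.\<close>
        have "U j \<subseteq> V i"
          using V(2)[of j] decseqD[OF V(3) elim] by auto
        then have "hitting (U j) 0 y \<le> emeasure (P (Some y)) (early_event (V i) t) + hitting (U j) t y"
          using t(1) by (intro hitting_split U V(1)) auto
        also have "emeasure (P (Some y)) (early_event (V i) t) \<le> ?early n"
        proof (rule emeasure_mono)
          show "early_event (V i) t \<subseteq> early_event (V i) (1 / real (Suc n))"
            using t(2) by (intro Collect_mono) (metis less_trans)
        qed (simp add: sets_early_event[OF V(1)])
        finally show ?case
          by (simp add: add_right_mono)
      qed
    qed
    also have "\<dots> = ?early n + 0"
      by (rule lim_imp_Limsup[OF sequentially_bot tendsto_add[OF tendsto_const tendsto_0_if_Limsup_eq_0_ennreal[OF lim]]])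
    finally show ?thesis
      by simp
  qed
  then have "limsup (\<lambda>j. hitting (U j) 0 y) \<le> 0"
    using early_event_tendsto[OF V(1) y] by (intro LIMSEQ_le_const) auto
  then show ?thesis
    by (intro tendsto_0_if_Limsup_eq_0_ennreal) simp
qed

text \<open>\<open>U j\<close> intersects a set of small capacity with a metric neighbourhood of
  \<open>K\<close>. The first gives convergence almost everywhere, where the competitor for the
  larger set remains admissible; the second separates \<open>U j\<close> from a given point off
  \<open>K\<close>. The empty set is treated apart since \<open>infdist\<close> to it is
  \<open>0\<close>.\<close>

lemma neighbourhood_sequence:
  assumes K: "closed K" and cap: "capacity m D \<E> K = 0"
  obtains U :: "nat \<Rightarrow> 'a set" where "\<And>j. open (U j)" "\<And>j. K \<subseteq> U j"
    "\<And>y. y \<notin> K \<Longrightarrow> (\<lambda>j. hitting (U j) 0 y) \<longlonglongrightarrow> 0"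
proof (cases "K = {}")
  case True
  have "hitting {} 0 y = 0" for y
    by (simp add: hitting_def)
  then show ?thesis
    using True by (intro that[of "\<lambda>_. {}"]) auto
next
  case False
  define V where "V j = {x. infdist x K < 1 / real (Suc j)}" for j
  have V: "open (V j)" "K \<subseteq> V j" for j
    unfolding V_def by (auto intro!: open_Collect_less continuous_intros)
  have "decseq V"
  proof (rule decseq_SucI)
    fix j
    have "1 / real (Suc (Suc j)) \<le> 1 / real (Suc j)"
      by (intro divide_left_mono) auto
    then show "V (Suc j) \<subseteq> V j"
      unfolding V_def by (intro Collect_mono) (metis less_le_trans)
  qed
  define Q where "Q j p \<longleftrightarrow> open (fst p) \<and> K \<subseteq> fst p \<and> snd p \<in> D \<and>
      (AE x in m. indicator (fst p) x \<le> snd p x) \<and> \<E> (snd p) (snd p) < (1 / 4) ^ j"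
    for j :: nat and p :: "'a set \<times> ('a \<Rightarrow> real)"
  have "\<exists>p. Q j p" for j
  proof -
    have "0 < (1 / 4 :: real) ^ j" by simp
    from capacity_zero_open[OF cap this]
    obtain W \<psi> where "open W" "K \<subseteq> W" "\<psi> \<in> D" "AE x in m. indicator W x \<le> \<psi> x" "\<E> \<psi> \<psi> < (1 / 4) ^ j"
      by blast
    then have "Q j (W, \<psi>)"
      by (simp add: Q_def)
    then show ?thesis ..
  qed
  then obtain p where p: "\<And>j. Q j (p j)"
    by metis
  define W where "W j = fst (p j)" for j
  define \<psi> where "\<psi> j = snd (p j)" for j
  have W: "open (W j)" "K \<subseteq> W j" and \<psi>: "\<psi> j \<in> D" "AE x in m. indicator (W j) x \<le> \<psi> j x"
      "\<E> (\<psi> j) (\<psi> j) < (1 / 4) ^ j" for j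
    using p[of j] by (simp_all add: Q_def W_def \<psi>_def)
  define U where "U j = W j \<inter> V j" for j
  have U: "open (U j)" "K \<subseteq> U j" "U j \<subseteq> V j" for j
    using W V by (auto simp: U_def)
  have "AE x in m. indicator (U j) x \<le> \<psi> j x" for j
    using \<psi>(2)[of j]
  proof eventually_elim
    case (elim x)
    have "indicator (U j) x \<le> (indicator (W j) x :: real)"
      by (auto simp: U_def indicator_def)
    then show ?case
      using elim by simp
  qed
  then have ae: "AE x in m. (\<lambda>j. hitting (U j) 0 x) \<longlonglongrightarrow> 0"
    by (intro hitting_sequence_AE_tendsto_0[OF U(1) \<psi>(1) _ \<psi>(3)])
  have "(\<lambda>j. hitting (U j) 0 y) \<longlonglongrightarrow> 0" if y: "y \<notin> K" for y
  proof -
    have "0 < infdist y K"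
      using y K False in_closed_iff_infdist_zero[of K y] infdist_nonneg[of y K] by force
    then obtain i where i: "1 / real (Suc i) < infdist y K"
      by (rule nat_approx_posE)
    have "closure (V i) \<subseteq> {x. infdist x K \<le> 1 / real (Suc i)}"
      by (intro closure_minimal closed_Collect_le continuous_intros) (auto simp: V_def)
    then have "y \<notin> closure (V i)"
      using i by auto
    then show ?thesis
      by (rule hitting_sequence_tendsto_0[OF U(1) V(1) U(3) \<open>decseq V\<close> ae])
  qed
  with U show ?thesis
    by (intro that[of U])
qed

text \<open>Dividing an integrable positive density by \<open>1\<close> plus the potential of
  \<open>\<tau>\<close> keeps it integrable against that potential, and duality turns this into
  integrability of the potential of \<open>h\<close> under \<open>\<tau>\<close>. Where the
  potential of \<open>\<tau>\<close> is infinite, \<open>h\<close> is zero, hence positivity only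
  almost everywhere.\<close>

lemma potential_charge_pos:
  assumes \<tau>: "sets \<tau> = sets borel" and fin: "AE x in m. (\<integral>\<^sup>+y. r 0 x y \<partial>\<tau>) < \<infinity>"
  obtains h where "h \<in> borel_measurable borel" "AE x in m. 0 < h x" "(\<integral>\<^sup>+x. \<R> 0 h x \<partial>\<tau>) < \<infinity>"
proof -
  interpret m: sigma_finite_measure m by (rule sigma_finite_m)
  have sf: "sigma_finite_measure \<tau>"
    by (rule sigma_finite_of_potential[OF \<tau> fin])
  interpret \<tau>: sigma_finite_measure \<tau> by (rule sf)
  note [measurable_cong] = \<tau>
  obtain \<rho> where \<rho>: "\<rho> \<in> borel_measurable m" "\<And>x. 0 < (\<rho> x :: real)" "integrable m \<rho>"
    using m.obtain_positive_integrable_function by metis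
  have [measurable]: "(\<lambda>p. r 0 (fst p) (snd p)) \<in> borel_measurable (borel \<Otimes>\<^sub>M borel)"
    by (rule borel_measurable_kernel) simp
  have "(\<lambda>x. \<integral>\<^sup>+y. r 0 x y \<partial>\<tau>) \<in> borel_measurable borel"
    by (intro \<tau>.borel_measurable_nn_integral) (unfold case_prod_beta', measurable)
  then have [measurable]: "(\<lambda>x. \<integral>\<^sup>+y. r 0 x y \<partial>\<tau>) \<in> borel_measurable m"
    by (simp cong: measurable_cong_sets)
  note [measurable] = \<rho>(1)
  define h where "h x = ennreal (\<rho> x) / (1 + (\<integral>\<^sup>+y. r 0 x y \<partial>\<tau>))" for x
  have "h \<in> borel_measurable m"
    unfolding h_def[abs_def] by measurable
  then have h: "h \<in> borel_measurable borel"
    by (simp cong: measurable_cong_sets)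
  have pos: "AE x in m. 0 < h x"
    using fin
  proof eventually_elim
    case (elim x)
    then show ?case
      using \<rho>(2)[of x] by (simp add: h_def ennreal_zero_less_divide)
  qed
  have le: "h x * (\<integral>\<^sup>+y. r 0 x y \<partial>\<tau>) \<le> ennreal (\<rho> x)" for x
  proof -
    let ?R = "\<integral>\<^sup>+y. r 0 x y \<partial>\<tau>"
    have "?R / (1 + ?R) \<le> 1"
      by (rule divide_le_posI_ennreal) (auto simp: add_pos_nonneg add_increasing)
    then have "ennreal (\<rho> x) * (?R / (1 + ?R)) \<le> ennreal (\<rho> x) * 1"
      by (rule mult_left_mono) simp
    then show ?thesis
      by (simp add: h_def ennreal_times_divide ennreal_divide_times)
  qed
  have "(\<integral>\<^sup>+x. \<R> 0 h x \<partial>\<tau>) = (\<integral>\<^sup>+x. h x * (\<integral>\<^sup>+y. r 0 x y \<partial>\<tau>) \<partial>m)"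
    by (rule Fubini_kernel[OF order_refl \<tau> sf h])
  also have "\<dots> \<le> (\<integral>\<^sup>+x. ennreal (\<rho> x) \<partial>m)"
    by (intro nn_integral_mono le)
  also have "\<dots> < \<infinity>"
    using \<rho>(2,3) by (simp add: integrable_iff_bounded less_imp_le)
  finally show ?thesis
    using that h pos by blast
qed

lemma polar_domination:
  assumes \<sigma>: "sets \<sigma> = sets borel" "sigma_finite_measure \<sigma>" and \<nu>: "sets \<nu> = sets borel" "sigma_finite_measure \<nu>"
    and dom: "AE x in m. (\<integral>\<^sup>+y. r 0 x y \<partial>\<nu>) \<le> (\<integral>\<^sup>+y. r 0 x y \<partial>\<sigma>)"
    and h: "h \<in> borel_measurable borel" "AE x in m. 0 < h x"
    and fin: "(\<integral>\<^sup>+x. \<R> 0 h x \<partial>\<nu>) < \<infinity>" "(\<integral>\<^sup>+x. \<R> 0 h x \<partial>\<sigma>) < \<infinity>"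
    and K: "closed K" "capacity m D \<E> K = 0" "emeasure \<sigma> K = 0"
  shows "emeasure \<nu> K = 0"
proof -
  note [measurable_cong] = \<sigma>(1) \<nu>(1)
  note [measurable] = h(1)
  have [measurable]: "K \<in> sets borel"
    using K(1) by simp
  obtain U :: "nat \<Rightarrow> 'a set" where U: "\<And>j. open (U j)" "\<And>j. K \<subseteq> U j"
      and lim: "\<And>y. y \<notin> K \<Longrightarrow> (\<lambda>j. hitting (U j) 0 y) \<longlonglongrightarrow> 0"
    using neighbourhood_sequence[OF K(1,2)] by blast
  note [measurable] = borel_measurable_hitting[OF U(1)]
  let ?R = "\<R> 0 h"
  let ?t = "\<lambda>n. 1 / real (Suc n)"
  define v where "v j x = min (hitting (U j) 0 x) (?R x)" for j x
  \<comment> \<open>The value of \<open>v j\<close> where the hitting probability is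
    \<open>1\<close>, in particular on \<open>U j\<close>; it does not depend on
    \<open>j\<close>.\<close>
  define q where "q x = min 1 (?R x)" for x
  have v_meas[measurable]: "v j \<in> borel_measurable borel" for j
    unfolding v_def[abs_def] by measurable
  have q_meas[measurable]: "q \<in> borel_measurable borel"
    unfolding q_def[abs_def] by measurable
  have v_super: "\<P> s (v j) x \<le> v j x" if s: "0 \<le> s" for j s x
  proof -
    have "\<P> s (v j) x \<le> \<P> s (hitting (U j) 0) x"
      by (intro transition_mono) (simp add: v_def)
    also have "\<dots> \<le> hitting (U j) 0 x"
      using s by (simp add: transition_hitting U(1) hitting_antimono)
    finally have 1: "\<P> s (v j) x \<le> hitting (U j) 0 x" .
    have "\<P> s (v j) x \<le> \<P> s ?R x"
      by (intro transition_mono) (simp add: v_def)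
    also have "\<dots> \<le> ?R x"
      using s by (intro resolvent_0_supermedian h(1))
    finally show ?thesis
      using 1 by (simp add: v_def)
  qed
  have q_super: "\<P> s q x \<le> q x" if s: "0 \<le> s" for s x
  proof -
    have "\<P> s q x \<le> 1"
      by (intro transition_le_const) (simp add: q_def)
    moreover have "\<P> s q x \<le> \<P> s ?R x"
      by (intro transition_mono) (simp add: q_def)
    then have "\<P> s q x \<le> ?R x"
      using resolvent_0_supermedian[OF h(1) s, of x] by (rule order_trans)
    ultimately show ?thesis
      by (simp add: q_def)
  qed
  have t_pos: "0 < ?t n" for n
    by simp
  have t_dec: "?t (Suc n) \<le> ?t n" for n
    by (intro divide_left_mono) auto
  have t_lim: "?t \<longlonglongrightarrow> 0"
    using LIMSEQ_inverse_real_of_nat by (simp add: inverse_eq_divide del: of_nat_Suc)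
  have inc: "incseq (\<lambda>n. \<P> (?t n) w x)"
    if "w \<in> borel_measurable borel" "\<And>s x. 0 \<le> s \<Longrightarrow> \<P> s w x \<le> w x" for w x
    by (intro incseq_SucI transition_decreasing[OF that(1) that(2) less_imp_le[OF t_pos] t_dec])
  \<comment> \<open>The excessive regularization of \<open>q\<close>: the limit of
    \<open>\<P> t q\<close> as \<open>t\<close> decreases to zero. It is the lower bound on
    \<open>K\<close> that survives the limit in \<open>j\<close>.\<close>
  define q' where "q' x = (SUP n. \<P> (?t n) q x)" for x
  have q'_meas[measurable]: "q' \<in> borel_measurable borel"
    unfolding q'_def[abs_def] by measurable
  \<comment> \<open>If \<open>\<P> s q x\<close> vanished for all \<open>s > 0\<close>, so would the
    potential of \<open>q\<close> at \<open>x\<close>, against \<open>resolvent_pos\<close>;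
    monotonicity in time moves a good \<open>s\<close> to the times \<open>?t n\<close>.\<close>
  have q'_pos: "0 < q' x" for x
  proof -
    have "AE x in m. 0 < q x"
      using resolvent_pos[OF h] by (simp add: q_def)
    then have "0 < \<R> 0 q x"
      by (rule resolvent_pos[OF q_meas])
    have "\<exists>s>0. 0 < \<P> s q x"
    proof (rule ccontr)
      assume none: "\<not> (\<exists>s>0. 0 < \<P> s q x)"
      have "AE s in lborel. s \<noteq> (0::real)"
        by (rule AE_lborel_singleton)
      then have "AE s in lborel. ennreal (exp (- 0 * s)) * \<P> s q x * indicator {0..} s = 0"
        by eventually_elim (use none in \<open>auto simp: indicator_def not_gr_zero\<close>)
      then have "\<R> 0 q x = 0"
        unfolding resolvent_eq_laplace[OF q_meas] laplace_def by (subst nn_integral_0_iff_AE) auto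
      with \<open>0 < \<R> 0 q x\<close> show False
        by simp
    qed
    then obtain s where s: "0 < s" "0 < \<P> s q x"
      by blast
    obtain n where "?t n < s"
      by (rule nat_approx_posE[OF s(1)])
    then have "\<P> s q x \<le> \<P> (?t n) q x"
      by (intro transition_decreasing[OF q_meas q_super]) auto
    also have "\<dots> \<le> q' x"
      unfolding q'_def by (rule SUP_upper) simp
    finally show ?thesis
      using s(2) by simp
  qed
  have q'_le: "q' x \<le> (SUP n. \<P> (?t n) (v j) x)" if x: "x \<in> K" for x j
  proof -
    let ?S = "SUP n. \<P> (?t n) (v j) x"
    have Ux: "x \<in> U j"
      using U(2) x by auto
    have U_meas[measurable]: "U j \<in> sets borel"
      using U(1) by simp
    \<comment> \<open>The error off \<open>U j\<close> is at most \<open>1\<close>, and its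
      transition probability from a point of the open set \<open>U j\<close> vanishes as time tends
      to zero.\<close>
    have "q z \<le> v j z + indicator (- U j) z" for z
    proof (cases "z \<in> U j")
      case True
      then have "1 \<le> hitting (U j) 0 z"
        using hitting_ge_indicator[OF U(1), of j z] by simp
      then have "q z \<le> v j z"
        unfolding q_def v_def by (intro min.mono) auto
      then show ?thesis
        using True by simp
    next
      case False
      have "q z \<le> 1"
        by (simp add: q_def)
      then show ?thesis
        using False by (simp add: add_increasing)
    qed
    then have step: "\<P> (?t n) q x \<le> \<P> (?t n) (v j) x + \<P> (?t n) (indicator (- U j)) x" for n
      by (subst transition_add[symmetric]) (auto intro!: transition_mono)
    have le: "\<P> (?t n) (v j) x \<le> ?S" for n
      by (rule SUP_upper) simp
    have bound: "\<P> (?t n) q x \<le> ?S + \<P> (?t n) (indicator (- U j)) x" for n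
      by (rule order_trans[OF step add_right_mono[OF le]])
    have "(\<lambda>n. \<P> (?t n) (indicator (- U j)) x) \<longlonglongrightarrow> 0"
    proof (rule tendsto_sandwich[OF _ _ tendsto_const])
      have "\<P> s (indicator (U j)) x + \<P> s (indicator (- U j)) x \<le> 1" for s
        by (subst transition_add[symmetric]) (auto intro!: transition_le_const simp: indicator_def)
      then have "\<P> s (indicator (- U j)) x \<le> 1 - \<P> s (indicator (U j)) x" for s
        by (intro ennreal_le_minus_iff[THEN iffD2]) (simp add: add.commute)
      then show "\<forall>\<^sub>F n in sequentially. \<P> (?t n) (indicator (- U j)) x \<le> 1 - \<P> (?t n) (indicator (U j)) x"
        by (intro always_eventually allI)
      have "(\<lambda>n. 1 - \<P> (?t n) (indicator (U j)) x) \<longlonglongrightarrow> 1 - 1"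
        by (intro tendsto_diff_ennreal tendsto_const transition_open_tendsto U(1) Ux t_lim t_pos) simp_all
      then show "(\<lambda>n. 1 - \<P> (?t n) (indicator (U j)) x) \<longlonglongrightarrow> 0"
        by simp
    qed auto
    then have S_lim: "(\<lambda>n. ?S + \<P> (?t n) (indicator (- U j)) x) \<longlonglongrightarrow> ?S + 0"
      by (intro tendsto_add tendsto_const)
    have q_lim: "(\<lambda>n. \<P> (?t n) q x) \<longlonglongrightarrow> q' x"
      unfolding q'_def by (intro LIMSEQ_SUP inc q_meas q_super)
    have "q' x \<le> ?S + 0"
      by (rule LIMSEQ_le[OF q_lim S_lim]) (intro exI[of _ 0] allI impI bound)
    then show ?thesis
      by simp
  qed
  have main: "(\<integral>\<^sup>+x. indicator K x * q' x \<partial>\<nu>) \<le> (\<integral>\<^sup>+x. v j x \<partial>\<sigma>)" for j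
  proof -
    have "(\<integral>\<^sup>+x. indicator K x * q' x \<partial>\<nu>) \<le> (\<integral>\<^sup>+x. (SUP n. \<P> (?t n) (v j) x) \<partial>\<nu>)"
      using q'_le by (intro nn_integral_mono) (auto simp: indicator_def)
    also have "\<dots> = (SUP n. \<integral>\<^sup>+x. \<P> (?t n) (v j) x \<partial>\<nu>)"
      using inc[OF v_meas v_super]
      by (intro nn_integral_monotone_convergence_SUP) (auto simp: incseq_def le_fun_def)
    also have "\<dots> \<le> (\<integral>\<^sup>+x. v j x \<partial>\<sigma>)"
    proof (rule SUP_least)
      fix n
      show "(\<integral>\<^sup>+x. \<P> (?t n) (v j) x \<partial>\<nu>) \<le> (\<integral>\<^sup>+x. v j x \<partial>\<sigma>)"
      proof (rule potential_domination[OF \<sigma> \<nu> dom h(1) fin(1) v_meas _ _ v_super t_pos])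
        show "v j x \<le> 1" for x
          using hitting_le_1[of "U j" 0 x] by (simp add: v_def min.coboundedI1)
        show "v j x \<le> ?R x" for x
          by (simp add: v_def)
      qed
    qed
    finally show ?thesis .
  qed
  \<comment> \<open>Under \<open>\<sigma>\<close> almost every point lies off \<open>K\<close>,
    where the hitting probabilities tend to zero; the potential of \<open>h\<close> is the
    integrable majorant.\<close>
  have "(\<lambda>j. \<integral>\<^sup>+x. v j x \<partial>\<sigma>) \<longlonglongrightarrow> (\<integral>\<^sup>+x. 0 \<partial>\<sigma>)"
  proof (rule nn_integral_dominated_convergence[where u'="\<lambda>_. 0" and w="?R"])
    have "AE x in \<sigma>. x \<notin> K"
      using K(3) by (intro AE_not_in) (auto simp: null_sets_def \<sigma>(1))
    then show "AE x in \<sigma>. (\<lambda>j. v j x) \<longlonglongrightarrow> 0"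
    proof eventually_elim
      case (elim x)
      show ?case
        by (rule tendsto_sandwich[OF _ _ tendsto_const lim[OF elim]]) (auto simp: v_def)
    qed
  qed (use fin(2) in \<open>auto simp: v_def\<close>)
  then have "(\<integral>\<^sup>+x. indicator K x * q' x \<partial>\<nu>) \<le> 0"
    using main by (intro LIMSEQ_le_const[where X="\<lambda>j. \<integral>\<^sup>+x. v j x \<partial>\<sigma>"]) auto
  then have "AE x in \<nu>. indicator K x * q' x = 0"
    by (subst nn_integral_0_iff_AE[symmetric]) auto
  then have "AE x in \<nu>. x \<notin> K"
  proof eventually_elim
    case (elim x)
    then show ?case
      using q'_pos[of x] by (auto simp: indicator_def split: if_splits)
  qed
  then have "emeasure \<nu> {x \<in> space \<nu>. \<not> x \<notin> K} = 0"
    by (subst (asm) AE_iff_measurable[OF _ refl]) auto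
  then show ?thesis
    using sets_eq_imp_space_eq[OF \<nu>(1)] by simp
qed

end

theorem theorem6p1:
  fixes m :: "'a::{metric_space, second_countable_topology} measure"
    and D :: "('a \<Rightarrow> real) set"
    and \<E> :: "('a \<Rightarrow> real) \<Rightarrow> ('a \<Rightarrow> real) \<Rightarrow> real"
    and M :: "'w measure"
    and F :: "ennreal \<Rightarrow> 'w measure"
    and P :: "'a option \<Rightarrow> 'w measure"
    and X :: "ennreal \<Rightarrow> 'w \<Rightarrow> 'a option"
    and r :: "real \<Rightarrow> 'a \<Rightarrow> 'a \<Rightarrow> ennreal"
    and \<mu> \<mu>c \<mu>d :: "'a smeasure"
    and u :: "'a \<Rightarrow> ereal"
  assumes "locally_compact_space (euclidean :: 'a topology)"
    and "radon_measure m" and "full_support m"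
    and "dirichlet_form m D \<E>" and "regular_form m D \<E>" and "transient_form m D \<E>"
    and "hunt_process M F P X" and "symmetric_process m P X"
    and "associated_process m D \<E> P X"
    and "absolutely_continuous_resolvent m P X"
    and "resolvent_kernel m P X r"
    and "\<mu> \<in> class_M m D \<E> (r 0)"
    and "capacity_decomposition m D \<E> \<mu> \<mu>c \<mu>d"
    and "is_solution m D \<E> (r 0) \<mu> u"
    and "\<forall>x. 0 \<le> u x"
  shows "nonneg_smeasure \<mu>c"
proof -
  interpret hunt_dirichlet M F P X m D \<E> r
    by (intro hunt_dirichlet.intro hunt_process_lc.intro hunt_process_lc_axioms.intro
        hunt_dirichlet_axioms.intro assms)
  have signed: "signed_borel \<mu>" and pot: "quasi_everywhere m D \<E> (\<lambda>x. (\<integral>\<^sup>+y. r 0 x y \<partial>tvar \<mu>) < \<infinity>)"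
    using \<open>\<mu> \<in> class_M m D \<E> (r 0)\<close> by (auto simp: class_M_def)
  have sets_pos: "sets (pos_part \<mu>) = sets borel" and sets_neg: "sets (neg_part \<mu>) = sets borel"
    using signed by (auto simp: signed_borel_def)
  \<comment> \<open>A Hahn set: the positive part lives on \<open>S\<close>, the negative part off
    it.\<close>
  obtain S where S: "S \<in> sets borel" "emeasure (pos_part \<mu>) (- S) = 0" "emeasure (neg_part \<mu>) S = 0"
    using signed by (auto simp: signed_borel_def)
  have pos_le: "pos_part \<mu> \<le> tvar \<mu>" and neg_le: "neg_part \<mu> \<le> tvar \<mu>"
    using sets_pos sets_neg by (auto simp: le_measure emeasure_tvar[OF signed])
  have int_pos: "(\<integral>\<^sup>+y. f y \<partial>pos_part \<mu>) \<le> (\<integral>\<^sup>+y. f y \<partial>tvar \<mu>)"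
    and int_neg: "(\<integral>\<^sup>+y. f y \<partial>neg_part \<mu>) \<le> (\<integral>\<^sup>+y. f y \<partial>tvar \<mu>)" for f
    using sets_pos sets_neg by (auto intro!: nn_integral_mono_measure pos_le neg_le)
  have fin: "AE x in m. (\<integral>\<^sup>+y. r 0 x y \<partial>tvar \<mu>) < \<infinity>"
    by (rule quasi_everywhere_AE[OF pot])
  have fin_pos: "AE x in m. (\<integral>\<^sup>+y. r 0 x y \<partial>pos_part \<mu>) < \<infinity>"
    using fin by eventually_elim (rule le_less_trans[OF int_pos])
  have fin_neg: "AE x in m. (\<integral>\<^sup>+y. r 0 x y \<partial>neg_part \<mu>) < \<infinity>"
    using fin by eventually_elim (rule le_less_trans[OF int_neg])
  note sf_pos = sigma_finite_of_potential[OF sets_pos fin_pos]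
    and sf_neg = sigma_finite_of_potential[OF sets_neg fin_neg]
  have "quasi_everywhere m D \<E> (\<lambda>x. u x = potential (r 0) \<mu> x)"
    using \<open>is_solution m D \<E> (r 0) \<mu> u\<close> by (simp add: is_solution_def)
  from quasi_everywhere_AE[OF this] fin_pos fin_neg
  \<comment> \<open>Both potentials are finite almost everywhere, so the convention for
    \<open>\<infinity> - \<infinity>\<close> is not in force and \<open>0 \<le> u\<close> is an
    inequality between them.\<close>
  have dom: "AE x in m. (\<integral>\<^sup>+y. r 0 x y \<partial>neg_part \<mu>) \<le> (\<integral>\<^sup>+y. r 0 x y \<partial>pos_part \<mu>)"
  proof eventually_elim
    case (elim x)
    have "0 \<le> u x"
      using \<open>\<forall>x. 0 \<le> u x\<close> by simp
    also have "u x = enn2ereal (\<integral>\<^sup>+y. r 0 x y \<partial>pos_part \<mu>) - enn2ereal (\<integral>\<^sup>+y. r 0 x y \<partial>neg_part \<mu>)"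
      using elim by (simp add: potential_def Let_def less_top)
    finally have diff: "0 \<le> enn2ereal (\<integral>\<^sup>+y. r 0 x y \<partial>pos_part \<mu>) - enn2ereal (\<integral>\<^sup>+y. r 0 x y \<partial>neg_part \<mu>)" .
    have "b \<le> a" if "0 \<le> enn2ereal a - enn2ereal b" "a < \<infinity>" "b < \<infinity>" for a b
      using that by (cases a; cases b) (auto simp: enn2ereal_ennreal ennreal_leI)
    from this[OF diff elim(2,3)] show ?case .
  qed
  \<comment> \<open>Taken for the total variation, so that one \<open>h\<close> serves both
    parts.\<close>
  obtain h where h: "h \<in> borel_measurable borel" "AE x in m. 0 < h x"
      and fin_h: "(\<integral>\<^sup>+x. resolvent P X 0 h x \<partial>tvar \<mu>) < \<infinity>"
    by (rule potential_charge_pos[OF sets_tvar fin])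
  note fin_h_pos = le_less_trans[OF int_pos fin_h] and fin_h_neg = le_less_trans[OF int_neg fin_h]
  have signed_c: "signed_borel \<mu>c"
    and split: "\<And>B. B \<in> sets borel \<Longrightarrow> emeasure (neg_part \<mu>) B = emeasure (neg_part \<mu>c) B + emeasure (neg_part \<mu>d) B"
    using \<open>capacity_decomposition m D \<E> \<mu> \<mu>c \<mu>d\<close> by (auto simp: capacity_decomposition_def)
  obtain N where N: "N \<in> sets borel" "capacity m D \<E> N = 0" "emeasure (tvar \<mu>c) (- N) = 0"
    using \<open>capacity_decomposition m D \<E> \<mu> \<mu>c \<mu>d\<close> by (auto simp: capacity_decomposition_def)
  have sets_c: "sets (neg_part \<mu>c) = sets borel"
    using signed_c by (simp add: signed_borel_def)
  \<comment> \<open>A closed subset of \<open>N - S\<close> has capacity zero and carries no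
    positive mass, which is the situation of \<open>polar_domination\<close>.\<close>
  have null: "emeasure (neg_part \<mu>) (N - S) = 0"
  proof (rule ccontr)
    assume "emeasure (neg_part \<mu>) (N - S) \<noteq> 0"
    then have "0 < emeasure (neg_part \<mu>) (N - S)"
      by (simp add: zero_less_iff_neq_zero)
    then obtain K where K: "closed K" "K \<subseteq> N - S" "0 < emeasure (neg_part \<mu>) K"
      using sigma_finite_closed_subset_pos[OF sets_neg sf_neg] N(1) S(1) by (metis sets.Diff)
    have "capacity m D \<E> K \<le> capacity m D \<E> N"
      using K(2) by (intro capacity_mono) auto
    then have cap: "capacity m D \<E> K = 0"
      using N(2) by simp
    have "emeasure (pos_part \<mu>) K \<le> emeasure (pos_part \<mu>) (- S)"
      using K(2) S(1) sets_pos by (intro emeasure_mono) auto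
    then have "emeasure (pos_part \<mu>) K = 0"
      using S(2) by simp
    from polar_domination[OF sets_pos sf_pos sets_neg sf_neg dom h fin_h_neg fin_h_pos K(1) cap this]
    show False
      using K(3) by simp
  qed
  \<comment> \<open>The sets \<open>N - S\<close>, \<open>S\<close> and \<open>- N\<close> cover the
    space. The negative part of \<open>\<mu>c\<close> is below that of \<open>\<mu>\<close> on the
    first two, and \<open>\<mu>c\<close> does not charge the third.\<close>
  have "emeasure (neg_part \<mu>c) B = 0" if B: "B \<in> sets borel" for B
  proof -
    have "emeasure (neg_part \<mu>c) (N - S) = 0" "emeasure (neg_part \<mu>c) S = 0"
      using split[of "N - S"] split[of S] null S N(1) by simp_all
    moreover have "emeasure (neg_part \<mu>c) (- N) = 0"
      using N emeasure_tvar[OF signed_c, of "- N"] by simp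
    ultimately have nulls: "(N - S) \<union> S \<union> - N \<in> null_sets (neg_part \<mu>c)"
      using N(1) S(1) by (intro null_sets.Un) (auto simp: null_sets_def sets_c)
    show ?thesis
      by (rule emeasure_eq_0[OF null_setsD2[OF nulls] null_setsD1[OF nulls]]) auto
  qed
  then show ?thesis
    by (simp add: nonneg_smeasure_def)
qed

end
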